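(* Let $(Y,\mathcal{C},\nu,T)$ be an ergodic, infinite measure-preserving system. Suppose a finite partition $\beta$ of $Y$ is uniform relative to $K_\beta$, and suppose a finite partition $\alpha_0$ of $Y$ is such that $\alpha_0\succcurlyeq\beta$. Let $0<\epsilon<1$. Then there exists a finite partition $\alpha$ of $Y$ (with the same number of atoms as $\alpha_0$) such that $\alpha\succcurlyeq\beta$, $\alpha$ is uniform relative to $K_\alpha$, and $d(\alpha_0,\alpha)<\epsilon$.
   Context: All relations among measurable sets and all properties of maps between measure spaces are understood up to sets of measure zero. A non-atomic, infinite Lebesgue space is a measure space isomorphic to $\mathbb{R}$ with Lebesgue measurable sets and Lebesgue measure. An infinite measure-preserving system $(Y,\mathcal{C},\nu,T)$ is a non-atomic, infinite Lebesgue space with a bijection $T:Y\to Y$ such that $T,T^{-1}$ are measurable and $\nu(T^{-1}E)=\nu(E)$ for all $E\in\mathcal{C}$; it is ergodic if every $T$-invariant $B\in\mathcal{C}$ has $\nu(B)=0$ or $\nu(Y\setminus B)=0$. Let $\mathcal{C}_0=\{C\in\mathcal{C}:0<\nu(C)<\infty\}$. A finite partition of $Y$ is a measurable partition $\alpha=\{A_1,\dots,A_N\}$, $N\ge2$, with a unique atom of infinite measure, always indexed so that $\nu(A_1)=\infty$; put $K_\alpha=Y\setminus A_1$, with $\nu(K_\alpha)>0$, so that $K_\alpha\in\mathcal{C}_0$. For finite partitions $\alpha=\{A_1,\dots,A_N\}$, $\beta=\{B_1,\dots,B_N\}$ with equally many atoms set $d(\alpha,\beta)=\sum_{i\ne1}\nu(A_i\triangle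 B_i)$. A partition $\alpha$ is finer than (refines) $\beta$ if each atom of $\beta$ is a union of atoms of $\alpha$. Write $\alpha\succcurlyeq\beta$ if $\alpha$ is finer than $\beta$ and $K_\alpha=K_\beta$. The join is $\alpha\vee\beta=\{A\cap B:A\in\alpha,B\in\beta\}$, and $\alpha_m^n=\bigvee_{i=m}^nT^{-i}\alpha$ for $m\le n$. For a function $f$ on $Y$, $T_Nf=\sum_{i=-N}^{N-1}f\circ T^i$. A set $C\in\mathcal{C}_0$ is uniform relative to $K\in\mathcal{C}_0$ if for every $\epsilon>0$ there is $m\in\mathbb{N}$ such that for a.e. $y\in K$ and all $N\in\mathbb{N}$, $T_N\mathbf{1}_K(y)\ge m$ implies $\left|\frac{T_N\mathbf{1}_C(y)}{T_N\mathbf{1}_K(y)}-\frac{\nu(C)}{\nu(K)}\right|<\epsilon$. A finite partition $\alpha$ is uniform relative to $K$ if all sets (of positive and) finite measure in $\bigcup_{n\in\mathbb{N}}\alpha_{-n}^{n-1}$ are uniform relative to $K$. *)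

theory Defs
  imports "HOL-Analysis.Analysis"
begin

text \<open>
  Throughout, relations among measurable sets and properties of maps are read modulo null sets.
\<close>

definition eq_mod0 :: "'a measure \<Rightarrow> 'a set \<Rightarrow> 'a set \<Rightarrow> bool" where
  "eq_mod0 M A B \<longleftrightarrow> sym_diff A B \<in> null_sets M"

text \<open>
  \<open>f\<close> is an isomorphism of measure spaces modulo null sets, with inverse \<open>g\<close>. An everywhere
  defined measure-preserving bijection with measurable inverse is the special case where the two
  almost-everywhere conditions hold everywhere. That \<open>g\<close> preserves the measure follows.
\<close>

definition iso_mod0 :: "'a measure \<Rightarrow> 'b measure \<Rightarrow> ('a \<Rightarrow> 'b) \<Rightarrow> ('b \<Rightarrow> 'a) \<Rightarrow> bool" where
  "iso_mod0 M N f g \<longleftrightarrow>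
     f \<in> measurable M N \<and> g \<in> measurable N M \<and>
     (AE x in M. g (f x) = x) \<and> (AE y in N. f (g y) = y) \<and>
     (\<forall>E\<in>sets N. emeasure M (f -` E \<inter> space M) = emeasure N E)"

definition infinite_lebesgue_space :: "'a measure \<Rightarrow> bool" where
  "infinite_lebesgue_space M \<longleftrightarrow> (\<exists>f g. iso_mod0 M (lebesgue :: real measure) f g)"

text \<open>The inverse \<open>S\<close> of \<open>T\<close> is carried along explicitly; it is determined by \<open>T\<close> modulo null sets.\<close>

definition infinite_mps :: "'a measure \<Rightarrow> ('a \<Rightarrow> 'a) \<Rightarrow> ('a \<Rightarrow> 'a) \<Rightarrow> bool" where
  "infinite_mps M T S \<longleftrightarrow> infinite_lebesgue_space M \<and> iso_mod0 M M T S"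

definition ergodic :: "'a measure \<Rightarrow> ('a \<Rightarrow> 'a) \<Rightarrow> bool" where
  "ergodic M T \<longleftrightarrow>
     (\<forall>B\<in>sets M. eq_mod0 M (T -` B \<inter> space M) B \<longrightarrow>
        emeasure M B = 0 \<or> emeasure M (space M - B) = 0)"

definition iter :: "('a \<Rightarrow> 'a) \<Rightarrow> ('a \<Rightarrow> 'a) \<Rightarrow> int \<Rightarrow> 'a \<Rightarrow> 'a" where
  "iter T S i = (if 0 \<le> i then T ^^ nat i else S ^^ nat (- i))"

definition pos_finite_sets :: "'a measure \<Rightarrow> 'a set set" where
  "pos_finite_sets M = {C \<in> sets M. 0 < emeasure M C \<and> emeasure M C < \<infinity>}"

text \<open>
  A partition with \<open>N\<close> atoms is an indexed family \<open>A 1, \<dots>, A N\<close>. Modulo null sets, an atom being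
  non-empty means that it has positive measure.
\<close>

definition finite_partition :: "'a measure \<Rightarrow> nat \<Rightarrow> (nat \<Rightarrow> 'a set) \<Rightarrow> bool" where
  "finite_partition M N A \<longleftrightarrow>
     2 \<le> N \<and>
     (\<forall>i\<in>{1..N}. A i \<in> sets M \<and> 0 < emeasure M (A i)) \<and>
     (\<forall>i\<in>{1..N}. \<forall>j\<in>{1..N}. i \<noteq> j \<longrightarrow> A i \<inter> A j \<in> null_sets M) \<and>
     space M - (\<Union>i\<in>{1..N}. A i) \<in> null_sets M \<and>
     emeasure M (A 1) = \<infinity> \<and>
     (\<forall>i\<in>{2..N}. emeasure M (A i) < \<infinity>)"

definition finite_part :: "'a measure \<Rightarrow> (nat \<Rightarrow> 'a set) \<Rightarrow> 'a set" where
  "finite_part M A = space M - A 1"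

definition partition_dist :: "'a measure \<Rightarrow> nat \<Rightarrow> (nat \<Rightarrow> 'a set) \<Rightarrow> (nat \<Rightarrow> 'a set) \<Rightarrow> ennreal" where
  "partition_dist M N A B = (\<Sum>i\<in>{2..N}. emeasure M (sym_diff (A i) (B i)))"

definition finer :: "'a measure \<Rightarrow> nat \<Rightarrow> (nat \<Rightarrow> 'a set) \<Rightarrow> nat \<Rightarrow> (nat \<Rightarrow> 'a set) \<Rightarrow> bool" where
  "finer M k A n B \<longleftrightarrow> (\<forall>j\<in>{1..n}. \<exists>J\<subseteq>{1..k}. eq_mod0 M (B j) (\<Union>i\<in>J. A i))"

definition strongly_finer :: "'a measure \<Rightarrow> nat \<Rightarrow> (nat \<Rightarrow> 'a set) \<Rightarrow> nat \<Rightarrow> (nat \<Rightarrow> 'a set) \<Rightarrow> bool" where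
  "strongly_finer M k A n B \<longleftrightarrow>
     finer M k A n B \<and> eq_mod0 M (finite_part M A) (finite_part M B)"

definition joins :: "'i set \<Rightarrow> ('i \<Rightarrow> 'a set set) \<Rightarrow> 'a set set" where
  "joins I Q = {(\<Inter>i\<in>I. s i) | s. \<forall>i\<in>I. s i \<in> Q i}"

text \<open>The partition obtained by joining the preimages under \<open>T\<^sup>i\<close> of the atoms, for \<open>m \<le> i \<le> n\<close>.\<close>

definition iterated_join ::
    "'a measure \<Rightarrow> ('a \<Rightarrow> 'a) \<Rightarrow> ('a \<Rightarrow> 'a) \<Rightarrow> nat \<Rightarrow> (nat \<Rightarrow> 'a set) \<Rightarrow> int \<Rightarrow> int \<Rightarrow> 'a set set" where
  "iterated_join M T S N A m n =
     joins {m..n} (\<lambda>i. (\<lambda>j. iter T S i -` A j \<inter> space M) ` {1..N})"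

definition two_sided_sum ::
    "('a \<Rightarrow> 'a) \<Rightarrow> ('a \<Rightarrow> 'a) \<Rightarrow> nat \<Rightarrow> ('a \<Rightarrow> real) \<Rightarrow> 'a \<Rightarrow> real" where
  "two_sided_sum T S N f y = (\<Sum>i\<in>{- int N..int N - 1}. f (iter T S i y))"

definition uniform_set ::
    "'a measure \<Rightarrow> ('a \<Rightarrow> 'a) \<Rightarrow> ('a \<Rightarrow> 'a) \<Rightarrow> 'a set \<Rightarrow> 'a set \<Rightarrow> bool" where
  "uniform_set M T S C K \<longleftrightarrow>
     C \<in> pos_finite_sets M \<and> K \<in> pos_finite_sets M \<and>
     (\<forall>\<epsilon>>0. \<exists>m::nat. AE y in M. y \<in> K \<longrightarrow>
        (\<forall>N. two_sided_sum T S N (indicator K) y \<ge> real m \<longrightarrow>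
           \<bar>two_sided_sum T S N (indicator C) y / two_sided_sum T S N (indicator K) y
              - measure M C / measure M K\<bar> < \<epsilon>))"

definition uniform_partition ::
    "'a measure \<Rightarrow> ('a \<Rightarrow> 'a) \<Rightarrow> ('a \<Rightarrow> 'a) \<Rightarrow> nat \<Rightarrow> (nat \<Rightarrow> 'a set) \<Rightarrow> 'a set \<Rightarrow> bool" where
  "uniform_partition M T S k A K \<longleftrightarrow>
     (\<forall>n\<ge>1. \<forall>C \<in> iterated_join M T S k A (- int n) (int n - 1).
        C \<in> pos_finite_sets M \<longrightarrow> uniform_set M T S C K)"

end

theory Submission
  imports Defs
begin

text \<open>
  Let \<open>K\<close> be the common finite part. Code a point by its bi-infinite sequence of atom indices along
  the orbit, the index \<open>1\<close> meaning a time outside \<open>K\<close>, and cut this sequence at the gaps of length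
  at least \<open>R\<close> between visits to \<open>K\<close>. The resulting \<open>R\<close>-blocks are determined by \<open>K\<close> alone and are
  nested as \<open>R\<close> grows; by uniformity of \<open>\<beta>\<close> they are bounded and, as \<open>R\<close> grows, uniformly sparse.
  Every cylinder set inside \<open>K\<close> given by a window shorter than \<open>R\<close> is counted exactly by the \<open>R\<close>-blocks,
  with no boundary effects, because a block is surrounded by gaps.

  Starting from \<open>\<alpha>\<^sub>0\<close>, one increases \<open>R\<close> in stages. At each stage the longer blocks in which the
  shorter labelled blocks do not occur with the right frequencies are relabelled by a concatenation
  of shorter labelled blocks that does have them and lies over the same \<open>\<beta>\<close>-labels; such a concatenation
  exists because \<open>\<beta>\<close> is uniform. By an ergodic argument the relabelled set has small measure. Later
  stages only rearrange the labelled blocks of earlier stages, so the frequencies that have been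
  made uniform stay uniform, and the labels converge almost everywhere.
\<close>

section \<open>From symmetric windows to arbitrary intervals\<close>

text \<open>The obstacle is that ergodicity gives good frequencies only outside a set of small
  measure, while uniformity asks for them along almost every orbit with one common constant. All
  estimates therefore have the form: slope times number of visits, plus a constant independent of
  the point. Such an estimate for single words passes to long intervals by summing over blocks, at
  the price of one constant per block, and this price is again a small slope once blocks are rare.
  So in each stage the constant is fixed first and the gap length afterwards. Infinite measure makes
  gaps of every length occur with positive frequency: otherwise finitely many translates of
  \<open>K\<close> would cover the space. The count of a pattern is a linear combination of block
  counts with coefficients bounded by word lengths, and this dictates the tolerance of the next
  stage. The ergodic input is that an integrable function with negative integral has bounded forward
  sums; it is used both to bound the bad blocks and to identify the limit frequencies.\<close>

lemma sum_int_split: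
  fixes f :: "int \<Rightarrow> real"
  assumes "a \<le> c" "c \<le> b"
  shows "sum f {a..<b} = sum f {a..<c} + sum f {c..<b}"
proof -
  have "{a..<b} = {a..<c} \<union> {c..<b}" using assms by auto
  then show ?thesis by (simp add: sum.union_disjoint)
qed

lemma sum_int_snoc:
  fixes f :: "int \<Rightarrow> real"
  assumes "a \<le> b"
  shows "sum f {a..<b + 1} = sum f {a..<b} + f b"
proof -
  have "{a..<b + 1} = insert b {a..<b}" using assms by auto
  then show ?thesis by simp
qed

text \<open>Choosing symmetric windows greedily from left to right, each with about \<open>m\<close> visits, leaves gaps
  with at most as many visits as the windows. Only the gaps need the old estimate \<open>Q\<close>, so its
  slope is halved.\<close>

lemma interval_deviation_halving:
  fixes \<kappa> d :: "int \<Rightarrow> real"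
  assumes \<kappa>: "\<And>i. \<kappa> i = 0 \<or> \<kappa> i = 1" and d: "\<And>i. \<bar>d i\<bar> \<le> \<kappa> i"
    and window: "\<And>y N. \<kappa> y = 1 \<Longrightarrow> sum \<kappa> {y - int N..<y + int N} \<ge> real m \<Longrightarrow>
      \<bar>sum d {y - int N..<y + int N}\<bar> \<le> \<epsilon> * sum \<kappa> {y - int N..<y + int N}"
    and Q: "\<And>a b. a \<le> b \<Longrightarrow> \<bar>sum d {a..<b}\<bar> \<le> l * sum \<kappa> {a..<b} + c"
    and m: "m \<ge> 1" and l: "0 \<le> l" "l \<le> 1" and "0 \<le> \<epsilon>" "0 \<le> c"
  shows "a \<le> b \<Longrightarrow> \<bar>sum d {a..<b}\<bar> \<le> (l / 2 + \<epsilon> + (c + 1) / m) * sum \<kappa> {a..<b} + (2 * m + 3)"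
proof (induction "nat (b - a)" arbitrary: a rule: less_induct)
  case less
  let ?\<theta> = "l / 2 + \<epsilon> + (c + 1) / m"
  have \<theta>: "?\<theta> \<ge> 0" using assms by auto
  have \<kappa>0: "\<kappa> i \<ge> 0" for i using \<kappa>[of i] by auto
  have \<kappa>1: "\<kappa> i \<le> 1" for i using \<kappa>[of i] by auto
  have s0: "sum \<kappa> A \<ge> 0" for A by (simp add: \<kappa>0 sum_nonneg)
  have mono: "sum \<kappa> A \<le> sum \<kappa> B" if "A \<subseteq> B" "finite B" for A B
    using that \<kappa>0 by (intro sum_mono2) auto
  show ?case
  \<comment> \<open>With fewer visits the constant alone suffices. Otherwise there is room for an
    initial stretch with fewer than \<open>m + 1\<close> visits and a window with fewer than
    \<open>m + 2\<close>.\<close>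
  proof (cases "sum \<kappa> {a..<b} < 2 * m + 3")
    case True
    have "\<bar>sum d {a..<b}\<bar> \<le> sum \<kappa> {a..<b}"
      by (rule order_trans[OF sum_abs sum_mono]) (rule d)
    also have "\<dots> \<le> ?\<theta> * sum \<kappa> {a..<b} + (2 * m + 3)" using True \<theta> s0 by (simp add: add_increasing)
    finally show ?thesis by simp
  next
    case False
    \<comment> \<open>\<open>y\<close> becomes the first visit with at least \<open>m\<close> visits
      before it in the interval; a window centred there collects \<open>m\<close> visits before its
      left end passes \<open>a\<close>.\<close>
    define P where "P = (\<lambda>j::nat. sum \<kappa> {a..<a + int j + 1} \<ge> m + 1)"
    have "P (nat (b - a))" unfolding P_def
      using mono[of "{a..<b}" "{a..<a + int (nat (b - a)) + 1}"] False less.prems by simp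
    define j where "j = (LEAST j. P j)"
    have Pj: "P j" unfolding j_def by (rule LeastI) fact
    define y where "y = a + int j"
    have ya: "y \<ge> a" by (simp add: y_def)
    have lt: "sum \<kappa> {a..<y} < m + 1"
    proof (cases j)
      case 0 then show ?thesis by (simp add: y_def)
    next
      case (Suc i)
      then have "\<not> P i" unfolding j_def by (metis lessI not_less_Least)
      then show ?thesis by (simp add: P_def y_def Suc algebra_simps)
    qed
    have spl: "sum \<kappa> {a..<y + 1} = sum \<kappa> {a..<y} + \<kappa> y"
      using ya by (rule sum_int_snoc)
    have ge: "sum \<kappa> {a..<y + 1} \<ge> m + 1" using Pj by (simp add: P_def y_def)
    have ky: "\<kappa> y = 1" using spl ge lt \<kappa>[of y] by auto
    have gm: "sum \<kappa> {a..<y} \<ge> m" using spl ge ky by auto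
    have yb: "y \<le> b"
    proof (rule ccontr)
      assume "\<not> y \<le> b"
      then have "sum \<kappa> {a..<b} \<le> sum \<kappa> {a..<y}" by (intro mono) auto
      then show False using False lt by simp
    qed
    define W where "W = (\<lambda>N. {y - int N..<y + int N})"
    have W1: "sum \<kappa> (W (nat (y - a))) \<ge> m"
      using mono[of "{a..<y}" "W (nat (y - a))"] gm ya by (auto simp: W_def)
    define N where "N = (LEAST N. sum \<kappa> (W N) \<ge> m)"
    have WN: "sum \<kappa> (W N) \<ge> m" unfolding N_def by (rule LeastI, rule W1)
    have Nle: "int N \<le> y - a" using Least_le[of "\<lambda>N. sum \<kappa> (W N) \<ge> m", OF W1] ya by (simp add: N_def)
    have N0: "N \<noteq> 0"
    proof
      assume "N = 0"
      with WN have "0 \<ge> real m" by (simp add: W_def)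
      with m show False by simp
    qed
    then obtain N' where N': "N = Suc N'" by (cases N) auto
    have "\<not> sum \<kappa> (W N') \<ge> m" unfolding N' by (metis N' N_def lessI not_less_Least)
    moreover have "W N = insert (y - int N) (insert (y + int N') (W N'))" by (auto simp: W_def N')
    moreover have "sum \<kappa> (insert (y - int N) (insert (y + int N') (W N'))) \<le> sum \<kappa> (W N') + 2"
      using \<kappa>1[of "y - int N"] \<kappa>1[of "y + int N'"] by (simp add: sum.insert_if W_def \<kappa>0 add_increasing)
    ultimately have wlt: "sum \<kappa> (W N) < m + 2" by simp
    have tb: "y + int N \<le> b"
    proof (rule ccontr)
      assume "\<not> ?thesis"
      then have "sum \<kappa> {y..<b} \<le> sum \<kappa> (W N)" by (intro mono) (auto simp: W_def)
      moreover have "sum \<kappa> {a..<b} = sum \<kappa> {a..<y} + sum \<kappa> {y..<b}" using ya yb by (rule sum_int_split)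
      ultimately show False using wlt lt False by simp
    qed
    let ?g = "sum \<kappa> {a..<y - int N}" and ?w = "sum \<kappa> (W N)" and ?r = "sum \<kappa> {y + int N..<b}"
    have dec: "sum f {a..<b} = sum f {a..<y - int N} + sum f (W N) + sum f {y + int N..<b}" for f :: "int \<Rightarrow> real"
      using sum_int_split[of a "y - int N" b f] sum_int_split[of "y - int N" "y + int N" b f] Nle tb
      by (simp add: W_def)
    have glt: "?g < m + 1" using mono[of "{a..<y - int N}" "{a..<y}"] lt by simp
    have 1: "\<bar>sum d {a..<y - int N}\<bar> \<le> l * ?g + c" using Nle by (intro Q) simp
    have 2: "\<bar>sum d (W N)\<bar> \<le> \<epsilon> * ?w" using window[OF ky] WN by (simp add: W_def)
    have 3: "\<bar>sum d {y + int N..<b}\<bar> \<le> ?\<theta> * ?r + (2 * m + 3)"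
      using less.hyps[of "y + int N"] tb N0 ya by simp
    \<comment> \<open>The gap exceeds the window by less than one visit, so up to this error it
      carries at most half of the visits of both; this halves \<open>l\<close>. The leftover, at
      most \<open>c + 1\<close>, is spread over the visits of the window, at least \<open>m\<close>
      in number.\<close>
    have 4: "l * ?g + c + \<epsilon> * ?w \<le> ?\<theta> * (?g + ?w)"
    proof -
      have "l * (?g - ?w) \<le> l * 1" using glt WN l by (intro mult_left_mono) auto
      then have "l * (?g - ?w) \<le> 1" using l by simp
      moreover have "c + 1 \<le> (c + 1) / m * (?g + ?w)"
      proof -
        have "(c + 1) / m * m \<le> (c + 1) / m * (?g + ?w)"
          using assms s0[of "{a..<y - int N}"] WN by (intro mult_left_mono) auto
        then show ?thesis using m by simp
      qed
      moreover have "\<epsilon> * ?w \<le> \<epsilon> * (?g + ?w)" using assms s0 by (intro mult_left_mono) auto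
      ultimately show ?thesis by (simp add: algebra_simps)
    qed
    have "\<bar>sum d {a..<b}\<bar> \<le> (l * ?g + c) + \<epsilon> * ?w + (?\<theta> * ?r + (2 * m + 3))"
      using dec[of d] 1 2 3 by linarith
    also have "\<dots> \<le> ?\<theta> * (?g + ?w) + ?\<theta> * ?r + (2 * m + 3)" using 4 by linarith
    also have "\<dots> = ?\<theta> * sum \<kappa> {a..<b} + (2 * m + 3)" unfolding dec[of \<kappa>] by (simp add: algebra_simps)
    finally show ?thesis by simp
  qed
qed

text \<open>The iteration starts from slope 1 and constant 0, where the estimate holds because
  \<open>d\<close> is bounded by \<kappa>. A set \<open>X\<close> of pairs is used so that the
  thresholds, and hence the final constant, are common to all orbits.\<close>

lemma interval_deviation_of_windows:
  fixes X :: "((int \<Rightarrow> real) \<times> (int \<Rightarrow> real)) set"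
  assumes \<kappa>: "\<And>\<kappa> d i. (\<kappa>, d) \<in> X \<Longrightarrow> \<kappa> i = 0 \<or> \<kappa> i = 1"
    and d: "\<And>\<kappa> d i. (\<kappa>, d) \<in> X \<Longrightarrow> \<bar>d i\<bar> \<le> \<kappa> i"
    and window: "\<And>\<epsilon>. \<epsilon> > 0 \<Longrightarrow> \<exists>m::nat. \<forall>(\<kappa>, d)\<in>X. \<forall>y N. \<kappa> y = 1 \<longrightarrow> sum \<kappa> {y - int N..<y + int N} \<ge> real m \<longrightarrow>
      \<bar>sum d {y - int N..<y + int N}\<bar> \<le> \<epsilon> * sum \<kappa> {y - int N..<y + int N}"
    and "\<epsilon> > 0"
  shows "\<exists>c\<ge>0. \<forall>(\<kappa>, d)\<in>X. \<forall>a b. a \<le> b \<longrightarrow> \<bar>sum d {a..<b}\<bar> \<le> \<epsilon> * sum \<kappa> {a..<b} + c"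
proof -
  define Q where "Q = (\<lambda>l c. \<forall>(\<kappa>, d)\<in>X. \<forall>a b. a \<le> b \<longrightarrow> \<bar>sum d {a..<b}\<bar> \<le> l * sum \<kappa> {a..<b} + c)"
  have nn: "sum \<kappa> A \<ge> 0" if "(\<kappa>, d) \<in> X" for \<kappa> d A
    using \<kappa>[OF that] by (intro sum_nonneg) (metis order_refl zero_le_one)
  have Qmono: "Q l' c" if "Q l c" "l \<le> l'" for l l' c
    unfolding Q_def
  proof (clarify)
    fix \<kappa> d and a b :: int assume X: "(\<kappa>, d) \<in> X" and ab: "a \<le> b"
    have "\<bar>sum d {a..<b}\<bar> \<le> l * sum \<kappa> {a..<b} + c" using that X ab by (auto simp: Q_def)
    also have "\<dots> \<le> l' * sum \<kappa> {a..<b} + c" using that nn[OF X] by (simp add: mult_right_mono)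
    finally show "\<bar>sum d {a..<b}\<bar> \<le> l' * sum \<kappa> {a..<b} + c" .
  qed
  \<comment> \<open>The map taking a slope \<open>l\<close> to \<open>l / 2 + 2 * e\<close> has the
    fixed point \<open>4 * e\<close>; the factor 8 leaves another \<open>4 * e\<close> for the
    distance that remains after finitely many halvings. The cap at 1/8 keeps all slopes between 0
    and 1.\<close>
  define e where "e = min \<epsilon> 1 / 8"
  have e: "e > 0" "e \<le> 1 / 8" "8 * e \<le> \<epsilon>" using assms by (auto simp: e_def min_def)
  have "\<exists>c\<ge>0. Q ((1/2) ^ j * (1 - 4 * e) + 4 * e) c" for j :: nat
  proof (induction j)
    case 0
    have "Q 1 0" unfolding Q_def
    proof clarify
      fix \<kappa> d and a b :: int assume X: "(\<kappa>, d) \<in> X"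
      show "\<bar>sum d {a..<b}\<bar> \<le> 1 * sum \<kappa> {a..<b} + 0"
        using order_trans[OF sum_abs sum_mono, of "{a..<b}" d \<kappa>] d[OF X] by simp
    qed
    then show ?case by auto
  next
    case (Suc j)
    let ?l = "(1/2) ^ j * (1 - 4 * e) + 4 * e"
    obtain c where c: "c \<ge> 0" "Q ?l c" using Suc by auto
    obtain m0 :: nat where m0: "\<forall>(\<kappa>, d)\<in>X. \<forall>y N. \<kappa> y = 1 \<longrightarrow> sum \<kappa> {y - int N..<y + int N} \<ge> real m0 \<longrightarrow>
      \<bar>sum d {y - int N..<y + int N}\<bar> \<le> e * sum \<kappa> {y - int N..<y + int N}"
      using window e by meson
    obtain m1 :: nat where m1: "(c + 1) / e \<le> m1" using real_arch_simple by blast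
    define m where "m = max (max m0 m1) 1"
    have m: "m \<ge> 1" "m \<ge> m0" "(c + 1) / m \<le> e"
    proof -
      have "(c + 1) / e \<le> m" using m1 by (auto simp: m_def)
      then show "(c + 1) / m \<le> e" using e by (simp add: field_simps m_def)
    qed (auto simp: m_def)
    have l: "0 \<le> ?l" "?l \<le> 1"
    proof -
      have "(1/2) ^ j * (1 - 4 * e) \<le> 1 * (1 - 4 * e)"
        using e by (intro mult_right_mono power_le_one) auto
      then show "?l \<le> 1" by simp
    qed (use e in auto)
    have "Q (?l / 2 + e + (c + 1) / m) (2 * m + 3)" unfolding Q_def
    proof (clarify)
      fix \<kappa> d and a b :: int assume X: "(\<kappa>, d) \<in> X" and ab: "a \<le> b"
      show "\<bar>sum d {a..<b}\<bar> \<le> (?l / 2 + e + (c + 1) / m) * sum \<kappa> {a..<b} + real (2 * m + 3)"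
        using interval_deviation_halving[of \<kappa> d m e ?l c a b, OF \<kappa>[OF X] d[OF X]] m0 X c l m e ab
        by (force simp: Q_def)
    qed
    then have "Q (?l / 2 + 2 * e) (2 * m + 3)" by (rule Qmono) (use m in auto)
    moreover have "?l / 2 + 2 * e = (1/2) ^ Suc j * (1 - 4 * e) + 4 * e" by (simp add: field_simps)
    ultimately show ?case by (metis of_nat_0_le_iff)
  qed note * = this
  obtain j :: nat where j: "(1/2) ^ j < 4 * e"
    using real_arch_pow_inv[of "4 * e" "1/2"] e by auto
  obtain c where c: "c \<ge> 0" "Q ((1/2) ^ j * (1 - 4 * e) + 4 * e) c" using *[of j] by auto
  have "(1/2) ^ j * (1 - 4 * e) \<le> (1/2) ^ j * 1" using e by (intro mult_left_mono) auto
  then have "Q \<epsilon> c" by (intro Qmono[OF c(2)]) (use j e in linarith)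
  with c show ?thesis unfolding Q_def by blast
qed

section \<open>Blocks of a symbolic sequence\<close>

definition shift :: "int \<Rightarrow> (int \<Rightarrow> nat) \<Rightarrow> int \<Rightarrow> nat" where
  "shift i x = (\<lambda>j. x (i + j))"

definition gap_end :: "nat \<Rightarrow> (int \<Rightarrow> nat) \<Rightarrow> int \<Rightarrow> bool" where
  "gap_end R x i \<longleftrightarrow> x i \<noteq> 1 \<and> (\<forall>j\<in>{i<..i + int R}. x j = 1)"

text \<open>Excluding every gap end before \<open>e\<close> makes a block the interval between two
  consecutive gaps; gaps shorter than \<open>R\<close> may remain inside.\<close>

definition block :: "nat \<Rightarrow> (int \<Rightarrow> nat) \<Rightarrow> int \<Rightarrow> int \<Rightarrow> bool" where
  "block R x s e \<longleftrightarrow> s \<le> e \<and> x s \<noteq> 1 \<and> (\<forall>j\<in>{s - int R..<s}. x j = 1) \<and> gap_end R x e \<and>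
     (\<forall>j\<in>{s..<e}. \<not> gap_end R x j)"

definition factor :: "(int \<Rightarrow> nat) \<Rightarrow> int \<Rightarrow> int \<Rightarrow> nat list" where
  "factor x s e = map x [s..e]"

text \<open>Padding with 1 surrounds a word by infinite gaps, so blocks and patterns inside a finite
  word are covered by the notions for sequences.\<close>

definition extend :: "nat list \<Rightarrow> int \<Rightarrow> nat" where
  "extend v i = (if 0 \<le> i \<and> i < int (length v) then v ! nat i else 1)"

text \<open>An occurrence is a whole \<open>R\<close>-block, not merely a factor; hence occurrences
  at different positions never overlap.\<close>

definition occurs :: "nat \<Rightarrow> (int \<Rightarrow> nat) \<Rightarrow> nat list \<Rightarrow> int \<Rightarrow> bool" where
  "occurs R x v i \<longleftrightarrow> block R x i (i + int (length v) - 1) \<and> factor x i (i + int (length v) - 1) = v"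

definition visit :: "(int \<Rightarrow> nat) \<Rightarrow> int \<Rightarrow> real" where
  "visit x i = of_bool (x i \<noteq> 1)"

text \<open>Frequencies are per visit to \<open>K\<close>, as in the quotient that defines
  uniformity; multiplied out, the estimate makes sense also on intervals without visits and can be
  added over adjacent intervals.\<close>

abbreviation near_freq :: "(int \<Rightarrow> bool) \<Rightarrow> real \<Rightarrow> real \<Rightarrow> real \<Rightarrow> (int \<Rightarrow> nat) \<Rightarrow> bool" where
  "near_freq A q \<epsilon> c x \<equiv> (\<forall>s e. s \<le> e \<longrightarrow>
     \<bar>(\<Sum>i\<in>{s..<e}. of_bool (A i)) - q * sum (visit x) {s..<e}\<bar> \<le> \<epsilon> * sum (visit x) {s..<e} + c)"

lemma length_factor [simp]: "length (factor x s e) = nat (e - s + 1)"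
  by (simp add: factor_def)

lemma nth_factor: "i < nat (e - s + 1) \<Longrightarrow> factor x s e ! i = x (s + int i)"
  by (simp add: factor_def nth_upto)

lemma factor_eq_iff:
  "factor x s e = v \<longleftrightarrow> length v = nat (e - s + 1) \<and> (\<forall>i<length v. x (s + int i) = v ! i)"
  by (auto simp: list_eq_iff_nth_eq nth_factor)

lemma map_factor: "map f (factor x s e) = factor (\<lambda>i. f (x i)) s e"
  by (simp add: factor_def)

section \<open>Existence, uniqueness and nesting of blocks\<close>

lemma gap_end_before_gap:
  assumes "x s \<noteq> 1" "s < t" "\<forall>j\<in>{t - int R..<t}. x j = 1"
  shows "\<exists>j. s \<le> j \<and> j < t \<and> gap_end R x j"
proof -
  define A where "A = {j\<in>{s..<t}. x j \<noteq> 1}"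
  have A: "finite A" by (rule finite_subset[of A "{s..<t}"]) (auto simp: A_def)
  have "s \<in> A" using assms by (simp add: A_def)
  then have A': "A \<noteq> {}" by auto
  define j where "j = Max A"
  have jA: "j \<in> A" unfolding j_def using A A' by (rule Max_in)
  have "gap_end R x j" unfolding gap_end_def
  proof (intro conjI ballI)
    show "x j \<noteq> 1" using jA by (simp add: A_def)
    fix k assume k: "k \<in> {j<..j + int R}"
    have "j < t - int R" using jA assms(3) by (force simp: A_def)
    with k have "k < t" by simp
    have "k \<notin> A" using k Max_ge[OF A, of k] by (auto simp: j_def)
    then show "x k = 1" using k \<open>k < t\<close> jA by (auto simp: A_def)
  qed
  then show ?thesis using jA by (auto simp: A_def)
qed

text \<open>A gap of length at least \<open>R'\<close> is also one of length at least
  \<open>R\<close>, so an end of the longer block cannot fall inside the shorter one. On the left,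
  \<open>gap_end_before_gap\<close> converts the gap in front of \<open>s'\<close> into a gap
  end.\<close>

lemma block_subset:
  assumes "block R x s e" "block R' x s' e'" "R \<le> R'" "s \<le> i" "i \<le> e" "s' \<le> i" "i \<le> e'"
  shows "s' \<le> s" "e \<le> e'"
proof -
  have "gap_end R x e'" using assms(2,3) by (auto simp: block_def gap_end_def)
  then show "e \<le> e'" using assms by (force simp: block_def)
  show "s' \<le> s"
  proof (rule ccontr)
    assume "\<not> s' \<le> s"
    then have "\<exists>j. s \<le> j \<and> j < s' \<and> gap_end R x j"
      using assms by (intro gap_end_before_gap) (auto simp: block_def)
    then show False using assms by (force simp: block_def)
  qed
qed

lemma block_unique:
  assumes "block R x s e" "block R x s' e'" "s \<le> i" "i \<le> e" "s' \<le> i" "i \<le> e'"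
  shows "s = s'" "e = e'"
  using block_subset[OF assms(1,2) order_refl assms(3-)] block_subset[OF assms(2,1) order_refl assms(5,6,3,4)]
  by auto

text \<open>The start is the last position up to \<open>i\<close> that is preceded by
  \<open>R\<close> ones, the end is the first gap end from \<open>i\<close> on. A gap end between
  the start and \<open>i\<close> would yield a later candidate for the start.\<close>

lemma block_exists:
  assumes i: "x i \<noteq> 1" and t: "t \<le> i" "\<forall>j\<in>{t - int R..<t}. x j = 1" and g: "gap_end R x g" "i \<le> g"
  shows "\<exists>s e. block R x s e \<and> t \<le> s \<and> s \<le> i \<and> i \<le> e \<and> e \<le> g"
proof -
  define A where "A = {t'\<in>{t..i}. \<forall>j\<in>{t' - int R..<t'}. x j = 1}"
  have A: "finite A" by (rule finite_subset[of A "{t..i}"]) (auto simp: A_def)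
  have "t \<in> A" using t by (simp add: A_def)
  then have A': "A \<noteq> {}" by auto
  define s where "s = Max A"
  have sA: "s \<in> A" unfolding s_def using A A' by (rule Max_in)
  have smax: "t' \<le> s" if "t' \<in> A" for t' using Max_ge[OF A that] by (simp add: s_def)
  have xs: "x s \<noteq> 1"
  proof
    assume xs: "x s = 1"
    then have "s \<noteq> i" using i by auto
    have "x j = 1" if "s + 1 - int R \<le> j" "j < s + 1" for j
      using sA that xs by (cases "j = s") (auto simp: A_def)
    then have "s + 1 \<in> A" using sA \<open>s \<noteq> i\<close> by (auto simp: A_def)
    then show False using smax by force
  qed
  define G where "G = {j\<in>{i..g}. gap_end R x j}"
  have G: "finite G" by (rule finite_subset[of G "{i..g}"]) (auto simp: G_def)
  have "g \<in> G" using g by (simp add: G_def)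
  then have G': "G \<noteq> {}" by auto
  define e where "e = Min G"
  have eG: "e \<in> G" unfolding e_def using G G' by (rule Min_in)
  have emin: "e \<le> j" if "j \<in> G" for j using Min_le[OF G that] by (simp add: e_def)
  have "\<not> gap_end R x j" if j: "s \<le> j" "j < e" for j
  proof
    assume gj: "gap_end R x j"
    show False
    proof (cases "i \<le> j")
      case True
      then have "j \<in> G" using gj j eG by (auto simp: G_def)
      then show False using emin[of j] j by simp
    next
      case False
      then have "j + int R < i" using gj i by (force simp: gap_end_def)
      then have "j + int R + 1 \<in> A" using gj j sA by (auto simp: A_def gap_end_def)
      then show False using smax[of "j + int R + 1"] j by simp
    qed
  qed
  then have "block R x s e" using sA eG xs by (auto simp: block_def A_def G_def)
  then show ?thesis using sA eG by (auto simp: A_def G_def)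
qed

section \<open>Locality of blocks, and words padded with ones\<close>

lemma block_cong_support:
  assumes "\<And>i. x i = 1 \<longleftrightarrow> y i = 1"
  shows "block R x s e \<longleftrightarrow> block R y s e"
  using assms unfolding block_def gap_end_def by simp

lemma gap_end_cong_window:
  assumes "\<And>j. i \<le> j \<Longrightarrow> j \<le> i + int R \<Longrightarrow> x (a + j) = y j"
  shows "gap_end R x (a + i) \<longleftrightarrow> gap_end R y i"
proof -
  have "x (a + i) = y i" using assms by simp
  moreover have "(\<forall>j\<in>{a + i<..a + i + int R}. x j = 1) \<longleftrightarrow> (\<forall>j\<in>{i<..i + int R}. y j = 1)"
  proof safe
    fix j assume *: "\<forall>j\<in>{a + i<..a + i + int R}. x j = 1" "j \<in> {i<..i + int R}"
    then show "y j = 1" using assms[of j] by auto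
  next
    fix j assume *: "\<forall>j\<in>{i<..i + int R}. y j = 1" "j \<in> {a + i<..a + i + int R}"
    then show "x j = 1" using assms[of "j - a"] by auto
  qed
  ultimately show ?thesis by (simp add: gap_end_def)
qed

text \<open>With the offset \<open>a\<close> the lemma compares a sequence with its shifts as well
  as with padded words.\<close>

lemma block_cong_window:
  assumes "\<And>j. s - int R \<le> j \<Longrightarrow> j \<le> e + int R \<Longrightarrow> x (a + j) = y j"
  shows "block R x (a + s) (a + e) \<longleftrightarrow> block R y s e"
proof (cases "s \<le> e")
  case True
  have g: "gap_end R x (a + i) \<longleftrightarrow> gap_end R y i" if "s \<le> i" "i \<le> e" for i
    using that by (intro gap_end_cong_window assms) auto
  have 1: "x (a + s) = y s" using assms True by simp
  have 2: "(\<forall>j\<in>{a + s - int R..<a + s}. x j = 1) \<longleftrightarrow> (\<forall>j\<in>{s - int R..<s}. y j = 1)"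
  proof safe
    fix j assume *: "\<forall>j\<in>{a + s - int R..<a + s}. x j = 1" "j \<in> {s - int R..<s}"
    then show "y j = 1" using assms[of j] True by auto
  next
    fix j assume *: "\<forall>j\<in>{s - int R..<s}. y j = 1" "j \<in> {a + s - int R..<a + s}"
    then show "x j = 1" using assms[of "j - a"] True by auto
  qed
  have 3: "(\<forall>j\<in>{a + s..<a + e}. \<not> gap_end R x j) \<longleftrightarrow> (\<forall>j\<in>{s..<e}. \<not> gap_end R y j)"
  proof safe
    fix j assume *: "\<forall>j\<in>{a + s..<a + e}. \<not> gap_end R x j" "j \<in> {s..<e}" "gap_end R y j"
    then show False using g[of j] by auto
  next
    fix j assume *: "\<forall>j\<in>{s..<e}. \<not> gap_end R y j" "j \<in> {a + s..<a + e}" "gap_end R x j"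
    then show False using g[of "j - a"] by auto
  qed
  show ?thesis unfolding block_def using 1 2 3 g[of e] True by simp
qed (simp add: block_def)

lemma occurs_cong_window:
  assumes "\<And>j. i - int R \<le> j \<Longrightarrow> j < i + int (length v) + int R \<Longrightarrow> x (a + j) = y j"
  shows "occurs R x v (a + i) \<longleftrightarrow> occurs R y v i"
proof -
  have "block R x (a + i) (a + (i + int (length v) - 1)) \<longleftrightarrow> block R y i (i + int (length v) - 1)"
    using assms by (intro block_cong_window) auto
  moreover have "factor x (a + i) (a + (i + int (length v) - 1)) = factor y i (i + int (length v) - 1)"
    unfolding factor_eq_iff
  proof (intro conjI allI impI)
    fix j assume j: "j < length (factor y i (i + int (length v) - 1))"
    then have "x (a + (i + int j)) = y (i + int j)" by (intro assms) auto
    then show "x (a + i + int j) = factor y i (i + int (length v) - 1) ! j"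
      using j by (simp add: nth_factor add.assoc)
  qed simp
  ultimately show ?thesis by (simp add: occurs_def algebra_simps)
qed

lemma occurs_shift: "occurs R (shift a x) v i \<longleftrightarrow> occurs R x v (a + i)"
  by (rule occurs_cong_window[symmetric]) (simp add: shift_def)

lemma block_shift: "block R (shift a x) s e \<longleftrightarrow> block R x (a + s) (a + e)"
  by (rule block_cong_window[symmetric]) (simp add: shift_def)

lemma factor_shift: "factor (shift a x) s e = factor x (a + s) (a + e)"
  by (auto simp: factor_eq_iff nth_factor shift_def algebra_simps)

lemma extend_factor_block:
  assumes "block R x s e" "- int R \<le> j" "j \<le> e - s + int R"
  shows "x (s + j) = extend (factor x s e) j"
proof (cases "0 \<le> j \<and> j \<le> e - s")
  case True
  then show ?thesis by (simp add: extend_def nth_factor)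
next
  case False
  then have "s + j \<in> {s - int R..<s} \<or> s + j \<in> {e<..e + int R}" using assms by auto
  then have "x (s + j) = 1" using assms(1) by (auto simp: block_def gap_end_def)
  then show ?thesis using False by (auto simp: extend_def)
qed

lemma occurs_block: "block R x s e \<Longrightarrow> occurs R x (factor x s e) s"
  by (auto simp: occurs_def block_def)

lemma occurs_extend_bounds:
  assumes "occurs R (extend v) u i"
  shows "0 \<le> i" "i + int (length u) \<le> int (length v)" "u \<noteq> []"
  using assms by (auto simp: occurs_def block_def gap_end_def extend_def split: if_splits)

text \<open>The longer block is surrounded by gaps of length at least \<open>R\<close>, so its
  \<open>R\<close>-blocks stay the same when the rest of the sequence is replaced by ones. This
  makes occurrence counts a function of the word alone.\<close>

lemma occurs_in_block:
  assumes b: "block R' x s e" and R: "R \<le> R'" and a: "s \<le> s + a" "s + a \<le> e"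
  shows "occurs R (extend (factor x s e)) u a \<longleftrightarrow> occurs R x u (s + a)"
proof (rule iffI)
  have ext: "x (s + j) = extend (factor x s e) j" if "- int R \<le> j" "j \<le> e - s + int R" for j
    by (rule extend_factor_block[OF b]) (use that R in auto)
  {
    assume "occurs R (extend (factor x s e)) u a"
    moreover from occurs_extend_bounds[OF this]
    have "occurs R x u (s + a) \<longleftrightarrow> occurs R (extend (factor x s e)) u a"
      using a by (intro occurs_cong_window ext) auto
    ultimately show "occurs R x u (s + a)" by simp
  }
  assume o: "occurs R x u (s + a)"
  then have "s + a + int (length u) - 1 \<le> e"
    using block_subset(2)[OF _ b R, of "s + a" _ "s + a"] a by (auto simp: occurs_def block_def)
  then have "occurs R x u (s + a) \<longleftrightarrow> occurs R (extend (factor x s e)) u a"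
    using a by (intro occurs_cong_window ext) auto
  then show "occurs R (extend (factor x s e)) u a" using o by simp
qed

lemma block_in_extend:
  assumes "extend v i \<noteq> 1"
  shows "\<exists>s e. block R (extend v) s e \<and> 0 \<le> s \<and> s \<le> i \<and> i \<le> e \<and> e < int (length v)"
proof -
  have i: "0 \<le> i" "i < int (length v)" using assms by (auto simp: extend_def split: if_splits)
  obtain g where g: "i \<le> g" "g < int (length v) + int R" "gap_end R (extend v) g"
    using gap_end_before_gap[of "extend v" i "int (length v) + int R" R] assms i by (auto simp: extend_def)
  have "g < int (length v)" using g by (auto simp: gap_end_def extend_def split: if_splits)
  moreover obtain s e where "block R (extend v) s e \<and> 0 \<le> s \<and> s \<le> i \<and> i \<le> e \<and> e \<le> g"
    using block_exists[of "extend v" i 0 R g] assms g i by (auto simp: extend_def)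
  ultimately show ?thesis by (intro exI[of _ s] exI[of _ e]) auto
qed

section \<open>Relabelling blocks\<close>

text \<open>At most one block contains \<open>j\<close>, so the choice is harmless. The filling may
  depend on the position: \<open>refill_exists\<close> fills equal words differently in order to
  balance counts, whereas the recoding of orbits uses a function of the word.\<close>

definition recode :: "nat \<Rightarrow> (int \<Rightarrow> int \<Rightarrow> nat list) \<Rightarrow> (int \<Rightarrow> nat) \<Rightarrow> int \<Rightarrow> nat" where
  "recode R \<phi> x j = (if \<exists>s e. block R x s e \<and> s \<le> j \<and> j \<le> e
     then (let (s, e) = (SOME (s, e). block R x s e \<and> s \<le> j \<and> j \<le> e) in \<phi> s e ! nat (j - s))
     else x j)"

lemma recode_in_block:
  assumes "block R x s e" "s \<le> j" "j \<le> e"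
  shows "recode R \<phi> x j = \<phi> s e ! nat (j - s)"
proof -
  have ex: "\<exists>s e. block R x s e \<and> s \<le> j \<and> j \<le> e" using assms by blast
  have "(SOME (s, e). block R x s e \<and> s \<le> j \<and> j \<le> e) = (s, e)"
  proof (rule some_equality)
    show "case (s, e) of (s, e) \<Rightarrow> block R x s e \<and> s \<le> j \<and> j \<le> e" using assms by simp
    fix t assume "case t of (s, e) \<Rightarrow> block R x s e \<and> s \<le> j \<and> j \<le> e"
    moreover obtain s' e' where t: "t = (s', e')" by (cases t)
    ultimately have "block R x s' e'" "s' \<le> j" "j \<le> e'" by simp_all
    from block_unique[OF this(1) assms(1) this(2,3) assms(2,3)] show "t = (s, e)" using t by simp
  qed
  then show ?thesis unfolding recode_def if_P[OF ex] by simp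
qed

text \<open>Used with \<open>g\<close> the identity when \<beta>-words are lifted, and with \<pi>
  for both maps when labels are changed above fixed \<beta>-labels.\<close>

lemma recode_map:
  assumes b: "\<And>s e. block R x s e \<Longrightarrow> map f (\<phi> s e) = map g (factor x s e)"
    and n: "\<And>j. (\<nexists>s e. block R x s e \<and> s \<le> j \<and> j \<le> e) \<Longrightarrow> f (x j) = g (x j)"
  shows "f (recode R \<phi> x j) = g (x j)"
proof (cases "\<exists>s e. block R x s e \<and> s \<le> j \<and> j \<le> e")
  case True
  then obtain s e where se: "block R x s e" "s \<le> j" "j \<le> e" by blast
  have len: "length (\<phi> s e) = nat (e - s + 1)"
    using arg_cong[OF b[OF se(1)], of length] by simp
  have "f (\<phi> s e ! nat (j - s)) = map f (\<phi> s e) ! nat (j - s)" using se len by simp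
  also have "\<dots> = g (x j)" unfolding b[OF se(1)] using se by (simp add: nth_factor)
  finally show ?thesis using recode_in_block[OF se] by simp
next
  case False
  then have "recode R \<phi> x j = x j" unfolding recode_def by (rule if_not_P)
  then show ?thesis using n[OF False] by simp
qed

lemma factor_recode:
  assumes "block R x s e" "length (\<phi> s e) = nat (e - s + 1)"
  shows "factor (recode R \<phi> x) s e = \<phi> s e"
  unfolding factor_eq_iff using assms(2) by (simp add: recode_in_block[OF assms(1)])

text \<open>Points are assigned one at a time, each to a class that is below its quota; only the upper
  bounds need to be maintained, since the deviations from the quotas sum to zero.\<close>

lemma balanced_assignment:
  fixes q :: "'b \<Rightarrow> real"
  assumes "finite F" "finite I" "\<And>v. v \<in> F \<Longrightarrow> q v \<ge> 0" "sum q F = 1"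
  shows "\<exists>\<phi>. (\<forall>i\<in>I. \<phi> i \<in> F) \<and> (\<forall>v\<in>F. \<bar>real (card {i\<in>I. \<phi> i = v}) - q v * card I\<bar> \<le> card F)"
proof -
  have tot: "(\<Sum>v\<in>F. real (card {i\<in>I. \<phi> i = v})) = card I" if "finite I" "\<forall>i\<in>I. \<phi> i \<in> F" for \<phi> :: "'c \<Rightarrow> 'b" and I
  proof -
    have "card I = card (\<Union>v\<in>F. {i\<in>I. \<phi> i = v})" by (rule arg_cong[of _ _ card]) (use that in auto)
    also have "\<dots> = (\<Sum>v\<in>F. card {i\<in>I. \<phi> i = v})"
      using assms(1) that by (intro card_UN_disjoint) auto
    finally show ?thesis by simp
  qed
  have "\<exists>\<phi>. (\<forall>i\<in>I. \<phi> i \<in> F) \<and> (\<forall>v\<in>F. real (card {i\<in>I. \<phi> i = v}) \<le> q v * card I + 1)"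
    using \<open>finite I\<close>
  proof (induction I rule: finite_induct)
    case empty
    then show ?case by auto
  next
    case (insert a I)
    then obtain \<phi> where \<phi>: "\<forall>i\<in>I. \<phi> i \<in> F" "\<forall>v\<in>F. real (card {i\<in>I. \<phi> i = v}) \<le> q v * card I + 1" by auto
    \<comment> \<open>The quotas for \<open>card I + 1\<close> points add up to one more than the
      number of points assigned so far, so some class has room.\<close>
    have "\<exists>v\<in>F. real (card {i\<in>I. \<phi> i = v}) < q v * (card I + 1)"
    proof (rule ccontr)
      assume "\<not> ?thesis"
      then have "(\<Sum>v\<in>F. q v * (card I + 1)) \<le> (\<Sum>v\<in>F. real (card {i\<in>I. \<phi> i = v}))"
        by (intro sum_mono) force
      also have "\<dots> = card I" using tot insert \<phi> by blast
      finally show False using assms(4) by (simp flip: sum_distrib_right)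
    qed
    then obtain v where v: "v \<in> F" "real (card {i\<in>I. \<phi> i = v}) < q v * (card I + 1)" by auto
    let ?\<phi> = "\<phi>(a := v)"
    have eq: "{i\<in>insert a I. ?\<phi> i = u} = (if u = v then insert a {i\<in>I. \<phi> i = u} else {i\<in>I. \<phi> i = u})" for u
      using insert by auto
    have "real (card {i\<in>insert a I. ?\<phi> i = u}) \<le> q u * card (insert a I) + 1" if "u \<in> F" for u
    proof (cases "u = v")
      case True
      then show ?thesis unfolding eq using v insert by (simp add: algebra_simps)
    next
      case False
      then have "real (card {i\<in>insert a I. ?\<phi> i = u}) \<le> q u * card I + 1" unfolding eq using \<phi> that by simp
      then show ?thesis using assms(3)[OF that] insert by (simp add: algebra_simps)
    qed
    moreover have "\<forall>i\<in>insert a I. ?\<phi> i \<in> F" using \<phi> v by auto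
    ultimately show ?case by blast
  qed
  then obtain \<phi> where \<phi>: "\<forall>i\<in>I. \<phi> i \<in> F" "\<And>v. v \<in> F \<Longrightarrow> real (card {i\<in>I. \<phi> i = v}) \<le> q v * card I + 1" by blast
  have "\<bar>real (card {i\<in>I. \<phi> i = v}) - q v * card I\<bar> \<le> card F" if v: "v \<in> F" for v
  proof -
    let ?d = "\<lambda>v. real (card {i\<in>I. \<phi> i = v}) - q v * card I"
    have "sum ?d F = 0"
      using tot[of I \<phi>] \<phi> assms by (simp add: sum_subtractf flip: sum_distrib_right)
    then have "?d v = - sum ?d (F - {v})" using v assms(1) by (simp add: sum.remove[of F v])
    moreover have "sum ?d (F - {v}) \<le> (\<Sum>v\<in>F - {v}. 1)"
      using \<phi>(2) by (intro sum_mono) force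
    moreover have "card F \<ge> 1" using v assms(1) by (auto simp: Suc_le_eq card_gt_0_iff)
    moreover have "card (F - {v}) \<le> card F" using assms(1) by (simp add: card_mono)
    ultimately show ?thesis using \<phi>(2)[OF v] by simp
  qed
  with \<phi>(1) show ?thesis by blast
qed

section \<open>Counting blocks inside words, and lifting words\<close>

definition occ_count :: "nat \<Rightarrow> nat list \<Rightarrow> nat list \<Rightarrow> real" where
  "occ_count R v u = (\<Sum>i\<in>{0..<int (length v)}. of_bool (occurs R (extend v) u i))"

definition visits :: "nat list \<Rightarrow> real" where
  "visits v = (\<Sum>i\<in>{0..<int (length v)}. visit (extend v) i)"

lemma occurs_extend_range: "{i. occurs R (extend v) u i} \<subseteq> {0..<int (length v)}"
proof
  fix i assume "i \<in> {i. occurs R (extend v) u i}"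
  then have o: "occurs R (extend v) u i" by simp
  then have "length u > 0" using occurs_extend_bounds(3) by simp
  then show "i \<in> {0..<int (length v)}"
    using occurs_extend_bounds(1,2)[OF o] unfolding atLeastLessThan_iff by linarith
qed

lemma occ_count_eq_card: "occ_count R v u = card {i. occurs R (extend v) u i}"
proof -
  have "{i. occurs R (extend v) u i} = {0..<int (length v)} \<inter> {i. occurs R (extend v) u i}"
    using occurs_extend_range[of R v u] by blast
  then show ?thesis by (simp add: occ_count_def sum_of_bool_eq)
qed

lemma finite_occurs_extend: "finite {i. occurs R (extend v) u i}"
  by (rule finite_subset[OF occurs_extend_range]) simp

lemma sum_int_shift:
  fixes f :: "int \<Rightarrow> real"
  shows "(\<Sum>i\<in>{a..<b}. f (s + i)) = sum f {s + a..<s + b}"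
  by (rule sum.reindex_bij_witness[of _ "\<lambda>i. i - s" "\<lambda>i. s + i"]) auto

lemma occ_count_block:
  assumes "block R' x s e" "R \<le> R'"
  shows "occ_count R (factor x s e) u = (\<Sum>i\<in>{s..<e + 1}. of_bool (occurs R x u i))"
proof -
  have se: "s \<le> e" using assms by (simp add: block_def)
  have "occ_count R (factor x s e) u = (\<Sum>i\<in>{0..<e - s + 1}. of_bool (occurs R x u (s + i)))"
    unfolding occ_count_def using se by (intro sum.cong) (auto simp: occurs_in_block[OF assms])
  also have "\<dots> = (\<Sum>i\<in>{s..<e + 1}. of_bool (occurs R x u i))"
    using sum_int_shift[of "\<lambda>i. of_bool (occurs R x u i)" s 0 "e - s + 1"] by simp
  finally show ?thesis .
qed

lemma visits_block:
  assumes "block R x s e"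
  shows "visits (factor x s e) = sum (visit x) {s..<e + 1}"
proof -
  have se: "s \<le> e" using assms by (simp add: block_def)
  have "visits (factor x s e) = (\<Sum>i\<in>{0..<e - s + 1}. visit x (s + i))"
    unfolding visits_def using se
    by (intro sum.cong) (auto simp: visit_def extend_factor_block[OF assms])
  also have "\<dots> = sum (visit x) {s..<e + 1}"
    using sum_int_shift[of "visit x" s 0 "e - s + 1"] by simp
  finally show ?thesis .
qed

text \<open>All occurrences of a block \<open>w\<close> in \<open>W\<close> are distributed among
  the words of \<open>L\<close> above \<open>w\<close>, in proportion to \<open>p\<close>. The
  counts of \<open>w\<close> are right by assumption, and the distribution adds an error of at most
  \<open>card L\<close>, whatever the length of \<open>W\<close>.\<close>

lemma refill_exists:
  assumes fin: "finite L" and one: "\<And>l. \<pi> l = 1 \<longleftrightarrow> l = (1::nat)"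
    and p: "\<And>v. v \<in> L \<Longrightarrow> p v \<ge> 0"
    and pos: "\<And>w i. occurs R (extend W) w i \<Longrightarrow> (\<Sum>v\<in>{v\<in>L. map \<pi> v = w}. p v) > 0"
    and cnt: "\<And>w. w \<in> map \<pi> ` L \<Longrightarrow> \<bar>occ_count R W w - (\<Sum>v\<in>{v\<in>L. map \<pi> v = w}. p v) * k\<bar> \<le> E"
  shows "\<exists>V. map \<pi> V = W \<and> (\<forall>v i. occurs R (extend V) v i \<longrightarrow> v \<in> L) \<and>
           (\<forall>v\<in>L. \<bar>occ_count R V v - p v * k\<bar> \<le> E + card L)"
proof -
  define F where "F = (\<lambda>w. {v\<in>L. map \<pi> v = w})"
  define P where "P = (\<lambda>w. sum p (F w))"
  define x where "x = extend W"
  define I where "I = (\<lambda>w. {i. occurs R x w i})"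
  have finI: "finite (I w)" for w unfolding I_def x_def by (rule finite_occurs_extend)
  have finF: "finite (F w)" for w using fin by (simp add: F_def)
  have "\<forall>w. \<exists>\<phi>. P w > 0 \<longrightarrow> (\<forall>i\<in>I w. \<phi> i \<in> F w) \<and>
     (\<forall>v\<in>F w. \<bar>real (card {i\<in>I w. \<phi> i = v}) - p v / P w * card (I w)\<bar> \<le> card (F w))"
  proof
    fix w
    show "\<exists>\<phi>. P w > 0 \<longrightarrow> (\<forall>i\<in>I w. \<phi> i \<in> F w) \<and>
     (\<forall>v\<in>F w. \<bar>real (card {i\<in>I w. \<phi> i = v}) - p v / P w * card (I w)\<bar> \<le> card (F w))"
    proof (cases "P w > 0")
      case True
      have "sum (\<lambda>v. p v / P w) (F w) = 1" using True by (simp add: P_def flip: sum_divide_distrib)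
      moreover have "p v / P w \<ge> 0" if "v \<in> F w" for v using that p True by (auto simp: F_def)
      ultimately show ?thesis using balanced_assignment[OF finF finI, of w "\<lambda>v. p v / P w" w] by blast
    qed auto
  qed
  then obtain \<phi> where \<phi>: "\<And>w i. P w > 0 \<Longrightarrow> i \<in> I w \<Longrightarrow> \<phi> w i \<in> F w"
     "\<And>w v. P w > 0 \<Longrightarrow> v \<in> F w \<Longrightarrow> \<bar>real (card {i\<in>I w. \<phi> w i = v}) - p v / P w * card (I w)\<bar> \<le> card (F w)"
    by metis
  define \<psi> where "\<psi> = (\<lambda>s e. \<phi> (factor x s e) s)"
  define y where "y = recode R \<psi> x"
  have Ppos: "P w > 0" if "i \<in> I w" for w i
    using pos that by (auto simp: P_def F_def I_def x_def)
  have occ: "s \<in> I (factor x s e)" if "block R x s e" for s e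
    using occurs_block[OF that] by (simp add: I_def)
  have \<psi>F: "\<psi> s e \<in> F (factor x s e)" if "block R x s e" for s e
    unfolding \<psi>_def using \<phi>(1) Ppos occ[OF that] by blast
  have \<pi>y: "\<pi> (y j) = x j" for j
    unfolding y_def
  proof (rule recode_map[where g = "\<lambda>l. l"])
    show "map \<pi> (\<psi> s e) = map (\<lambda>l. l) (factor x s e)" if "block R x s e" for s e
      using \<psi>F[OF that] by (simp add: F_def)
    show "\<pi> (x j) = x j" if "\<nexists>s e. block R x s e \<and> s \<le> j \<and> j \<le> e" for j
    proof -
      have "x j = 1" using block_in_extend[of W j R] that unfolding x_def by blast
      then show ?thesis using one by simp
    qed
  qed
  have supp: "y j = 1 \<longleftrightarrow> x j = 1" for j using \<pi>y[of j] one[of "y j"] by metis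
  have blk: "block R y s e \<longleftrightarrow> block R x s e" for s e by (rule block_cong_support) (rule supp)
  have fy: "factor y s e = \<psi> s e" if "block R x s e" for s e
    unfolding y_def using \<psi>F[OF that] by (intro factor_recode that) (auto simp: F_def dest: arg_cong[of _ _ length])
  define V where "V = factor y 0 (int (length W) - 1)"
  have lenV: "length V = length W" by (simp add: V_def)
  have \<pi>V: "map \<pi> V = W"
    unfolding V_def map_factor \<pi>y by (auto simp: factor_eq_iff x_def extend_def)
  have extV: "extend V = y"
  proof
    fix j show "extend V j = y j"
    proof (cases "0 \<le> j \<and> j < int (length W)")
      case True
      then have "V ! nat j = y (0 + int (nat j))" unfolding V_def by (intro nth_factor) auto
      then show ?thesis using True lenV by (simp add: extend_def)
    next
      case False
      then have "y j = 1" unfolding supp by (auto simp: x_def extend_def)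
      then show ?thesis using False lenV by (auto simp: extend_def)
    qed
  qed
  have inL: "v \<in> L" if "occurs R (extend V) v i" for v i
  proof -
    from that have b: "block R x i (i + int (length v) - 1)" and f: "factor y i (i + int (length v) - 1) = v"
      unfolding extV by (auto simp: occurs_def blk)
    from \<psi>F[OF b] fy[OF b] f show ?thesis by (simp add: F_def)
  qed
  have "\<bar>occ_count R V v - p v * k\<bar> \<le> E + card L" if v: "v \<in> L" for v
  proof -
    define w where "w = map \<pi> v"
    have vF: "v \<in> F w" using v by (simp add: F_def w_def)
    have set_eq: "{i. occurs R (extend V) v i} = {i\<in>I w. \<phi> w i = v}"
    proof safe
      fix i assume "occurs R (extend V) v i"
      then have b: "block R x i (i + int (length v) - 1)" and f: "factor y i (i + int (length v) - 1) = v"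
        unfolding extV by (auto simp: occurs_def blk)
      have "w = factor x i (i + int (length v) - 1)"
        unfolding w_def using f map_factor[of \<pi> y i "i + int (length v) - 1"] \<pi>y by simp
      moreover have "\<phi> (factor x i (i + int (length v) - 1)) i = v" using fy[OF b] f by (simp add: \<psi>_def)
      ultimately show "i \<in> I w" "\<phi> w i = v" using occ[OF b] by simp_all
    next
      fix i assume i: "i \<in> I w" and v_eq: "v = \<phi> w i"
      have "length w = length v" by (simp add: w_def)
      with i have b: "block R x i (i + int (length v) - 1)" and f: "factor x i (i + int (length v) - 1) = w"
        by (auto simp: I_def occurs_def)
      have "factor y i (i + int (length v) - 1) = v" using fy[OF b] f v_eq by (simp add: \<psi>_def)
      with b show "occurs R (extend V) (\<phi> w i) i" unfolding extV using v_eq by (simp add: occurs_def blk)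
    qed
    have cI: "occ_count R W w = card (I w)" by (simp add: occ_count_eq_card I_def x_def)
    have E: "\<bar>occ_count R W w - P w * k\<bar> \<le> E" using cnt[of w] v by (simp add: P_def F_def w_def)
    have le: "p v \<le> P w" unfolding P_def using vF finF p by (intro member_le_sum) (auto simp: F_def)
    show ?thesis
    proof (cases "P w > 0")
      case True
      have "\<bar>occ_count R V v - p v / P w * card (I w)\<bar> \<le> card (F w)"
        unfolding occ_count_eq_card set_eq by (rule \<phi>(2)[OF True vF])
      also have "\<dots> \<le> card L" using fin by (simp add: F_def card_mono)
      finally have 1: "\<bar>occ_count R V v - p v / P w * card (I w)\<bar> \<le> card L" .
      \<comment> \<open>The ratio \<open>p v / P w\<close> is at most 1, so the error
        \<open>E\<close> in the number of occurrences of \<open>w\<close> is not enlarged when it is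
        shared out.\<close>
      have "p v / P w * card (I w) - p v * k = p v / P w * (card (I w) - P w * k)"
        using True by (simp add: field_simps)
      then have "\<bar>p v / P w * card (I w) - p v * k\<bar> = p v / P w * \<bar>card (I w) - P w * k\<bar>"
        using True p[OF v] by (simp add: abs_mult)
      also have "\<dots> \<le> 1 * E" using E cI le True p[OF v] by (intro mult_mono) auto
      finally show ?thesis using 1 by simp
    next
      case False
      \<comment> \<open>A block of total weight 0 does not occur, and every word above it has weight
        0; so nothing has to be distributed.\<close>
      then have "I w = {}" using Ppos by blast
      then have "occ_count R V v = 0" unfolding occ_count_eq_card set_eq by simp
      moreover have "p v = 0" using False le p[OF v] by simp
      ultimately show ?thesis using E by simp
    qed
  qed
  with \<pi>V inL show ?thesis by blast
qed

section \<open>Summation along blocks\<close>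

lemma visit_bounds [simp]: "0 \<le> visit x i" "visit x i \<le> 1"
  by (simp_all add: visit_def)

lemma sum_abs_le_length:
  assumes "\<And>i. \<bar>f i\<bar> \<le> visit x i" "a \<le> b"
  shows "\<bar>sum f {a..<b}\<bar> \<le> real_of_int (b - a)"
proof -
  have "\<bar>sum f {a..<b}\<bar> \<le> (\<Sum>i\<in>{a..<b}. 1)"
    by (rule order_trans[OF sum_abs sum_mono]) (rule order_trans[OF assms(1)], simp)
  then show ?thesis using assms(2) by simp
qed

text \<open>Passes from single blocks to arbitrary intervals. Times outside \<open>K\<close>
  contribute nothing, each complete block costs \<open>c\<close> once and is charged to its gap end,
  and the at most two blocks cut by the ends of the interval cost \<open>h\<close> each.\<close>

lemma sum_over_blocks:
  fixes f :: "int \<Rightarrow> real"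
  assumes f: "\<And>i. \<bar>f i\<bar> \<le> visit x i"
    and ex: "\<And>i. x i \<noteq> 1 \<Longrightarrow> \<exists>s e. block R x s e \<and> s \<le> i \<and> i \<le> e"
    and h: "\<And>s e. block R x s e \<Longrightarrow> e - s < h"
    and B: "\<And>s e. block R x s e \<Longrightarrow> \<bar>sum f {s..<e + 1}\<bar> \<le> \<epsilon> * sum (visit x) {s..<e + 1} + c"
    and "0 \<le> \<epsilon>" "0 \<le> c" "0 \<le> h" and ab: "a \<le> b"
  shows "\<bar>sum f {a..<b}\<bar> \<le> \<epsilon> * sum (visit x) {a..<b} + c * (\<Sum>i\<in>{a..<b}. of_bool (gap_end R x i)) + 2 * h"
proof -
  let ?g = "\<lambda>i. of_bool (gap_end R x i) :: real"
  \<comment> \<open>\<open>?I a\<close> says that \<open>a\<close> cuts no block. The induction runs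
    over such left ends only; a block cut on the left is split off afterwards.\<close>
  let ?I = "\<lambda>a. \<forall>s e. block R x s e \<longrightarrow> \<not> (s < a \<and> a \<le> e)"
  let ?b = "\<lambda>a b. \<epsilon> * sum (visit x) {a..<b} + c * sum ?g {a..<b}"
  have b0: "?b a b \<ge> 0" for a b
    using assms by (intro add_nonneg_nonneg mult_nonneg_nonneg sum_nonneg) auto
  have b_split: "?b a b = ?b a t + ?b t b" if "a \<le> t" "t \<le> b" for a b t
    using sum_int_split[OF that, of "visit x"] sum_int_split[OF that, of ?g] by (simp add: algebra_simps)
  have *: "\<bar>sum f {a..<b}\<bar> \<le> ?b a b + h" if "?I a" "a \<le> b" for a
    using that
  proof (induction "nat (b - a)" arbitrary: a rule: less_induct)
    case less
    show ?case
    proof (cases "a = b")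
      case True then show ?thesis using assms by simp
    next
      case False
      then have ab: "a < b" using less.prems by simp
      show ?thesis
      proof (cases "x a = 1")
        case True
        have "?I (a + 1)"
        proof (intro allI impI notI)
          fix s e assume se: "block R x s e" "s < a + 1 \<and> a + 1 \<le> e"
          then have "s \<noteq> a" using True by (auto simp: block_def)
          then show False using less.prems(1) se by force
        qed
        then have "\<bar>sum f {a + 1..<b}\<bar> \<le> ?b (a + 1) b + h" using ab by (intro less.hyps) auto
        moreover have "sum f {a..<b} = sum f {a..<a + 1} + sum f {a + 1..<b}" using ab by (intro sum_int_split) auto
        moreover have "sum f {a..<a + 1} = 0" using f[of a] True sum_int_snoc[of a a f] by (simp add: visit_def)
        ultimately show ?thesis using b_split[of a "a + 1" b] b0[of a "a + 1"] ab by simp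
      next
        case False
        then obtain s e where se: "block R x s e" "s \<le> a" "a \<le> e" using ex by blast
        then have "s = a" using less.prems by force
        show ?thesis
        proof (cases "e + 1 \<le> b")
          case True
          have "?I (e + 1)" using block_unique(2)[OF se(1), of _ _ e] se by force
          then have "\<bar>sum f {e + 1..<b}\<bar> \<le> ?b (e + 1) b + h" using True se by (intro less.hyps) auto
          moreover have "sum f {a..<b} = sum f {a..<e + 1} + sum f {e + 1..<b}" using True se by (intro sum_int_split) auto
          moreover have "\<bar>sum f {a..<e + 1}\<bar> \<le> ?b a (e + 1)"
          proof -
            have "sum ?g {a..<e + 1} \<ge> ?g e" using se by (intro member_le_sum) auto
            then have "c * 1 \<le> c * sum ?g {a..<e + 1}" using se \<open>0 \<le> c\<close> by (intro mult_left_mono) (auto simp: block_def)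
            then show ?thesis using B[OF se(1)] \<open>s = a\<close> by simp
          qed
          ultimately show ?thesis using b_split[of a "e + 1" b] True se by simp
        next
          case False
          have "\<bar>sum f {a..<b}\<bar> \<le> real_of_int (b - a)" using f ab by (intro sum_abs_le_length) auto
          also have "\<dots> \<le> h" using h[OF se(1)] False \<open>s = a\<close> by simp
          finally show ?thesis using b0[of a b] by simp
        qed
      qed
    qed
  qed
  show ?thesis
  proof (cases "?I a")
    case True then show ?thesis using *[of a] ab \<open>0 \<le> h\<close> by simp
  next
    case False
    then obtain s e where se: "block R x s e" "s < a" "a \<le> e" by blast
    define t where "t = min b (e + 1)"
    have t: "a \<le> t" "t \<le> b" "t - a \<le> h" using se ab h[OF se(1)] by (auto simp: t_def)
    have 1: "\<bar>sum f {a..<t}\<bar> \<le> h"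
      using sum_abs_le_length[of f x a t] f t by simp
    have 2: "\<bar>sum f {t..<b}\<bar> \<le> ?b t b + h"
    proof (cases "e + 1 \<le> b")
      case True
      have "?I (e + 1)" using block_unique(2)[OF se(1), of _ _ e] se by force
      then show ?thesis using *[of "e + 1"] True by (simp add: t_def)
    next
      case False
      then show ?thesis using b0 \<open>0 \<le> h\<close> by (simp add: t_def)
    qed
    show ?thesis using sum_int_split[OF t(1,2), of f] b_split[OF t(1,2)] b0[of a t] 1 2 by simp
  qed
qed

section \<open>Invertible and ergodic systems\<close>

locale invertible_system =
  fixes M :: "'a measure" and T S :: "'a \<Rightarrow> 'a"
  assumes T [measurable]: "T \<in> measurable M M" and S [measurable]: "S \<in> measurable M M"
    and ST: "AE y in M. S (T y) = y" and TS: "AE y in M. T (S y) = y"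
    and T_preserves: "\<And>E. E \<in> sets M \<Longrightarrow> emeasure M (T -` E \<inter> space M) = emeasure M E"
begin

abbreviation orb :: "int \<Rightarrow> 'a \<Rightarrow> 'a" where "orb \<equiv> iter T S"

lemma measurable_orb [measurable]: "orb i \<in> measurable M M"
  unfolding iter_def by (cases "0 \<le> i") simp_all

lemma orb_0 [simp]: "orb 0 y = y" by (simp add: iter_def)
lemma orb_1 [simp]: "orb 1 y = T y" by (simp add: iter_def)

lemma distr_T: "distr M M T = M"
  by (rule measure_eqI) (simp_all add: emeasure_distr T_preserves)

text \<open>Pulling the preimage of \<open>E\<close> under \<open>S\<close> back by \<open>T\<close>
  gives \<open>E\<close> again, up to a null set.\<close>

lemma distr_S: "distr M M S = M"
proof (rule measure_eqI)
  fix E assume "E \<in> sets (distr M M S)"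
  then have E [measurable]: "E \<in> sets M" by simp
  have "emeasure (distr M M S) E = emeasure M (S -` E \<inter> space M)" by (simp add: emeasure_distr)
  also have "\<dots> = emeasure M (T -` (S -` E \<inter> space M) \<inter> space M)" by (rule T_preserves[symmetric]) measurable
  also have "\<dots> = emeasure M E"
  proof (rule emeasure_eq_AE)
    show "AE y in M. y \<in> T -` (S -` E \<inter> space M) \<inter> space M \<longleftrightarrow> y \<in> E"
      using ST AE_space
    proof eventually_elim
      case (elim y)
      then show ?case using measurable_space[OF T] sets.sets_into_space[OF E] by auto
    qed
  qed measurable
  finally show "emeasure (distr M M S) E = emeasure M E" .
qed simp

lemma distr_orb: "distr M M (orb i) = M"
proof -
  have *: "distr M M (f ^^ n) = M" if "f \<in> measurable M M" "distr M M f = M" for f and n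
  proof (induction n)
    case 0 then show ?case by (simp add: distr_id[unfolded id_def] id_def)
  next
    case (Suc n)
    have "distr M M (f ^^ Suc n) = distr (distr M M (f ^^ n)) M f"
      using that by (subst distr_distr) simp_all
    also have "\<dots> = M" using Suc that by simp
    finally show ?case .
  qed
  show ?thesis unfolding iter_def using *[OF T distr_T] *[OF S distr_S] by simp
qed

lemma AE_orb:
  assumes "AE y in M. P y"
  shows "AE y in M. \<forall>i. P (orb i y)"
proof -
  have "AE y in M. P (orb i y)" for i
  proof (rule AE_distrD[OF measurable_orb])
    show "AE y in distr M M (orb i). P y" unfolding distr_orb by (rule assms)
  qed
  then show ?thesis by (simp add: AE_all_countable)
qed

lemma emeasure_orb:
  assumes [measurable]: "E \<in> sets M"
  shows "emeasure M (orb i -` E \<inter> space M) = emeasure M E"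
  using emeasure_distr[of "orb i" M M E] by (simp add: distr_orb)

text \<open>\<open>S\<close> inverts \<open>T\<close> only almost everywhere, so the group law may
  fail on a null set. It holds at points for which the inverse relations are valid along the orbit
  and along the orbits of all iterates.\<close>

lemma AE_orb_add: "AE y in M. \<forall>i j. orb i (orb j y) = orb (i + j) y"
proof -
  let ?good = "\<lambda>y. \<forall>i. S (T (orb i y)) = orb i y \<and> T (S (orb i y)) = orb i y"
  have "AE y in M. ?good y"
    by (rule AE_orb) (use ST TS in eventually_elim, simp)
  then have "AE y in M. \<forall>j. ?good (orb j y)" by (rule AE_orb)
  then show ?thesis
  proof eventually_elim
    case (elim y)
    have Tstep: "orb (i + 1) z = T (orb i z)" if "?good z" for i z
    proof (cases "0 \<le> i")
      case True then show ?thesis by (simp add: iter_def nat_add_distrib)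
    next
      case False
      then have "nat (- i) = Suc (nat (- (i + 1)))" by simp
      then have "orb i z = S (orb (i + 1) z)" using False by (auto simp: iter_def)
      then show ?thesis using that by metis
    qed
    have Sstep: "orb (i - 1) z = S (orb i z)" if "?good z" for i z
      using Tstep[OF that, of "i - 1"] that by simp
    have g: "?good y" using elim[rule_format, of 0] by simp
    have "orb i (orb j y) = orb (i + j) y" for i j
    proof (induction i rule: int_induct[where k = 0])
      case base show ?case by simp
    next
      case (step1 i)
      then show ?case using Tstep[of "orb j y" i] Tstep[of y "i + j"] g elim by (simp add: algebra_simps)
    next
      case (step2 i)
      then show ?case using Sstep[of "orb j y" i] Sstep[of y "i + j"] g elim by (simp add: algebra_simps)
    qed
    then show ?case by blast
  qed
qed

definition name :: "('a \<Rightarrow> nat) \<Rightarrow> 'a \<Rightarrow> int \<Rightarrow> nat" where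
  "name a y = (\<lambda>i. a (orb i y))"

lemma AE_name_orb: "AE y in M. \<forall>i. name a (orb i y) = shift i (name a y)"
  using AE_orb_add by eventually_elim (auto simp: name_def shift_def add.commute)

end

section \<open>Ergodicity: recurrence and forward sums\<close>

locale ergodic_system = invertible_system +
  assumes erg: "ergodic M T"
    and nonatomic: "\<And>W. W \<in> sets M \<Longrightarrow> emeasure M W > 0 \<Longrightarrow>
      \<exists>U V. U \<in> sets M \<and> V \<in> sets M \<and> U \<subseteq> W \<and> V \<subseteq> W \<and> U \<inter> V = {} \<and> emeasure M U > 0 \<and> emeasure M V > 0"
begin

lemma AE_invariant_cases:
  assumes [measurable]: "Measurable.pred M P" and inv: "AE y in M. P (T y) \<longleftrightarrow> P y"
  shows "(AE y in M. P y) \<or> (AE y in M. \<not> P y)"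
proof -
  let ?B = "{y\<in>space M. P y}"
  have "eq_mod0 M (T -` ?B \<inter> space M) ?B" unfolding eq_mod0_def
  proof (rule AE_iff_null_sets[THEN iffD2])
    show "AE y in M. y \<notin> sym_diff (T -` ?B \<inter> space M) ?B"
      using inv AE_space by eventually_elim (use measurable_space[OF T] in auto)
  qed measurable
  then have "emeasure M ?B = 0 \<or> emeasure M (space M - ?B) = 0"
    using erg unfolding ergodic_def by (auto simp: pred_def)
  then show ?thesis
  proof
    assume "emeasure M ?B = 0"
    then have "AE y in M. y \<notin> ?B" by (intro AE_not_in) (auto simp: null_sets_def)
    then have "AE y in M. \<not> P y" using AE_space by eventually_elim simp
    then show ?thesis ..
  next
    assume "emeasure M (space M - ?B) = 0"
    then have "AE y in M. y \<notin> space M - ?B" by (intro AE_not_in) (auto simp: null_sets_def)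
    then have "AE y in M. P y" using AE_space by eventually_elim simp
    then show ?thesis ..
  qed
qed

text \<open>A set of positive measure that orbits meet at most once would split into two disjoint
  parts of positive measure. The points whose orbits meet the first part form an invariant set,
  hence almost everything, yet they miss the second part.\<close>

lemma wandering_null:
  assumes W [measurable]: "W \<in> sets M" and wand: "AE y in M. y \<in> W \<longrightarrow> (\<forall>i. i \<noteq> 0 \<longrightarrow> orb i y \<notin> W)"
  shows "AE y in M. y \<notin> W"
proof (rule ccontr)
  assume "\<not> ?thesis"
  then have "emeasure M W > 0" using AE_iff_null_sets[OF W] by (auto simp: null_sets_def zero_less_iff_neq_zero)
  then obtain U V where [measurable]: "U \<in> sets M" "V \<in> sets M"
    and UV: "U \<subseteq> W" "V \<subseteq> W" "U \<inter> V = {}" "emeasure M U > 0" "emeasure M V > 0"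
    using nonatomic[OF W] by blast
  have "AE y in M. (\<exists>i. orb i (T y) \<in> U) \<longleftrightarrow> (\<exists>i. orb i y \<in> U)"
    using AE_orb_add
  proof eventually_elim
    case (elim y)
    then have "orb i (T y) = orb (i + 1) y" for i using elim[rule_format, of i 1] by simp
    then show ?case by (metis diff_add_cancel)
  qed
  then have "(AE y in M. \<exists>i. orb i y \<in> U) \<or> (AE y in M. \<not> (\<exists>i. orb i y \<in> U))"
    by (intro AE_invariant_cases) measurable
  then show False
  proof
    assume "AE y in M. \<exists>i. orb i y \<in> U"
    then have "AE y in M. y \<notin> V" using wand
    proof eventually_elim
      case (elim y)
      then obtain i where "orb i y \<in> U" by blast
      then show ?case using elim UV by (cases "i = 0") auto
    qed
    then show False using UV AE_iff_null_sets[of V M] by (auto simp: null_sets_def)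
  next
    assume "AE y in M. \<not> (\<exists>i. orb i y \<in> U)"
    then have "AE y in M. y \<notin> U" by eventually_elim (metis orb_0)
    then show False using UV AE_iff_null_sets[of U M] by (auto simp: null_sets_def)
  qed
qed

text \<open>Ergodicity gives one visit on almost every orbit. The points of last visit and the
  points of first visit form wandering sets, which are null, so visits continue in both
  directions.\<close>

lemma AE_recurrent:
  assumes K [measurable]: "K \<in> sets M" and pos: "emeasure M K > 0"
  shows "AE y in M. \<forall>i. (\<exists>j>i. orb j y \<in> K) \<and> (\<exists>j<i. orb j y \<in> K)"
proof -
  have "AE y in M. (\<exists>i. orb i (T y) \<in> K) \<longleftrightarrow> (\<exists>i. orb i y \<in> K)"
    using AE_orb_add
  proof eventually_elim
    case (elim y)
    then have "orb i (T y) = orb (i + 1) y" for i using elim[rule_format, of i 1] by simp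
    then show ?case by (metis diff_add_cancel)
  qed
  then have "(AE y in M. \<exists>i. orb i y \<in> K) \<or> (AE y in M. \<not> (\<exists>i. orb i y \<in> K))"
    by (intro AE_invariant_cases) measurable
  then have ex: "AE y in M. \<exists>i. orb i y \<in> K"
  proof
    assume "AE y in M. \<not> (\<exists>i. orb i y \<in> K)"
    then have "AE y in M. y \<notin> K" by eventually_elim (metis orb_0)
    then show ?thesis using pos AE_iff_null_sets[OF K] by (auto simp: null_sets_def)
  qed
  let ?F = "{y\<in>space M. y \<in> K \<and> (\<forall>j>0. orb j y \<notin> K)}"
  let ?G = "{y\<in>space M. y \<in> K \<and> (\<forall>j<0. orb j y \<notin> K)}"
  have "AE y in M. y \<notin> ?F"
  proof (rule wandering_null)
    show "AE y in M. y \<in> ?F \<longrightarrow> (\<forall>i. i \<noteq> 0 \<longrightarrow> orb i y \<notin> ?F)"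
      using AE_orb_add
    proof eventually_elim
      case (elim y)
      show ?case
      proof (intro impI allI notI)
        fix i :: int assume y: "y \<in> ?F" "i \<noteq> 0" "orb i y \<in> ?F"
        show False
        proof (cases "i > 0")
          case False
          then have "orb (- i) (orb i y) \<notin> K" using y by auto
          then show False using elim[rule_format, of "- i" i] y by simp
        qed (use y in auto)
      qed
    qed
  qed measurable
  moreover have "AE y in M. y \<notin> ?G"
  proof (rule wandering_null)
    show "AE y in M. y \<in> ?G \<longrightarrow> (\<forall>i. i \<noteq> 0 \<longrightarrow> orb i y \<notin> ?G)"
      using AE_orb_add
    proof eventually_elim
      case (elim y)
      show ?case
      proof (intro impI allI notI)
        fix i :: int assume y: "y \<in> ?G" "i \<noteq> 0" "orb i y \<in> ?G"
        show False
        proof (cases "i < 0")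
          case False
          then have "orb (- i) (orb i y) \<notin> K" using y by auto
          then show False using elim[rule_format, of "- i" i] y by simp
        qed (use y in auto)
      qed
    qed
  qed measurable
  ultimately have "AE y in M. y \<notin> ?F \<and> y \<notin> ?G" by eventually_elim simp
  then have "AE y in M. \<forall>i. orb i y \<notin> ?F \<and> orb i y \<notin> ?G" by (rule AE_orb)
  then show ?thesis using ex AE_orb_add AE_space
  proof eventually_elim
    case (elim y)
    have sp: "orb i y \<in> space M" for i using measurable_space[OF measurable_orb] elim by blast
    have fut: "\<exists>j>i. orb j y \<in> K" if "orb i y \<in> K" for i
    proof -
      have "\<exists>j>0. orb j (orb i y) \<in> K" using elim(1)[rule_format, of i] that sp[of i] by auto
      then obtain j where "j > 0" "orb j (orb i y) \<in> K" by blast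
      then have "orb (j + i) y \<in> K" using elim(3) by simp
      then show ?thesis using \<open>j > 0\<close> by (intro exI[of _ "j + i"]) simp
    qed
    have past: "\<exists>j<i. orb j y \<in> K" if "orb i y \<in> K" for i
    proof -
      have "\<exists>j<0. orb j (orb i y) \<in> K" using elim(1)[rule_format, of i] that sp[of i] by auto
      then obtain j where "j < 0" "orb j (orb i y) \<in> K" by blast
      then have "orb (j + i) y \<in> K" using elim(3) by simp
      then show ?thesis using \<open>j < 0\<close> by (intro exI[of _ "j + i"]) simp
    qed
    obtain k where k: "orb k y \<in> K" using elim by blast
    have 1: "\<exists>j>k + int n. orb j y \<in> K" for n
    proof (induction n)
      case 0 then show ?case using fut[OF k] by simp
    next
      case (Suc n)
      then obtain j where j: "j > k + int n" "orb j y \<in> K" by blast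
      from fut[OF j(2)] obtain j' where "j' > j" "orb j' y \<in> K" by blast
      then show ?case using j by (intro exI[of _ j']) simp
    qed
    have 2: "\<exists>j<k - int n. orb j y \<in> K" for n
    proof (induction n)
      case 0 then show ?case using past[OF k] by simp
    next
      case (Suc n)
      then obtain j where j: "j < k - int n" "orb j y \<in> K" by blast
      from past[OF j(2)] obtain j' where "j' < j" "orb j' y \<in> K" by blast
      then show ?case using j by (intro exI[of _ j']) simp
    qed
    show ?case
    proof (intro allI conjI)
      fix i
      have le: "i \<le> k + int (nat (i - k))" "k - int (nat (k - i)) \<le> i" by simp_all
      obtain j where "j > k + int (nat (i - k))" "orb j y \<in> K" using 1 by blast
      then show "\<exists>j>i. orb j y \<in> K" using le(1) by (intro exI[of _ j]) simp
      obtain j where "j < k - int (nat (k - i))" "orb j y \<in> K" using 2 by blast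
      then show "\<exists>j<i. orb j y \<in> K" using le(2) by (intro exI[of _ j]) simp
    qed
  qed
qed

text \<open>The partial maxima satisfy \<open>h (n + 1) = max 0 (f + h n \<circ> T)\<close>. If they were unbounded, then
  \<open>h (n + 1) - h n \<circ> T = max (- h n \<circ> T) f\<close> would converge to \<open>f\<close>, while its integral is
  nonnegative because \<open>h\<close> increases with \<open>n\<close>.\<close>

lemma AE_bounded_sums:
  fixes f :: "'a \<Rightarrow> real"
  assumes f [measurable]: "integrable M f" and neg: "(\<integral>y. f y \<partial>M) < 0"
  shows "AE y in M. \<exists>c. \<forall>n. (\<Sum>i<n. f (orb (int i) y)) \<le> c"
proof -
  \<comment> \<open>\<open>h n\<close> is the maximum of 0 and the forward sums of length at most
    \<open>n\<close>, written as a recursion along \<open>T\<close>.\<close>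
  define h where "h = rec_nat (\<lambda>y. 0) (\<lambda>_ g y. max 0 (f y + g (T y)))"
  have h0: "h 0 y = 0" and hS: "h (Suc n) y = max 0 (f y + h n (T y))" for n y
    by (simp_all add: h_def)
  have fm [measurable]: "f \<in> borel_measurable M" using f by (rule borel_measurable_integrable)
  have hm [measurable]: "h n \<in> borel_measurable M" for n
  proof (induction n)
    case 0 then show ?case by (simp add: h0 [abs_def])
  next
    case (Suc n)
    note Suc[measurable]
    show ?case unfolding hS [abs_def] by measurable
  qed
  have intT: "integrable M (\<lambda>y. g (T y))" "(\<integral>y. g (T y) \<partial>M) = (\<integral>y. g y \<partial>M)" if "integrable M g" for g :: "'a \<Rightarrow> real"
  proof -
    have [measurable]: "g \<in> borel_measurable M" using that by simp
    show "integrable M (\<lambda>y. g (T y))" using integrable_distr_eq[of T M M g] that distr_T by simp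
    show "(\<integral>y. g (T y) \<partial>M) = (\<integral>y. g y \<partial>M)" using integral_distr[of T M M g] distr_T by simp
  qed
  have hint: "integrable M (h n)" for n
  proof (induction n)
    case 0 then show ?case by (simp add: h0 [abs_def])
  next
    case (Suc n)
    show ?case unfolding hS [abs_def] using Suc intT f by (intro integrable_max) auto
  qed
  have h_nonneg: "h n y \<ge> 0" for n y by (cases n) (simp_all add: h0 hS)
  have h_Suc: "h n y \<le> h (Suc n) y" for n y
  proof (induction n arbitrary: y)
    case 0 then show ?case by (simp add: h_nonneg h0)
  next
    case (Suc n)
    show ?case unfolding hS[of "Suc n" y] hS[of n y] using Suc[of "T y"] by auto
  qed
  have h_mono: "h m y \<le> h n y" if "m \<le> n" for m n y
    using that by (rule lift_Suc_mono_le[of "\<lambda>n. h n y", OF h_Suc])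
  have sum_le: "(\<Sum>i<n. f ((T ^^ i) y)) \<le> h n y" for n y
  proof (induction n arbitrary: y)
    case 0 then show ?case by (simp add: h0)
  next
    case (Suc n)
    have "(\<Sum>i<Suc n. f ((T ^^ i) y)) = f y + (\<Sum>i<n. f ((T ^^ i) (T y)))"
      by (simp add: sum.lessThan_Suc_shift funpow_swap1 del: sum.lessThan_Suc)
    also have "\<dots> \<le> h (Suc n) y" unfolding hS using Suc[of "T y"] by simp
    finally show ?case .
  qed
  \<comment> \<open>Unboundedness of the maxima is invariant, since passing from \<open>y\<close> to
    \<open>T y\<close> changes them by at most the absolute value of \<open>f y\<close>; so it holds
    almost everywhere or almost nowhere.\<close>
  let ?U = "\<lambda>y. \<forall>c::nat. \<exists>n. h n y > c"
  have "?U (T y) \<longleftrightarrow> ?U y" for y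
  proof
    assume U: "?U (T y)"
    show "?U y"
    proof
      fix c :: nat
      obtain c' :: nat where c': "real c + \<bar>f y\<bar> \<le> c'" using real_arch_simple by blast
      obtain n where "h n (T y) > c'" using U by blast
      then have "h (Suc n) y > c" unfolding hS using c' by simp
      then show "\<exists>n. h n y > c" ..
    qed
  next
    assume U: "?U y"
    show "?U (T y)"
    proof
      fix c :: nat
      obtain c' :: nat where c': "real c + \<bar>f y\<bar> \<le> c'" using real_arch_simple by blast
      obtain n where "h n y > c'" using U by blast
      then have "h (Suc n) y > c'" using h_Suc[of n y] by simp
      then have "h n (T y) > c" unfolding hS using c' by simp
      then show "\<exists>n. h n (T y) > c" ..
    qed
  qed
  moreover have "Measurable.pred M ?U"
  proof -
    have [measurable]: "Measurable.pred M (\<lambda>y. real c < h n y)" for c n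
      unfolding pred_def by (rule borel_measurable_less) simp_all
    show ?thesis by measurable
  qed
  ultimately have "(AE y in M. ?U y) \<or> (AE y in M. \<not> ?U y)"
    by (intro AE_invariant_cases) simp_all
  then show ?thesis
  proof
    assume U: "AE y in M. ?U y"
    let ?g = "\<lambda>n y. h (Suc n) y - h n (T y)"
    have "(\<lambda>n. \<integral>y. ?g n y \<partial>M) \<longlonglongrightarrow> (\<integral>y. f y \<partial>M)"
    proof (rule integral_dominated_convergence)
      show "integrable M (\<lambda>y. \<bar>f y\<bar>)" using f by simp
      show "AE y in M. (\<lambda>n. ?g n y) \<longlonglongrightarrow> f y"
        using AE_orb[OF U]
      proof eventually_elim
        case (elim y)
        then have U: "?U (T y)" using spec[OF elim, of 1] by simp
        obtain c :: nat where c: "- f y \<le> c" using real_arch_simple by blast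
        obtain N where N: "h N (T y) > c" using U by blast
        have "?g n y = f y" if "n \<ge> N" for n
          using h_mono[OF that, of "T y"] N c unfolding hS by simp
        then have "\<forall>\<^sub>F n in sequentially. ?g n y = f y" by (auto simp: eventually_sequentially)
        then show ?case by (rule tendsto_eventually)
      qed
      show "AE y in M. norm (?g n y) \<le> \<bar>f y\<bar>" for n
      proof (rule AE_I2)
        fix y
        have "?g n y = max (- h n (T y)) (f y)" by (simp add: hS)
        then show "norm (?g n y) \<le> \<bar>f y\<bar>" using h_nonneg[of n "T y"] by auto
      qed
    qed measurable
    moreover have "(\<integral>y. ?g n y \<partial>M) \<ge> 0" for n
    proof -
      have "(\<integral>y. ?g n y \<partial>M) = (\<integral>y. h (Suc n) y \<partial>M) - (\<integral>y. h n y \<partial>M)"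
        using hint intT by simp
      moreover have "(\<integral>y. h n y \<partial>M) \<le> (\<integral>y. h (Suc n) y \<partial>M)"
        using hint h_Suc by (intro integral_mono) auto
      ultimately show ?thesis by simp
    qed
    ultimately have "(\<integral>y. f y \<partial>M) \<ge> 0" by (intro LIMSEQ_le_const) auto
    then show ?thesis using neg by simp
  next
    assume "AE y in M. \<not> ?U y"
    then show ?thesis
    proof eventually_elim
      case (elim y)
      then obtain c :: nat where c: "\<And>n. h n y \<le> c" by (auto simp: not_less)
      show ?case
        by (rule exI[of _ "real c"]) (use order_trans[OF sum_le c] in \<open>simp add: iter_def\<close>)
    qed
  qed
qed

end

section \<open>Visits to a set with uniform cylinders\<close>

text \<open>These finite-window events generalise the cylinder sets of the iterated joins; gap ends
  and block occurrences are also of this kind.\<close>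

definition window_determined :: "nat \<Rightarrow> ((int \<Rightarrow> nat) \<Rightarrow> bool) \<Rightarrow> bool" where
  "window_determined m P \<longleftrightarrow> (\<forall>x y. (\<forall>i. \<bar>i\<bar> \<le> int m \<longrightarrow> x i = y i) \<longrightarrow> P x = P y)"

lemma window_determined_gap_end: "window_determined R (\<lambda>x. gap_end R x 0)"
  by (auto simp: window_determined_def gap_end_def)

lemma window_determined_occurs: "window_determined (R + length v) (\<lambda>x. occurs R x v 0)"
  unfolding window_determined_def
proof (intro allI impI)
  fix x y :: "int \<Rightarrow> nat" assume *: "\<forall>i. \<bar>i\<bar> \<le> int (R + length v) \<longrightarrow> x i = y i"
  have "occurs R x v (0 + 0) \<longleftrightarrow> occurs R y v 0"
    by (rule occurs_cong_window) (use * in auto)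
  then show "occurs R x v 0 = occurs R y v 0" by simp
qed

definition recurrent :: "(int \<Rightarrow> nat) \<Rightarrow> bool" where
  "recurrent x \<longleftrightarrow> (\<forall>i. (\<exists>j>i. x j \<noteq> 1) \<and> (\<exists>j<i. x j \<noteq> 1))"

lemma sum_visit_mono: "a \<le> a' \<Longrightarrow> b' \<le> b \<Longrightarrow> sum (visit x) {a'..<b'} \<le> sum (visit x) {a..<b}"
  by (rule sum_mono2) auto

lemma recurrent_many_visits:
  assumes "recurrent x"
  shows "\<exists>d\<ge>i. sum (visit x) {i..<d} \<ge> real n" "\<exists>a\<le>i. sum (visit x) {a..<i} \<ge> real n"
proof -
  show "\<exists>d\<ge>i. sum (visit x) {i..<d} \<ge> real n"
  proof (induction n)
    case 0 show ?case by (intro exI[of _ i]) simp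
  next
    case (Suc n)
    then obtain d where d: "d \<ge> i" "sum (visit x) {i..<d} \<ge> real n" by blast
    obtain j where j: "j > d" "x j \<noteq> 1" using assms by (auto simp: recurrent_def)
    have "sum (visit x) {i..<j + 1} = sum (visit x) {i..<j} + visit x j" using d j by (intro sum_int_snoc) auto
    moreover have "sum (visit x) {i..<d} \<le> sum (visit x) {i..<j}" using j by (intro sum_visit_mono) auto
    ultimately show ?case using d j by (intro exI[of _ "j + 1"]) (simp add: visit_def)
  qed
  show "\<exists>a\<le>i. sum (visit x) {a..<i} \<ge> real n"
  proof (induction n)
    case 0 show ?case by (intro exI[of _ i]) simp
  next
    case (Suc n)
    then obtain a where a: "a \<le> i" "sum (visit x) {a..<i} \<ge> real n" by blast
    obtain j where j: "j < a" "x j \<noteq> 1" using assms by (auto simp: recurrent_def)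
    have "sum (visit x) {j..<i} = sum (visit x) {j..<j + 1} + sum (visit x) {j + 1..<i}"
      using a j by (intro sum_int_split) auto
    moreover have "sum (visit x) {j..<j + 1} = 1" using sum_int_snoc[of j j "visit x"] j by (simp add: visit_def)
    moreover have "sum (visit x) {a..<i} \<le> sum (visit x) {j + 1..<i}" using j by (intro sum_visit_mono) auto
    ultimately show ?case using a j by (intro exI[of _ j]) simp
  qed
qed

text \<open>No visit before the end of a block is followed by \<open>R\<close> times outside
  \<open>K\<close>, so every time of the block lies within distance \<open>R\<close> after a visit.
  A bound on the visits of a block therefore bounds its length.\<close>

lemma block_length_le_visits:
  assumes b: "block R x s e"
  shows "real_of_int (e - s) \<le> (real R + 1) * sum (visit x) {s..<e}"
proof -
  define A where "A = {i\<in>{s..<e}. x i \<noteq> 1}"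
  have "j \<in> (\<Union>i\<in>A. {i..i + int R})" if j: "j \<in> {s..<e}" for j
  proof -
    define B where "B = {i\<in>{s..j}. x i \<noteq> 1}"
    have "finite B" by (rule finite_subset[of B "{s..j}"]) (auto simp: B_def)
    have "s \<in> B" using b j by (simp add: B_def block_def)
    then have "B \<noteq> {}" by auto
    define i where "i = Max B"
    have iB: "i \<in> B" unfolding i_def using \<open>finite B\<close> \<open>B \<noteq> {}\<close> by (rule Max_in)
    have "j \<le> i + int R"
    proof (rule ccontr)
      assume gt: "\<not> j \<le> i + int R"
      have "x k = 1" if "k \<in> {i<..i + int R}" for k
      proof -
        have "k \<notin> B" using Max_ge[OF \<open>finite B\<close>, of k] that unfolding i_def by auto
        then show ?thesis using that gt iB by (auto simp: B_def)
      qed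
      then have "gap_end R x i" using iB by (simp add: gap_end_def B_def)
      then show False using b iB j by (auto simp: block_def B_def)
    qed
    then show ?thesis using iB j by (auto simp: A_def B_def)
  qed
  moreover have finA: "finite A" by (rule finite_subset[of A "{s..<e}"]) (auto simp: A_def)
  ultimately have "card {s..<e} \<le> card (\<Union>i\<in>A. {i..i + int R})" by (intro card_mono subsetI) simp_all
  also have "\<dots> \<le> (\<Sum>i\<in>A. card {i..i + int R})" by (rule card_UN_le) (rule finA)
  also have "\<dots> = (R + 1) * card A" by (simp add: nat_add_distrib)
  finally have "real (card {s..<e}) \<le> real ((R + 1) * card A)" by (simp only: of_nat_le_iff)
  moreover have "real (card A) = sum (visit x) {s..<e}"
    unfolding A_def visit_def sum_of_bool_eq[OF finite_atLeastLessThan_int] by (simp add: Int_def)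
  ultimately show ?thesis using b by (simp add: block_def algebra_simps)
qed

section \<open>Measurability of events of the coding\<close>

context invertible_system begin

lemma measurable_factor [measurable]:
  assumes [measurable]: "a \<in> measurable M (count_space UNIV)"
  shows "(\<lambda>y. factor (name a y) s e) \<in> measurable M (count_space UNIV)"
proof (subst measurable_count_space_eq2_countable, intro conjI ballI)
  fix v :: "nat list"
  have "Measurable.pred M (\<lambda>y. factor (name a y) s e = v)"
    unfolding factor_eq_iff name_def by measurable
  then have "{y\<in>space M. factor (name a y) s e = v} \<in> sets M" by (simp add: pred_def)
  also have "{y\<in>space M. factor (name a y) s e = v} = (\<lambda>y. factor (name a y) s e) -` {v} \<inter> space M" by auto
  finally show "(\<lambda>y. factor (name a y) s e) -` {v} \<inter> space M \<in> sets M" .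
qed auto

text \<open>The event is a function of the word read in the window, and there are only countably
  many words; so \<open>P\<close> may be arbitrary.\<close>

lemma measurable_window_determined:
  assumes [measurable]: "a \<in> measurable M (count_space UNIV)" and P: "window_determined m P"
  shows "Measurable.pred M (\<lambda>y. P (name a y))"
proof -
  have "P (name a y) \<longleftrightarrow> P (\<lambda>i. factor (name a y) (- int m) (int m) ! nat (i + int m))" for y
  proof -
    have "name a y i = factor (name a y) (- int m) (int m) ! nat (i + int m)" if "\<bar>i\<bar> \<le> int m" for i
      using that by (subst nth_factor) auto
    then show ?thesis by (intro P[unfolded window_determined_def, rule_format])
  qed
  moreover have "Measurable.pred M (\<lambda>y. (\<lambda>v. P (\<lambda>i. v ! nat (i + int m))) (factor (name a y) (- int m) (int m)))"
    by (rule measurable_compose[OF measurable_factor]) simp_all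
  ultimately show ?thesis by simp
qed

lemma measurable_name [measurable]:
  assumes [measurable]: "a \<in> measurable M (count_space UNIV)"
  shows "(\<lambda>y. name a y i) \<in> measurable M (count_space UNIV)"
  unfolding name_def by measurable

lemma measurable_gap_end [measurable]:
  assumes [measurable]: "a \<in> measurable M (count_space UNIV)"
  shows "Measurable.pred M (\<lambda>y. gap_end R (name a y) i)"
  unfolding gap_end_def by measurable

lemma measurable_block [measurable]:
  assumes [measurable]: "a \<in> measurable M (count_space UNIV)"
  shows "Measurable.pred M (\<lambda>y. block R (name a y) s e)"
  unfolding block_def by measurable

lemma measurable_occurs [measurable]:
  assumes [measurable]: "a \<in> measurable M (count_space UNIV)"
  shows "Measurable.pred M (\<lambda>y. occurs R (name a y) v i)"
  unfolding occurs_def by measurable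

lemma measurable_visit [measurable]:
  assumes [measurable]: "a \<in> measurable M (count_space UNIV)"
  shows "(\<lambda>y. visit (name a y) i) \<in> borel_measurable M"
  unfolding visit_def by measurable

end

text \<open>The assumption \<open>uniform\<close> is the uniformity of \<beta> in its working form:
  for finite-window events inside \<open>K\<close>, on all intervals, with a constant independent of
  the point. For the given partition it is derived in \<open>base_uniform\<close>.\<close>

locale uniform_base = ergodic_system +
  fixes b :: "'a \<Rightarrow> nat"
  assumes b [measurable]: "b \<in> measurable M (count_space UNIV)"
    and K_pos: "emeasure M {y\<in>space M. b y \<noteq> 1} > 0"
    and K_fin: "emeasure M {y\<in>space M. b y \<noteq> 1} < \<infinity>"
    and space_infinite: "emeasure M (space M) = \<infinity>"
    and uniform: "\<And>P m \<epsilon>. window_determined m P \<Longrightarrow> (\<And>x. P x \<Longrightarrow> x 0 \<noteq> 1) \<Longrightarrow> \<epsilon> > 0 \<Longrightarrow>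
      \<exists>c\<ge>0. AE y in M. near_freq (\<lambda>i. P (shift i (name b y))) (measure M {y\<in>space M. P (name b y)} / measure M {y\<in>space M. b y \<noteq> 1}) \<epsilon> c (name b y)"
begin

definition K :: "'a set" where "K = {y\<in>space M. b y \<noteq> 1}"

lemma K [measurable]: "K \<in> sets M"
  unfolding K_def by measurable

lemma K_measure: "emeasure M K = ennreal (measure M K)" "measure M K > 0"
proof -
  show eq: "emeasure M K = ennreal (measure M K)"
    using K_fin by (intro emeasure_eq_ennreal_measure) (auto simp: K_def)
  show "measure M K > 0"
    using K_pos[folded K_def] unfolding eq by simp
qed

definition freq :: "((int \<Rightarrow> nat) \<Rightarrow> bool) \<Rightarrow> ('a \<Rightarrow> nat) \<Rightarrow> real" where
  "freq P a = measure M {y\<in>space M. P (name a y)} / measure M K"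

lemma AE_recurrent_name: "AE y in M. recurrent (name b y)"
  using AE_recurrent[OF K K_pos[folded K_def]] AE_space
proof eventually_elim
  case (elim y)
  have "orb j y \<in> K \<longleftrightarrow> name b y j \<noteq> 1" for j
    using measurable_space[OF measurable_orb, of y j] elim by (simp add: K_def name_def)
  then show ?case using elim by (simp add: recurrent_def K_def[symmetric])
qed

lemma gap_end_subset_K: "gap_end R (name b y) 0 \<Longrightarrow> y \<in> space M \<Longrightarrow> y \<in> K"
  by (simp add: gap_end_def K_def name_def)

text \<open>This is where infinite measure enters. Without gap ends almost every point would have a
  visit among its last \<open>R + 1\<close> times, and finitely many translates of \<open>K\<close>,
  a set of finite measure, would cover the space.\<close>

lemma freq_gap_end_pos: "freq (\<lambda>x. gap_end R x 0) b > 0"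
proof (rule ccontr)
  assume "\<not> ?thesis"
  then have m0: "measure M {y\<in>space M. gap_end R (name b y) 0} = 0"
    using K_measure(2) by (simp add: freq_def zero_less_divide_iff zero_less_measure_iff) 
  have "emeasure M {y\<in>space M. gap_end R (name b y) 0} \<le> emeasure M K"
    using gap_end_subset_K by (intro emeasure_mono) auto
  then have "emeasure M {y\<in>space M. gap_end R (name b y) 0} \<noteq> \<infinity>" using K_measure by (auto simp: top_unique)
  then have "emeasure M {y\<in>space M. gap_end R (name b y) 0} = 0"
    using m0 by (simp add: emeasure_eq_ennreal_measure)
  then have "AE y in M. \<not> gap_end R (name b y) 0"
    by (subst AE_iff_measurable[OF _ refl]) simp_all
  then have "AE y in M. \<forall>i. \<not> gap_end R (name b (orb i y)) 0" by (rule AE_orb)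
  then have "AE y in M. y \<in> (\<Union>i\<in>{- int R..0}. orb i -` K \<inter> space M)"
    using AE_recurrent_name AE_name_orb[of b] AE_space
  proof eventually_elim
    case (elim y)
    let ?x = "name b y"
    have no: "\<not> gap_end R ?x i" for i
    proof -
      have "gap_end R (shift i ?x) 0 \<longleftrightarrow> gap_end R ?x (i + 0)"
        by (rule gap_end_cong_window[symmetric]) (simp add: shift_def)
      then show ?thesis using elim by simp
    qed
    have "\<exists>j\<in>{- int R..0}. ?x j \<noteq> 1"
    proof (rule ccontr)
      assume "\<not> ?thesis"
      then have w: "\<forall>j\<in>{1 - int R..<1}. ?x j = 1" by auto
      have "\<exists>s. s < - int R \<and> ?x s \<noteq> 1" using elim unfolding recurrent_def by blast
      then obtain s where "s < - int R" "?x s \<noteq> 1" by blast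
      then have "\<exists>j. s \<le> j \<and> j < 1 \<and> gap_end R ?x j" using w by (intro gap_end_before_gap) auto
      then show False using no by blast
    qed
    then show ?case using elim measurable_space[OF measurable_orb] by (auto simp: name_def K_def)
  qed
  then have "emeasure M (space M) \<le> emeasure M (\<Union>i\<in>{- int R..0}. orb i -` K \<inter> space M)"
    by (intro emeasure_mono_AE) auto
  also have "\<dots> \<le> (\<Sum>i\<in>{- int R..0}. emeasure M (orb i -` K \<inter> space M))"
    by (rule emeasure_subadditive_finite) auto
  also have "\<dots> = (\<Sum>i\<in>{- int R..0}. emeasure M K)" by (simp add: emeasure_orb)
  also have "\<dots> < \<infinity>" by (subst K_measure(1), subst sum_ennreal) simp_all
  finally show False using space_infinite by simp
qed

text \<open>A point that is a gap end for every \<open>R\<close> would never return to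
  \<open>K\<close>. Recurrence excludes this, and continuity from above gives the limit.\<close>

lemma freq_gap_end_tendsto: "(\<lambda>R. freq (\<lambda>x. gap_end R x 0) b) \<longlonglongrightarrow> 0"
proof -
  define A where "A = (\<lambda>R. {y\<in>space M. gap_end R (name b y) 0})"
  have Am [measurable]: "A R \<in> sets M" for R unfolding A_def by measurable
  have AK: "emeasure M (A R) \<noteq> \<infinity>" for R
  proof -
    have "emeasure M (A R) \<le> emeasure M K"
      unfolding A_def using gap_end_subset_K by (intro emeasure_mono) auto
    then show ?thesis using K_measure by (auto simp: top_unique)
  qed
  have "(\<lambda>R. measure M (A R)) \<longlonglongrightarrow> measure M (\<Inter>R. A R)"
  proof (rule Lim_measure_decseq)
    show "decseq A" by (rule decseq_SucI) (auto simp: A_def gap_end_def)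
  qed (use AK in auto)
  moreover have "AE y in M. y \<notin> (\<Inter>R. A R)"
    using AE_recurrent_name
  proof eventually_elim
    case (elim y)
    obtain j where j: "j > 0" "name b y j \<noteq> 1" using elim by (auto simp: recurrent_def)
    then have "\<not> gap_end (nat j) (name b y) 0" by (auto simp: gap_end_def)
    then show ?case by (auto simp: A_def)
  qed
  then have "emeasure M (\<Inter>R. A R) = 0"
    using AE_iff_null_sets[of "\<Inter>R. A R" M] by (auto simp: null_sets_def)
  ultimately have "(\<lambda>R. measure M (A R) / measure M K) \<longlonglongrightarrow> 0 / measure M K"
    using K_measure by (intro tendsto_divide) (auto simp: measure_def)
  then show ?thesis by (simp add: freq_def A_def)
qed

lemma uniform_gap_end:
  assumes "\<epsilon> > 0"
  shows "\<exists>c\<ge>0. AE y in M. near_freq (\<lambda>i. gap_end R (name b y) i) (freq (\<lambda>x. gap_end R x 0) b) \<epsilon> c (name b y)"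
proof -
  have "gap_end R (shift i x) 0 \<longleftrightarrow> gap_end R x i" for i x
    using gap_end_cong_window[of 0 R x i "shift i x"] by (simp add: shift_def)
  then show ?thesis
    using uniform[OF window_determined_gap_end _ assms, of R] by (simp add: gap_end_def freq_def K_def)
qed

text \<open>\<open>c\<close> stands for a cost per block and is given first. A sufficiently large
  gap length makes blocks so rare that the total cost is at most \<epsilon> per visit, up to a
  constant.\<close>

lemma gap_end_sparse:
  assumes "\<epsilon> > 0" "c \<ge> 0"
  shows "\<exists>R'>R. \<exists>c'. AE y in M. \<forall>s e. s \<le> e \<longrightarrow>
     c * (\<Sum>i\<in>{s..<e}. of_bool (gap_end R' (name b y) i)) \<le> \<epsilon> * sum (visit (name b y)) {s..<e} + c'"
proof -
  \<comment> \<open>One share \<eta> bounds the frequency of gap ends, the other their deviation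
    from it; adding 1 to \<open>c\<close> keeps \<eta> positive when \<open>c\<close> is 0.\<close>
  define \<eta> where "\<eta> = \<epsilon> / (2 * (c + 1))"
  have \<eta>: "\<eta> > 0" "c * (2 * \<eta>) \<le> \<epsilon>" using assms by (auto simp: \<eta>_def field_simps)
  have "\<forall>\<^sub>F R in sequentially. freq (\<lambda>x. gap_end R x 0) b < \<eta>"
    using freq_gap_end_tendsto \<eta> by (simp add: order_tendsto_iff)
  then obtain R0 where R0: "\<And>R. R \<ge> R0 \<Longrightarrow> freq (\<lambda>x. gap_end R x 0) b < \<eta>" by (auto simp: eventually_sequentially)
  define R' where "R' = max (Suc R) R0"
  obtain c1 where c1: "c1 \<ge> 0" "AE y in M. near_freq (\<lambda>i. gap_end R' (name b y) i) (freq (\<lambda>x. gap_end R' x 0) b) \<eta> c1 (name b y)"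
    using uniform_gap_end[OF \<eta>(1), of R'] by blast
  from c1(2) have "AE y in M. \<forall>s e. s \<le> e \<longrightarrow>
     c * (\<Sum>i\<in>{s..<e}. of_bool (gap_end R' (name b y) i)) \<le> \<epsilon> * sum (visit (name b y)) {s..<e} + c * c1"
  proof eventually_elim
    case (elim y)
    show ?case
    proof (intro allI impI)
      fix s e :: int assume "s \<le> e"
      let ?v = "sum (visit (name b y)) {s..<e}"
      have v0: "?v \<ge> 0" by (intro sum_nonneg) simp
      have "freq (\<lambda>x. gap_end R' x 0) b * ?v \<le> \<eta> * ?v"
        using R0[of R'] v0 by (intro mult_right_mono) (auto simp: R'_def)
      then have "(\<Sum>i\<in>{s..<e}. of_bool (gap_end R' (name b y) i)) \<le> 2 * \<eta> * ?v + c1"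
        using elim[rule_format, OF \<open>s \<le> e\<close>] by (simp add: abs_le_iff)
      then have "c * (\<Sum>i\<in>{s..<e}. of_bool (gap_end R' (name b y) i)) \<le> c * (2 * \<eta> * ?v + c1)"
        using assms by (intro mult_left_mono) auto
      also have "\<dots> = (c * (2 * \<eta>)) * ?v + c * c1" by (simp add: algebra_simps)
      also have "\<dots> \<le> \<epsilon> * ?v + c * c1" using \<eta> v0 by (intro add_right_mono mult_right_mono) auto
      finally show "c * (\<Sum>i\<in>{s..<e}. of_bool (gap_end R' (name b y) i)) \<le> \<epsilon> * ?v + c * c1" .
    qed
  qed
  then show ?thesis by (intro exI[of _ R']) (auto simp: R'_def)
qed

lemma AE_blocks:
  "\<exists>h>0. AE y in M. (\<forall>s e. block R (name b y) s e \<longrightarrow> e - s < int h) \<and>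
     (\<forall>i. name b y i \<noteq> 1 \<longrightarrow> (\<exists>s e. block R (name b y) s e \<and> s \<le> i \<and> i \<le> e))"
proof -
  define p where "p = freq (\<lambda>x. gap_end R x 0) b"
  have p: "p > 0" unfolding p_def by (rule freq_gap_end_pos)
  then obtain c where c: "c \<ge> 0" "AE y in M. near_freq (\<lambda>i. gap_end R (name b y) i) p (p / 2) c (name b y)"
    using uniform_gap_end[of "p / 2" R] by (auto simp: p_def)
  \<comment> \<open>With slope half the frequency, an interval without gap ends has at most
    \<open>2 * c / p\<close> visits. Hence every interval with \<open>n\<close> visits contains a
    gap end; this bounds the blocks and also provides gaps on both sides of a visit.\<close>
  define n where "n = nat \<lceil>2 * c / p\<rceil> + 1"
  have n: "real n > 2 * c / p" unfolding n_def by linarith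
  define h where "h = (R + 1) * n + 1"
  from c(2) AE_recurrent_name have "AE y in M. (\<forall>s e. block R (name b y) s e \<longrightarrow> e - s < int h) \<and>
     (\<forall>i. name b y i \<noteq> 1 \<longrightarrow> (\<exists>s e. block R (name b y) s e \<and> s \<le> i \<and> i \<le> e))"
  proof eventually_elim
    case (elim y)
    let ?x = "name b y"
    have ex: "\<exists>i\<in>{s..<e}. gap_end R ?x i" if "s \<le> e" "sum (visit ?x) {s..<e} \<ge> n" for s e
    proof (rule ccontr)
      assume "\<not> ?thesis"
      then have "(\<Sum>i\<in>{s..<e}. of_bool (gap_end R ?x i)) = (0::real)" by (intro sum.neutral) auto
      then have "p * sum (visit ?x) {s..<e} \<le> p / 2 * sum (visit ?x) {s..<e} + c"
        using elim(1)[rule_format, OF that(1)] by simp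
      moreover have "p / 2 * (2 * c / p) < p / 2 * sum (visit ?x) {s..<e}"
        using n that p by (intro mult_strict_left_mono) auto
      ultimately show False using p by (simp add: field_simps)
    qed
    show ?case
    proof (intro conjI allI impI)
      fix s e assume bl: "block R ?x s e"
      then have "s \<le> e" "\<not> (\<exists>i\<in>{s..<e}. gap_end R ?x i)" by (auto simp: block_def)
      then have "sum (visit ?x) {s..<e} < n" using ex[of s e] by linarith
      then have "(real R + 1) * sum (visit ?x) {s..<e} \<le> (real R + 1) * n" by (intro mult_left_mono) auto
      then have "real_of_int (e - s) \<le> (real R + 1) * n" using block_length_le_visits[OF bl] by linarith
      also have "\<dots> = real_of_int (int ((R + 1) * n))" by (simp add: algebra_simps)
      finally have "e - s \<le> int ((R + 1) * n)" by (simp only: of_int_le_iff)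
      then show "e - s < int h" unfolding h_def by simp
    next
      fix i assume i: "?x i \<noteq> 1"
      obtain d where "d \<ge> i" "sum (visit ?x) {i..<d} \<ge> n" using recurrent_many_visits(1)[OF elim(2)] by blast
      then obtain g where g: "i \<le> g" "gap_end R ?x g" using ex[of i d] by auto
      obtain a where "a \<le> i" "sum (visit ?x) {a..<i} \<ge> n" using recurrent_many_visits(2)[OF elim(2)] by blast
      then obtain g' where g': "g' < i" "gap_end R ?x g'" using ex[of a i] by auto
      have "g' + int R < i" using g' i by (force simp: gap_end_def)
      moreover have "\<forall>j\<in>{g' + int R + 1 - int R..<g' + int R + 1}. ?x j = 1" using g' by (auto simp: gap_end_def)
      ultimately have "\<exists>s e. block R ?x s e \<and> g' + int R + 1 \<le> s \<and> s \<le> i \<and> i \<le> e \<and> e \<le> g"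
        using i g by (intro block_exists) auto
      then show "\<exists>s e. block R ?x s e \<and> s \<le> i \<and> i \<le> e" by blast
    qed
  qed
  then show ?thesis by (intro exI[of _ h]) (simp add: h_def)
qed

end

section \<open>Blocks with excessive sums\<close>

text \<open>The combinatorial core of \<open>bad_blocks_small\<close>, with \<open>E\<close> the
  times of large forward sums. The sum is cut at the first visit outside \<open>E\<close>: from
  there on it is at most \<open>c\<close>, so the excess is earned before.\<close>

lemma many_exceedances:
  fixes f :: "int \<Rightarrow> real"
  assumes f: "\<And>i. f i \<le> visit x i" and \<epsilon>: "\<epsilon> \<le> 1"
    and tail: "\<And>i. i \<in> {0..<n} \<Longrightarrow> x i \<noteq> 1 \<Longrightarrow> i \<notin> E \<Longrightarrow> sum f {i..<n} \<le> c"
    and total: "sum f {0..<n} > \<epsilon> * sum (visit x) {0..<n} + c"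
  shows "\<epsilon> * sum (visit x) {0..<n} \<le> (\<Sum>i\<in>{0..<n}. of_bool (x i \<noteq> 1 \<and> i \<in> E))"
proof -
  define A where "A = {i\<in>{0..<n}. x i \<noteq> 1 \<and> i \<notin> E}"
  have finA: "finite A" by (rule finite_subset[of A "{0..<n}"]) (auto simp: A_def)
  have v0: "sum (visit x) {0..<n} \<ge> 0" by (intro sum_nonneg) simp
  show ?thesis
  proof (cases "A = {}")
    case True
    have "\<epsilon> * sum (visit x) {0..<n} \<le> sum (visit x) {0..<n}" using mult_right_mono[OF \<epsilon> v0] by simp
    also have "\<dots> = (\<Sum>i\<in>{0..<n}. of_bool (x i \<noteq> 1 \<and> i \<in> E))"
      using True by (intro sum.cong) (auto simp: A_def visit_def)
    finally show ?thesis .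
  next
    case False
    define k where "k = Min A"
    have kA: "k \<in> A" unfolding k_def using finA False by (rule Min_in)
    have k: "0 \<le> k" "k \<le> n" "sum f {k..<n} \<le> c" using kA tail by (auto simp: A_def)
    have inE: "i \<in> E" if "i \<in> {0..<k}" "x i \<noteq> 1" for i
    proof -
      have "i \<notin> A" using Min_le[OF finA, of i] that by (auto simp: k_def[symmetric])
      then show ?thesis using that k by (auto simp: A_def)
    qed
    have "\<epsilon> * sum (visit x) {0..<n} \<le> sum f {0..<k}"
      using total k sum_int_split[OF k(1,2), of f] by simp
    also have "\<dots> \<le> (\<Sum>i\<in>{0..<k}. of_bool (x i \<noteq> 1 \<and> i \<in> E))"
    proof (rule sum_mono)
      fix i assume "i \<in> {0..<k}"
      then show "f i \<le> of_bool (x i \<noteq> 1 \<and> i \<in> E)" using f[of i] inE[of i] by (cases "x i = 1") (auto simp: visit_def)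
    qed
    also have "\<dots> \<le> (\<Sum>i\<in>{0..<n}. of_bool (x i \<noteq> 1 \<and> i \<in> E))"
      using k by (intro sum_mono2) auto
    finally show ?thesis .
  qed
qed

lemma sum_nat_int:
  fixes f :: "int \<Rightarrow> real"
  shows "(\<Sum>k<m. f (int k)) = sum f {0..<int m}"
  by (rule sum.reindex_bij_witness[of _ nat int]) auto

context uniform_base begin

text \<open>Each point of a marked block is moved to the start of its block, which preserves
  measure. The measure of a part of the marked blocks becomes an integral, over block starts, of the
  number of times spent in \<open>A\<close>; two choices of \<open>A\<close> can then be compared
  block by block.\<close>

lemma emeasure_Union_blocks:
  assumes A [measurable]: "A \<in> sets M" and Bd [measurable]: "\<And>s e. Measurable.pred M (Bd s e)"
    and shift: "AE y in M. \<forall>i s e. Bd s e (orb i y) \<longleftrightarrow> Bd (i + s) (i + e) y"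
    and block: "\<And>s e y. Bd s e y \<Longrightarrow> block R (name b y) s e"
    and h: "AE y in M. \<forall>s e. block R (name b y) s e \<longrightarrow> e - s < int h"
  shows "emeasure M {y\<in>space M. y \<in> A \<and> (\<exists>s e. Bd s e y \<and> s \<le> 0 \<and> 0 \<le> e)} =
    (\<integral>\<^sup>+y. ennreal (\<Sum>n\<in>{0..<int h}. \<Sum>l\<in>{0..<n + 1}. of_bool (orb l y \<in> A \<and> Bd 0 n y)) \<partial>M)"
proof -
  \<comment> \<open>\<open>n\<close> is the length of the block minus one and \<open>l\<close> the
    place of the point in it. Uniqueness of blocks makes the pieces disjoint.\<close>
  define J where "J = (SIGMA n:{0..<int h}. {0..<n + 1})"
  define X where "X = (\<lambda>(n, l). {y\<in>space M. y \<in> A \<and> Bd (- l) (n - l) y})"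
  have finJ: "finite J" by (simp add: J_def)
  have Xm [measurable]: "X p \<in> sets M" for p unfolding X_def by (cases p) simp
  have "disjoint_family_on X J"
  proof -
    have "(n, l) = (n', l')" if "(n, l) \<in> J" "(n', l') \<in> J" "y \<in> X (n, l)" "y \<in> X (n', l')" for n l n' l' y
    proof -
      have b1: "block R (name b y) (- l) (n - l)" and b2: "block R (name b y) (- l') (n' - l')"
        using that by (auto simp: X_def dest: block)
      have "- l = - l'" "n - l = n' - l'"
        using that block_unique[OF b1 b2, of 0] by (auto simp: J_def)
      then show ?thesis by simp
    qed
    then show ?thesis unfolding disjoint_family_on_def by fast
  qed
  then have disj: "(\<Sum>p\<in>J. emeasure M (X p)) = emeasure M (\<Union>p\<in>J. X p)"
    using finJ by (intro sum_emeasure) auto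
  have "emeasure M {y\<in>space M. y \<in> A \<and> (\<exists>s e. Bd s e y \<and> s \<le> 0 \<and> 0 \<le> e)} = emeasure M (\<Union>p\<in>J. X p)"
  proof (rule emeasure_eq_AE)
    show "AE y in M. y \<in> {y\<in>space M. y \<in> A \<and> (\<exists>s e. Bd s e y \<and> s \<le> 0 \<and> 0 \<le> e)} \<longleftrightarrow> y \<in> (\<Union>p\<in>J. X p)"
      using h
    proof eventually_elim
      case (elim y)
      show ?case
      proof
        assume "y \<in> {y\<in>space M. y \<in> A \<and> (\<exists>s e. Bd s e y \<and> s \<le> 0 \<and> 0 \<le> e)}"
        then obtain s e where se: "y \<in> space M" "y \<in> A" "Bd s e y" "s \<le> 0" "0 \<le> e" by blast
        then have "e - s < int h" using elim block by blast
        then have "(e - s, - s) \<in> J" "y \<in> X (e - s, - s)" using se by (auto simp: J_def X_def)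
        then show "y \<in> (\<Union>p\<in>J. X p)" by blast
      next
        assume "y \<in> (\<Union>p\<in>J. X p)"
        then obtain n l where "(n, l) \<in> J" "y \<in> X (n, l)" by auto
        then have "y \<in> space M" "y \<in> A" "Bd (- l) (n - l) y" "- l \<le> 0" "0 \<le> n - l"
          by (auto simp: J_def X_def)
        then show "y \<in> {y\<in>space M. y \<in> A \<and> (\<exists>s e. Bd s e y \<and> s \<le> 0 \<and> 0 \<le> e)}" by blast
      qed
    qed
    show "(\<Union>p\<in>J. X p) \<in> sets M" using finJ by (intro sets.finite_UN) auto
  qed measurable
  also have "\<dots> = (\<Sum>p\<in>J. emeasure M (X p))" by (rule disj[symmetric])
  also have "\<dots> = (\<Sum>p\<in>J. \<integral>\<^sup>+y. ennreal (case p of (n, l) \<Rightarrow> of_bool (orb l y \<in> A \<and> Bd 0 n y)) \<partial>M)"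
  proof (rule sum.cong[OF refl])
    fix p assume "p \<in> J"
    obtain n l where p: "p = (n, l)" by (cases p)
    have "emeasure M (X p) = emeasure M (orb l -` X p \<inter> space M)" by (rule emeasure_orb[symmetric]) (rule Xm)
    also have "\<dots> = emeasure M {y\<in>space M. orb l y \<in> A \<and> Bd 0 n y}"
    proof (rule emeasure_eq_AE)
      show "AE y in M. y \<in> orb l -` X p \<inter> space M \<longleftrightarrow> y \<in> {y\<in>space M. orb l y \<in> A \<and> Bd 0 n y}"
        using shift AE_space
      proof eventually_elim
        case (elim y)
        have "Bd (- l) (n - l) (orb l y) \<longleftrightarrow> Bd 0 n y" using elim(1)[rule_format, of "- l" "n - l" l] by simp
        then show ?case using elim measurable_space[OF measurable_orb, of y l] by (auto simp: X_def p)
      qed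
    qed measurable
    also have "\<dots> = (\<integral>\<^sup>+y. indicator {y\<in>space M. orb l y \<in> A \<and> Bd 0 n y} y \<partial>M)"
      by (rule nn_integral_indicator[symmetric]) measurable
    also have "\<dots> = (\<integral>\<^sup>+y. ennreal (case p of (n, l) \<Rightarrow> of_bool (orb l y \<in> A \<and> Bd 0 n y)) \<partial>M)"
      by (rule nn_integral_cong) (simp add: p indicator_def)
    finally show "emeasure M (X p) = (\<integral>\<^sup>+y. ennreal (case p of (n, l) \<Rightarrow> of_bool (orb l y \<in> A \<and> Bd 0 n y)) \<partial>M)" .
  qed
  also have "\<dots> = (\<integral>\<^sup>+y. (\<Sum>p\<in>J. ennreal (case p of (n, l) \<Rightarrow> of_bool (orb l y \<in> A \<and> Bd 0 n y))) \<partial>M)"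
    by (rule nn_integral_sum[symmetric]) (auto split: prod.split)
  also have "\<dots> = (\<integral>\<^sup>+y. ennreal (\<Sum>n\<in>{0..<int h}. \<Sum>l\<in>{0..<n + 1}. of_bool (orb l y \<in> A \<and> Bd 0 n y)) \<partial>M)"
  proof (rule nn_integral_cong)
    fix y
    have "(\<Sum>p\<in>J. ennreal (case p of (n, l) \<Rightarrow> of_bool (orb l y \<in> A \<and> Bd 0 n y))) =
      ennreal (\<Sum>p\<in>J. (case p of (n, l) \<Rightarrow> of_bool (orb l y \<in> A \<and> Bd 0 n y)))"
      by (rule sum_ennreal) (auto split: prod.split)
    also have "(\<Sum>p\<in>J. (case p of (n, l) \<Rightarrow> of_bool (orb l y \<in> A \<and> Bd 0 n y))) =
      (\<Sum>n\<in>{0..<int h}. \<Sum>l\<in>{0..<n + 1}. of_bool (orb l y \<in> A \<and> Bd 0 n y) :: real)"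
      unfolding J_def by (rule sum.Sigma[symmetric]) auto
    finally show "(\<Sum>p\<in>J. ennreal (case p of (n, l) \<Rightarrow> of_bool (orb l y \<in> A \<and> Bd 0 n y))) =
      ennreal (\<Sum>n\<in>{0..<int h}. \<Sum>l\<in>{0..<n + 1}. of_bool (orb l y \<in> A \<and> Bd 0 n y))" .
  qed
  finally show ?thesis .
qed

text \<open>In a bad block all visits before the first one with a small forward sum lie in the set where
  forward sums are large. As each visit contributes at most one to the excess, these visits make up
  at least the fraction \<open>\<epsilon>\<close> of the block.\<close>

lemma bad_blocks_small:
  fixes g :: "'a \<Rightarrow> real"
  assumes g [measurable]: "g \<in> borel_measurable M" and gK: "\<And>y. y \<in> space M \<Longrightarrow> \<bar>g y\<bar> \<le> indicator K y"
    and g0: "(\<integral>y. g y \<partial>M) = 0" and \<epsilon>: "0 < \<epsilon>" "\<epsilon> \<le> 1" and \<delta>: "\<delta> > 0"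
  shows "\<exists>c0::nat. \<forall>c\<ge>real c0. \<forall>R. emeasure M {y\<in>space M. y \<in> K \<and> (\<exists>s e. (block R (name b y) s e \<and>
    (\<Sum>i\<in>{s..<e + 1}. g (orb i y)) > 2 * \<epsilon> * sum (visit (name b y)) {s..<e + 1} + c) \<and> s \<le> 0 \<and> 0 \<le> e)} \<le> ennreal \<delta>"
proof -
  \<comment> \<open>Subtracting \<epsilon> per visit makes the integral negative. The other
    \<epsilon> of the slope \<open>2 * \<epsilon>\<close> is the fraction of the visits of a bad
    block that lie in the set of large forward sums.\<close>
  define f where "f = (\<lambda>y. g y - \<epsilon> * indicator K y)"
  have [measurable]: "f \<in> borel_measurable M" unfolding f_def by measurable
  have intK: "integrable M (indicator K :: 'a \<Rightarrow> real)" using K_measure by (intro integrable_real_indicator) auto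
  have intg: "integrable M g"
    by (rule Bochner_Integration.integrable_bound[OF intK]) (use gK in auto)
  have "(\<integral>y. f y \<partial>M) = - \<epsilon> * measure M K"
    unfolding f_def using intK intg g0 by simp
  then have "(\<integral>y. f y \<partial>M) < 0" using \<epsilon> K_measure by simp
  moreover have "integrable M f" unfolding f_def using intK intg by simp
  ultimately have bdd: "AE y in M. \<exists>c. \<forall>n. (\<Sum>i<n. f (orb (int i) y)) \<le> c" by (rule AE_bounded_sums[rotated])
  define E where "E = (\<lambda>c::nat. {y\<in>space M. y \<in> K \<and> (\<exists>n. (\<Sum>i<n. f (orb (int i) y)) > real c)})"
  have [measurable]: "Measurable.pred M (\<lambda>y. real c < (\<Sum>i<n. f (orb (int i) y)))" for c n
    unfolding pred_def by (rule borel_measurable_less) simp_all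
  have Em [measurable]: "E c \<in> sets M" for c unfolding E_def by measurable
  have EK: "emeasure M (E c) \<noteq> \<infinity>" for c
  proof -
    have "emeasure M (E c) \<le> emeasure M K" by (intro emeasure_mono) (auto simp: E_def)
    then show ?thesis using K_measure by (auto simp: top_unique)
  qed
  have "(\<lambda>c. emeasure M (E c)) \<longlonglongrightarrow> emeasure M (\<Inter>c. E c)"
  proof (rule Lim_emeasure_decseq)
    show "decseq E"
    proof (rule decseq_SucI, rule subsetI)
      fix c y assume "y \<in> E (Suc c)"
      then obtain n where "y \<in> K" "y \<in> space M" "(\<Sum>i<n. f (orb (int i) y)) > real (Suc c)" by (auto simp: E_def)
      then show "y \<in> E c" by (auto simp: E_def intro!: exI[of _ n])
    qed
  qed (use EK in auto)
  moreover have "AE y in M. y \<notin> (\<Inter>c. E c)"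
    using bdd
  proof eventually_elim
    case (elim y)
    then obtain c where c: "\<And>n. (\<Sum>i<n. f (orb (int i) y)) \<le> c" by blast
    obtain c' :: nat where "c \<le> c'" using real_arch_simple by blast
    then have "y \<notin> E c'" using order_trans[OF c, of "real c'"] by (auto simp: E_def not_less)
    then show ?case by blast
  qed
  then have "emeasure M (\<Inter>c. E c) = 0"
    using AE_iff_null_sets[of "\<Inter>c. E c" M] by (auto simp: null_sets_def)
  ultimately have "(\<lambda>c. emeasure M (E c)) \<longlonglongrightarrow> 0" by simp
  moreover have "0 < ennreal (\<epsilon> * \<delta>)" using \<epsilon> \<delta> by simp
  ultimately have "\<forall>\<^sub>F c in sequentially. emeasure M (E c) < ennreal (\<epsilon> * \<delta>)" by (rule order_tendstoD)
  \<comment> \<open>\<open>c0\<close> comes from the forward sums alone and so serves all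
    \<open>R\<close>. The factor \<epsilon> in the bound is lost in passing from the visits of bad
    blocks to those in \<open>E c0\<close>.\<close>
  then obtain c0 where c0: "emeasure M (E c0) < ennreal (\<epsilon> * \<delta>)" by (auto simp: eventually_sequentially)
  show ?thesis
  proof (intro exI[of _ c0] allI impI)
    fix c :: real and R assume c: "c \<ge> real c0"
    define Bd where "Bd = (\<lambda>s e y. block R (name b y) s e \<and>
      (\<Sum>i\<in>{s..<e + 1}. g (orb i y)) > 2 * \<epsilon> * sum (visit (name b y)) {s..<e + 1} + c)"
    define G where "G = (\<lambda>A. {y\<in>space M. y \<in> A \<and> (\<exists>s e. Bd s e y \<and> s \<le> 0 \<and> 0 \<le> e)})"
    obtain h where h: "AE y in M. \<forall>s e. block R (name b y) s e \<longrightarrow> e - s < int h"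
      using AE_blocks[of R] by auto
    have Bdm [measurable]: "Measurable.pred M (Bd s e)" for s e
    proof -
      have [measurable]: "Measurable.pred M (\<lambda>y. 2 * \<epsilon> * sum (visit (name b y)) {s..<e + 1} + c < (\<Sum>i\<in>{s..<e + 1}. g (orb i y)))"
        unfolding pred_def by (rule borel_measurable_less) simp_all
      show ?thesis unfolding Bd_def by measurable
    qed
    have sh: "AE y in M. \<forall>i s e. Bd s e (orb i y) \<longleftrightarrow> Bd (i + s) (i + e) y"
      using AE_name_orb[of b] AE_orb_add
    proof eventually_elim
      case (elim y)
      show ?case
      proof (intro allI)
        fix i s e
        have "sum (visit (name b (orb i y))) {s..<e + 1} = (\<Sum>j\<in>{s..<e + 1}. visit (name b y) (i + j))"
          using elim(1) by (simp add: visit_def shift_def)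
        also have "\<dots> = sum (visit (name b y)) {i + s..<i + e + 1}" using sum_int_shift[of "visit (name b y)" i s "e + 1"] by (simp add: add.assoc)
        finally have 1: "sum (visit (name b (orb i y))) {s..<e + 1} = sum (visit (name b y)) {i + s..<i + e + 1}" .
        have "(\<Sum>j\<in>{s..<e + 1}. g (orb j (orb i y))) = (\<Sum>j\<in>{s..<e + 1}. g (orb (i + j) y))"
          using elim(2) by (simp add: add.commute)
        also have "\<dots> = (\<Sum>j\<in>{i + s..<i + e + 1}. g (orb j y))" using sum_int_shift[of "\<lambda>j. g (orb j y)" i s "e + 1"] by (simp add: add.assoc)
        finally show "Bd s e (orb i y) \<longleftrightarrow> Bd (i + s) (i + e) y"
          unfolding Bd_def 1 using elim(1) by (simp add: block_shift)
      qed
    qed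
    have eq: "emeasure M (G A) = (\<integral>\<^sup>+y. ennreal (\<Sum>n\<in>{0..<int h}. \<Sum>l\<in>{0..<n + 1}. of_bool (orb l y \<in> A \<and> Bd 0 n y)) \<partial>M)"
      if "A \<in> sets M" for A
      unfolding G_def using that sh h by (intro emeasure_Union_blocks[where R = R]) (auto simp: Bd_def[abs_def] intro: Bdm[unfolded Bd_def])
    have "ennreal \<epsilon> * emeasure M (G K) =
      (\<integral>\<^sup>+y. ennreal \<epsilon> * ennreal (\<Sum>n\<in>{0..<int h}. \<Sum>l\<in>{0..<n + 1}. of_bool (orb l y \<in> K \<and> Bd 0 n y)) \<partial>M)"
      unfolding eq[OF K] by (rule nn_integral_cmult[symmetric]) measurable
    also have "\<dots> \<le> (\<integral>\<^sup>+y. ennreal (\<Sum>n\<in>{0..<int h}. \<Sum>l\<in>{0..<n + 1}. of_bool (orb l y \<in> E c0 \<and> Bd 0 n y)) \<partial>M)"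
    proof (rule nn_integral_mono_AE)
      show "AE y in M. ennreal \<epsilon> * ennreal (\<Sum>n\<in>{0..<int h}. \<Sum>l\<in>{0..<n + 1}. of_bool (orb l y \<in> K \<and> Bd 0 n y))
        \<le> ennreal (\<Sum>n\<in>{0..<int h}. \<Sum>l\<in>{0..<n + 1}. of_bool (orb l y \<in> E c0 \<and> Bd 0 n y))"
        using AE_orb_add AE_space
      proof eventually_elim
        case (elim y)
        let ?x = "name b y"
        have sp: "orb l y \<in> space M" for l using measurable_space[OF measurable_orb elim(2)] .
        have inK: "orb l y \<in> K \<longleftrightarrow> ?x l \<noteq> 1" for l using sp by (simp add: K_def name_def)
        have main: "\<epsilon> * (\<Sum>l\<in>{0..<n + 1}. of_bool (orb l y \<in> K \<and> Bd 0 n y)) \<le> (\<Sum>l\<in>{0..<n + 1}. of_bool (orb l y \<in> E c0 \<and> Bd 0 n y))"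
          for n
        proof (cases "Bd 0 n y")
          case True
          have "\<epsilon> * sum (visit ?x) {0..<n + 1} \<le> (\<Sum>i\<in>{0..<n + 1}. of_bool (?x i \<noteq> 1 \<and> i \<in> {i. orb i y \<in> E c0}))"
          proof (rule many_exceedances)
            show "f (orb i y) \<le> visit ?x i" for i
              using gK[OF sp[of i]] inK[of i] \<epsilon> by (auto simp: f_def visit_def indicator_def split: if_splits)
            show "(\<Sum>j\<in>{i..<n + 1}. f (orb j y)) \<le> c" if "i \<in> {0..<n + 1}" "?x i \<noteq> 1" "i \<notin> {i. orb i y \<in> E c0}" for i
            proof -
              have "(\<Sum>j\<in>{i..<n + 1}. f (orb j y)) = (\<Sum>j\<in>{0..<n + 1 - i}. f (orb (i + j) y))"
                using sum_int_shift[of "\<lambda>j. f (orb j y)" i 0 "n + 1 - i"] by simp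
              also have "\<dots> = (\<Sum>k<nat (n + 1 - i). f (orb (i + int k) y))"
                using sum_nat_int[of "\<lambda>j. f (orb (i + j) y)" "nat (n + 1 - i)"] that by simp
              also have "\<dots> = (\<Sum>k<nat (n + 1 - i). f (orb (int k) (orb i y)))" using elim(1) by (simp add: add.commute)
              also have "\<dots> \<le> c0" using that inK sp by (auto simp: E_def not_less)
              finally show ?thesis using c by simp
            qed
            have "(\<Sum>j\<in>{0..<n + 1}. f (orb j y)) = (\<Sum>j\<in>{0..<n + 1}. g (orb j y)) - \<epsilon> * sum (visit ?x) {0..<n + 1}"
              unfolding f_def using inK by (simp add: sum_subtractf sum_distrib_left visit_def indicator_def of_bool_def)
            then show "\<epsilon> * sum (visit ?x) {0..<n + 1} + c < (\<Sum>j\<in>{0..<n + 1}. f (orb j y))"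
              using True by (simp add: Bd_def)
          qed (rule \<epsilon>)
          also have "\<dots> = (\<Sum>l\<in>{0..<n + 1}. of_bool (orb l y \<in> E c0 \<and> Bd 0 n y))"
            using True inK by (intro sum.cong) (auto simp: E_def)
          finally show ?thesis using True by (simp add: inK visit_def[abs_def])
        qed simp
        have "\<epsilon> * (\<Sum>n\<in>{0..<int h}. \<Sum>l\<in>{0..<n + 1}. of_bool (orb l y \<in> K \<and> Bd 0 n y))
          \<le> (\<Sum>n\<in>{0..<int h}. \<Sum>l\<in>{0..<n + 1}. of_bool (orb l y \<in> E c0 \<and> Bd 0 n y))"
          unfolding sum_distrib_left[of \<epsilon> _ "{0..<int h}"] by (intro sum_mono main)
        then show ?case using \<epsilon> by (subst ennreal_mult[symmetric]) (auto intro!: sum_nonneg ennreal_leI)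
      qed
    qed
    also have "\<dots> = emeasure M (G (E c0))" by (rule eq[symmetric]) (rule Em)
    also have "\<dots> \<le> emeasure M (E c0)" by (rule emeasure_mono) (auto simp: G_def)
    also have "\<dots> \<le> ennreal (\<epsilon> * \<delta>)" using c0 by simp
    also have "\<dots> = ennreal \<epsilon> * ennreal \<delta>" using \<epsilon> \<delta> by (intro ennreal_mult) auto
    finally have "ennreal \<epsilon> * emeasure M (G K) \<le> ennreal \<epsilon> * ennreal \<delta>" .
    then have "emeasure M (G K) \<le> ennreal \<delta>" using \<epsilon> by (subst (asm) ennreal_mult_le_mult_iff) auto
    then show "emeasure M {y\<in>space M. y \<in> K \<and> (\<exists>s e. (block R (name b y) s e \<and>
    (\<Sum>i\<in>{s..<e + 1}. g (orb i y)) > 2 * \<epsilon> * sum (visit (name b y)) {s..<e + 1} + c) \<and> s \<le> 0 \<and> 0 \<le> e)} \<le> ennreal \<delta>"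
      by (simp only: G_def Bd_def)
  qed
qed

end

section \<open>One stage of the refinement\<close>

text \<open>Recoding commutes with the shift if the fillings do. For fillings that depend on the
  word only, this is \<open>factor_shift\<close>.\<close>

lemma recode_shift:
  assumes "\<And>s e. \<phi> s e = \<phi>' (i + s) (i + e)"
  shows "recode R \<phi> (shift i x) j = recode R \<phi>' x (i + j)"
proof (cases "\<exists>s e. block R (shift i x) s e \<and> s \<le> j \<and> j \<le> e")
  case True
  then obtain s e where se: "block R (shift i x) s e" "s \<le> j" "j \<le> e" by blast
  then have "block R x (i + s) (i + e)" by (simp add: block_shift)
  then have "recode R \<phi>' x (i + j) = \<phi>' (i + s) (i + e) ! nat (i + j - (i + s))"
    using se by (intro recode_in_block) auto
  then show ?thesis using recode_in_block[OF se] assms by simp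
next
  case False
  have "\<nexists>s e. block R x s e \<and> s \<le> i + j \<and> i + j \<le> e"
  proof
    assume "\<exists>s e. block R x s e \<and> s \<le> i + j \<and> i + j \<le> e"
    then obtain s e where "block R x s e" "s \<le> i + j" "i + j \<le> e" by blast
    then have "block R (shift i x) (s - i) (e - i) \<and> s - i \<le> j \<and> j \<le> e - i" by (simp add: block_shift)
    then show False using False by blast
  qed
  then have "recode R \<phi>' x (i + j) = x (i + j)" unfolding recode_def by (rule if_not_P)
  moreover have "recode R \<phi> (shift i x) j = shift i x j" using False unfolding recode_def by (rule if_not_P)
  ultimately show ?thesis by (simp add: shift_def)
qed

lemma visits_map:
  assumes "\<And>l. \<pi> l = 1 \<longleftrightarrow> l = (1::nat)"
  shows "visits (map \<pi> V) = visits V"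
proof -
  have "extend (map \<pi> V) i = 1 \<longleftrightarrow> extend V i = 1" for i   proof (cases "0 \<le> i \<and> i < int (length V)")
    case True
    then have "nat i < length V" by linarith
    then show ?thesis using True by (simp add: extend_def assms del: One_nat_def)
  next
    case False
    then show ?thesis unfolding extend_def length_map by (simp only: if_not_P if_False)
  qed
  then show ?thesis by (simp add: visits_def visit_def del: One_nat_def)
qed

lemma occurs_unique: "occurs R x v i \<Longrightarrow> occurs R x v' i \<Longrightarrow> v = v'"
proof -
  assume a: "occurs R x v i" "occurs R x v' i"
  then have "block R x i (i + int (length v) - 1)" "block R x i (i + int (length v') - 1)" by (auto simp: occurs_def)
  from block_unique(2)[OF this, of i] this have "length v = length v'" by (auto simp: block_def)
  then show ?thesis using a by (auto simp: occurs_def)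
qed

context uniform_base begin

lemma measurable_block_excess:
  assumes [measurable]: "g \<in> borel_measurable M"
  shows "Measurable.pred M (\<lambda>y. \<exists>s e. (block R (name b y) s e \<and>
    (\<Sum>i\<in>{s..<e + 1}. g (orb i y)) > \<epsilon> * sum (visit (name b y)) {s..<e + 1} + (c::real)) \<and> s \<le> 0 \<and> 0 \<le> e)"
proof -
  have [measurable]: "Measurable.pred M (\<lambda>y. \<epsilon> * sum (visit (name b y)) {s..<e + 1} + c < (\<Sum>i\<in>{s..<e + 1}. g (orb i y)))" for s e
    unfolding pred_def by (rule borel_measurable_less) simp_all
  show ?thesis by measurable
qed

end

text \<open>\<pi> sends a label to the \<beta>-label below it. By \<open>\<pi>_bounded\<close> the
  alphabet above \<beta> is finite, so blocks of bounded length carry only finitely many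
  words.\<close>

locale refining_labels = uniform_base +
  fixes \<pi> :: "nat \<Rightarrow> nat" and k :: nat
  assumes \<pi>_1: "\<And>l. \<pi> l = 1 \<longleftrightarrow> l = 1"
    and \<pi>_bounded: "\<And>y l. y \<in> space M \<Longrightarrow> \<pi> l = b y \<Longrightarrow> l \<le> k"
begin

text \<open>All stages stay in this class. The relation to \<open>b\<close> is required at every
  point, so all labellings share their visits and blocks without exceptional sets.\<close>

definition labelling :: "('a \<Rightarrow> nat) \<Rightarrow> bool" where
  "labelling a \<longleftrightarrow> a \<in> measurable M (count_space UNIV) \<and> (\<forall>y\<in>space M. \<pi> (a y) = b y)"

lemma name_\<pi>:
  assumes "labelling a" "y \<in> space M"
  shows "\<pi> (name a y i) = name b y i" "name a y i = 1 \<longleftrightarrow> name b y i = 1" "name a y i \<le> k"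
proof -
  have sp: "orb i y \<in> space M" using measurable_space[OF measurable_orb assms(2)] .
  show *: "\<pi> (name a y i) = name b y i" using assms sp by (simp add: labelling_def name_def)
  then show "name a y i = 1 \<longleftrightarrow> name b y i = 1" using \<pi>_1[of "name a y i"] by simp
  show "name a y i \<le> k" using \<pi>_bounded[OF sp] * by (simp add: name_def)
qed

lemma block_name:
  assumes "labelling a" "y \<in> space M"
  shows "block R (name a y) s e \<longleftrightarrow> block R (name b y) s e"
  by (rule block_cong_support) (rule name_\<pi>[OF assms])

lemma visit_name:
  assumes "labelling a" "y \<in> space M"
  shows "visit (name a y) = visit (name b y)"
  using name_\<pi>(2)[OF assms] by (simp add: visit_def fun_eq_iff)

lemma map_factor_name:
  assumes "labelling a" "y \<in> space M"
  shows "map \<pi> (factor (name a y) s e) = factor (name b y) s e"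
  using name_\<pi>(1)[OF assms] by (simp add: map_factor)

lemma occurs_shift_0: "occurs R (shift i x) v 0 \<longleftrightarrow> occurs R x v i"
  by (simp add: occurs_shift)

lemma freq_nonneg: "freq P a \<ge> 0"
  using K_measure by (simp add: freq_def)

text \<open>The starts of the block \<open>w\<close> split according to the labelled word above it.
  So the frequencies of labelled words are weights compatible with \<beta>, as
  \<open>refill_exists\<close> requires.\<close>

lemma freq_occurs_base:
  assumes a: "labelling a" and L: "finite L" "AE y in M. \<forall>v i. occurs R (name a y) v i \<longrightarrow> v \<in> L"
  shows "freq (\<lambda>x. occurs R x w 0) b = (\<Sum>v\<in>{v\<in>L. map \<pi> v = w}. freq (\<lambda>x. occurs R x v 0) a)"
proof -
  have am [measurable]: "a \<in> measurable M (count_space UNIV)" using a by (simp add: labelling_def)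
  define Oc where "Oc = (\<lambda>v. {y\<in>space M. occurs R (name a y) v 0})"
  have Om [measurable]: "Oc v \<in> sets M" for v unfolding Oc_def by measurable
  have OK: "emeasure M (Oc v) \<noteq> \<infinity>" for v
  proof -
    have "y \<in> K" if "y \<in> Oc v" for y
      using that block_name[OF a, of y R 0 "int (length v) - 1"] by (auto simp: Oc_def occurs_def block_def K_def name_def)
    then have "emeasure M (Oc v) \<le> emeasure M K" by (intro emeasure_mono) auto
    then show ?thesis using K_measure by (auto simp: top_unique)
  qed
  have "measure M {y\<in>space M. occurs R (name b y) w 0} = measure M (\<Union>v\<in>{v\<in>L. map \<pi> v = w}. Oc v)"
  proof (rule measure_eq_AE)
    show "AE y in M. y \<in> {y\<in>space M. occurs R (name b y) w 0} \<longleftrightarrow> y \<in> (\<Union>v\<in>{v\<in>L. map \<pi> v = w}. Oc v)"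
      using L(2)
    proof eventually_elim
      case (elim y)
      show ?case
      proof
        assume y: "y \<in> {y\<in>space M. occurs R (name b y) w 0}"
        define v where "v = factor (name a y) 0 (int (length w) - 1)"
        have "block R (name a y) 0 (int (length w) - 1)" using y block_name[OF a] by (auto simp: occurs_def)
        then have "occurs R (name a y) v 0" unfolding v_def by (rule occurs_block)
        moreover have "map \<pi> v = w" using y map_factor_name[OF a] by (auto simp: v_def occurs_def)
        ultimately show "y \<in> (\<Union>v\<in>{v\<in>L. map \<pi> v = w}. Oc v)" using y elim by (auto simp: Oc_def)
      next
        assume "y \<in> (\<Union>v\<in>{v\<in>L. map \<pi> v = w}. Oc v)"
        then obtain v where v: "map \<pi> v = w" "y \<in> space M" "occurs R (name a y) v 0" by (auto simp: Oc_def)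
        then have "length w = length v" by auto
        then show "y \<in> {y\<in>space M. occurs R (name b y) w 0}"
          using v block_name[OF a v(2)] map_factor_name[OF a v(2), of 0 "int (length v) - 1"] by (auto simp: occurs_def)
      qed
    qed
    show "(\<Union>v\<in>{v\<in>L. map \<pi> v = w}. Oc v) \<in> sets M" using L(1) by (intro sets.finite_UN) auto
  qed measurable
  also have "\<dots> = (\<Sum>v\<in>{v\<in>L. map \<pi> v = w}. measure M (Oc v))"
  proof (rule measure_finite_Union)
    show "disjoint_family_on Oc {v \<in> L. map \<pi> v = w}"
      by (auto simp: disjoint_family_on_def Oc_def dest: occurs_unique)
  qed (use L OK in auto)
  finally show ?thesis by (simp add: freq_def Oc_def sum_divide_distrib)
qed

text \<open>There are countably many words, so those of frequency zero can be excluded along whole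
  orbits. This supplies the positive weights required for refilling.\<close>

lemma AE_occurs_freq_pos: "AE y in M. \<forall>w i. occurs R (name b y) w i \<longrightarrow> freq (\<lambda>x. occurs R x w 0) b > 0"
proof -
  have "AE y in M. \<forall>i. occurs R (name b y) w i \<longrightarrow> freq (\<lambda>x. occurs R x w 0) b > 0" for w
  proof (cases "freq (\<lambda>x. occurs R x w 0) b > 0")
    case False
    then have 0: "measure M {y\<in>space M. occurs R (name b y) w 0} = 0"
      using K_measure(2) by (simp add: freq_def zero_less_divide_iff zero_less_measure_iff)
    have "y \<in> K" if "y \<in> space M" "occurs R (name b y) w 0" for y
      using that by (auto simp: occurs_def block_def K_def name_def)
    then have "emeasure M {y\<in>space M. occurs R (name b y) w 0} \<le> emeasure M K" by (intro emeasure_mono) auto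
    then have "emeasure M {y\<in>space M. occurs R (name b y) w 0} \<noteq> \<infinity>" using K_measure by (auto simp: top_unique)
    then have "emeasure M {y\<in>space M. occurs R (name b y) w 0} = 0" using 0 by (simp add: emeasure_eq_ennreal_measure)
    then have "AE y in M. \<not> occurs R (name b y) w 0" by (subst AE_iff_measurable[OF _ refl]) simp_all
    then have "AE y in M. \<forall>i. \<not> occurs R (name b (orb i y)) w 0" by (rule AE_orb)
    then show ?thesis using AE_name_orb[of b]
      by eventually_elim (simp add: occurs_shift_0)
  qed simp
  then show ?thesis by (simp add: AE_all_countable)
qed

lemma uniform_occurs:
  assumes "\<epsilon> > 0" "finite Ws"
  shows "\<exists>c\<ge>0. AE y in M. \<forall>w\<in>Ws. near_freq (\<lambda>i. occurs R (name b y) w i) (freq (\<lambda>x. occurs R x w 0) b) \<epsilon> c (name b y)"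
proof -
  have "\<forall>w. \<exists>c\<ge>0. AE y in M. near_freq (\<lambda>i. occurs R (name b y) w i) (freq (\<lambda>x. occurs R x w 0) b) \<epsilon> c (name b y)"
  proof
    fix w
    have K0: "x 0 \<noteq> 1" if "occurs R x w 0" for x using that by (simp add: occurs_def block_def)
    show "\<exists>c\<ge>0. AE y in M. near_freq (\<lambda>i. occurs R (name b y) w i) (freq (\<lambda>x. occurs R x w 0) b) \<epsilon> c (name b y)"
      unfolding freq_def K_def
      by (rule uniform[of "R + length w" "\<lambda>x. occurs R x w 0" \<epsilon>, unfolded occurs_shift_0])
        (rule window_determined_occurs, erule K0, rule assms(1))
  qed
  then obtain c where c: "\<And>w. c w \<ge> 0" "\<And>w. AE y in M. near_freq (\<lambda>i. occurs R (name b y) w i) (freq (\<lambda>x. occurs R x w 0) b) \<epsilon> (c w) (name b y)"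
    using choice[of "\<lambda>w c. c \<ge> 0 \<and> (AE y in M. near_freq (\<lambda>i. occurs R (name b y) w i) (freq (\<lambda>x. occurs R x w 0) b) \<epsilon> c (name b y))"] by blast
  have "AE y in M. \<forall>w\<in>Ws. near_freq (\<lambda>i. occurs R (name b y) w i) (freq (\<lambda>x. occurs R x w 0) b) \<epsilon> (c w) (name b y)"
    using c(2) assms(2) by (intro AE_finite_allI) auto
  then have "AE y in M. \<forall>w\<in>Ws. near_freq (\<lambda>i. occurs R (name b y) w i) (freq (\<lambda>x. occurs R x w 0) b) \<epsilon> (sum c Ws) (name b y)"
  proof eventually_elim
    case (elim y)
    have "c w \<le> sum c Ws" if "w \<in> Ws" for w using that assms(2) c(1) by (intro member_le_sum) auto
    then show ?case using elim by (meson add_left_mono order_trans)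
  qed
  then show ?thesis using c(1) by (intro exI[of _ "sum c Ws"]) (simp add: sum_nonneg)
qed

text \<open>The mean zero function to which \<open>bad_blocks_small\<close> is applied: its sum over
  a block is the number of occurrences minus the expected number.\<close>

definition deviation :: "nat \<Rightarrow> ('a \<Rightarrow> nat) \<Rightarrow> nat list \<Rightarrow> 'a \<Rightarrow> real" where
  "deviation R a v y = of_bool (occurs R (name a y) v 0) - freq (\<lambda>x. occurs R x v 0) a * indicator K y"

lemma deviation:
  assumes a: "labelling a"
  shows "deviation R a v \<in> borel_measurable M"
    and "y \<in> space M \<Longrightarrow> \<bar>deviation R a v y\<bar> \<le> indicator K y"
    and "(\<integral>y. deviation R a v y \<partial>M) = 0"
proof -
  have am [measurable]: "a \<in> measurable M (count_space UNIV)" using a by (simp add: labelling_def)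
  define Oc where "Oc = {y\<in>space M. occurs R (name a y) v 0}"
  have Om [measurable]: "Oc \<in> sets M" unfolding Oc_def by measurable
  show "deviation R a v \<in> borel_measurable M" unfolding deviation_def by measurable
  have OK: "Oc \<subseteq> K"
    using block_name[OF a, of _ R 0 "int (length v) - 1"] by (auto simp: Oc_def occurs_def block_def K_def name_def)
  then have "emeasure M Oc \<le> emeasure M K" by (intro emeasure_mono) auto
  then have fin: "emeasure M Oc < \<infinity>" using K_measure by (auto simp: less_top[symmetric] top_unique)
  have "measure M Oc \<le> measure M K"
    using OK K_measure by (intro measure_mono_fmeasurable) (auto simp: fmeasurable_def)
  then have f1: "freq (\<lambda>x. occurs R x v 0) a \<le> 1" using K_measure by (simp add: freq_def Oc_def)
  have ind: "of_bool (occurs R (name a y) v 0) = (indicator Oc y :: real)" if "y \<in> space M" for y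
    using that by (simp add: Oc_def indicator_def)
  show "\<bar>deviation R a v y\<bar> \<le> indicator K y" if "y \<in> space M"
    using ind[OF that] OK f1 freq_nonneg[of "\<lambda>x. occurs R x v 0" a] unfolding deviation_def by (auto simp: indicator_def)
  have "(\<integral>y. deviation R a v y \<partial>M) = (\<integral>y. indicator Oc y - freq (\<lambda>x. occurs R x v 0) a * indicator K y \<partial>M)"
    unfolding deviation_def by (rule Bochner_Integration.integral_cong) (simp_all add: ind)
  also have "\<dots> = measure M Oc - freq (\<lambda>x. occurs R x v 0) a * measure M K"
    using fin K_measure by (subst Bochner_Integration.integral_diff) (auto intro!: integrable_real_indicator)
  also have "\<dots> = 0" using K_measure by (simp add: freq_def Oc_def)
  finally show "(\<integral>y. deviation R a v y \<partial>M) = 0" .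
qed

lemma sum_deviation:
  assumes "labelling a"
  shows "AE y in M. \<forall>v s e. (\<Sum>i\<in>{s..<e}. deviation R a v (orb i y)) =
    (\<Sum>i\<in>{s..<e}. of_bool (occurs R (name a y) v i)) - freq (\<lambda>x. occurs R x v 0) a * sum (visit (name b y)) {s..<e}"
  using AE_name_orb[of a] AE_space
proof eventually_elim
  case (elim y)
  have "orb i y \<in> K \<longleftrightarrow> name b y i \<noteq> 1" for i
    using measurable_space[OF measurable_orb elim(2)] by (simp add: K_def name_def)
  then have "deviation R a v (orb i y) = of_bool (occurs R (name a y) v i) - freq (\<lambda>x. occurs R x v 0) a * visit (name b y) i" for v i
    using elim(1) by (simp add: deviation_def occurs_shift_0 visit_def indicator_def of_bool_def)
  then show ?case by (simp add: sum_subtractf sum_distrib_left)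
qed

end

text \<open>A property of the finite word alone, hence kept whenever a later stage uses the word as
  a whole. \<open>p\<close> will be the block frequencies of the labelling before the stage.\<close>

definition good_word :: "nat \<Rightarrow> nat list set \<Rightarrow> (nat list \<Rightarrow> real) \<Rightarrow> real \<Rightarrow> real \<Rightarrow> nat list \<Rightarrow> bool" where
  "good_word R L p \<epsilon> c V \<longleftrightarrow> (\<forall>v i. occurs R (extend V) v i \<longrightarrow> v \<in> L) \<and>
     (\<forall>v\<in>L. \<bar>occ_count R V v - p v * visits V\<bar> \<le> \<epsilon> * visits V + c)"

lemma visits_nonneg: "visits V \<ge> 0"
  unfolding visits_def by (intro sum_nonneg) simp

context refining_labels begin

text \<open>The \<beta>-word of every longer block lifts to a good word, even where the present
  labels are bad, because its block counts are controlled by \<beta>. The constant does not depend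
  on \<open>R'\<close>, which is chosen later.\<close>

lemma AE_good_fill_exists:
  assumes a: "labelling a" and L: "finite L" "AE y in M. \<forall>v i. occurs R (name a y) v i \<longrightarrow> v \<in> L"
    and \<epsilon>: "\<epsilon> > 0"
  shows "\<exists>c0\<ge>0. \<forall>c\<ge>c0. \<forall>R'\<ge>R. AE y in M. \<forall>s e. block R' (name b y) s e \<longrightarrow>
    (\<exists>V. map \<pi> V = factor (name b y) s e \<and> good_word R L (\<lambda>v. freq (\<lambda>x. occurs R x v 0) a) \<epsilon> c V)"
proof -
  let ?p = "\<lambda>v. freq (\<lambda>x. occurs R x v 0) a"
  obtain c1 where c1: "c1 \<ge> 0" "AE y in M. \<forall>w\<in>map \<pi> ` L. near_freq (\<lambda>i. occurs R (name b y) w i) (freq (\<lambda>x. occurs R x w 0) b) \<epsilon> c1 (name b y)"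
    using uniform_occurs[OF \<epsilon>, of "map \<pi> ` L" R] L(1) by auto
  have base: "freq (\<lambda>x. occurs R x w 0) b = (\<Sum>v\<in>{v\<in>L. map \<pi> v = w}. ?p v)" for w
    by (rule freq_occurs_base[OF a L])
  show ?thesis
  \<comment> \<open>\<open>c1\<close> is the deviation of the \<beta>-blocks, \<open>card L\<close>
    the error of distributing them among their lifts.\<close>
  proof (intro exI[of _ "c1 + card L"] conjI allI impI)
    fix c and R' assume c: "c1 + card L \<le> c" and R': "R \<le> R'"
    show "AE y in M. \<forall>s e. block R' (name b y) s e \<longrightarrow>
      (\<exists>V. map \<pi> V = factor (name b y) s e \<and> good_word R L ?p \<epsilon> c V)"
      using c1(2) AE_occurs_freq_pos[of R]
    proof eventually_elim
      case (elim y)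
      show ?case
      proof (intro allI impI)
        fix s e assume bl: "block R' (name b y) s e"
        then have se: "s \<le> e" by (simp add: block_def)
        define W where "W = factor (name b y) s e"
        have "\<exists>V. map \<pi> V = W \<and> (\<forall>v i. occurs R (extend V) v i \<longrightarrow> v \<in> L) \<and>
           (\<forall>v\<in>L. \<bar>occ_count R V v - ?p v * visits W\<bar> \<le> (\<epsilon> * visits W + c1) + card L)"
        proof (rule refill_exists)
          show "finite L" by (rule L(1))
          show "\<pi> l = 1 \<longleftrightarrow> l = 1" for l by (rule \<pi>_1)
          show "?p v \<ge> 0" for v by (rule freq_nonneg)
          show "0 < (\<Sum>v\<in>{v\<in>L. map \<pi> v = w}. ?p v)" if "occurs R (extend W) w i" for w i
          proof -
            have "s \<le> s + i" "s + i \<le> e"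
              using occurs_extend_range[of R W w] that se by (auto simp: W_def)
            then have "occurs R (name b y) w (s + i)"
              using that occurs_in_block[OF bl R'] by (simp add: W_def)
            then show ?thesis using elim(2) base by metis
          qed
          show "\<bar>occ_count R W w - (\<Sum>v\<in>{v\<in>L. map \<pi> v = w}. ?p v) * visits W\<bar> \<le> \<epsilon> * visits W + c1"
            if "w \<in> map \<pi> ` L" for w
            unfolding W_def occ_count_block[OF bl R'] visits_block[OF bl] base[symmetric]
            using elim(1)[rule_format, OF that, of s "e + 1"] se by simp
        qed
        then obtain V where V: "map \<pi> V = W" "\<forall>v i. occurs R (extend V) v i \<longrightarrow> v \<in> L"
          "\<forall>v\<in>L. \<bar>occ_count R V v - ?p v * visits W\<bar> \<le> (\<epsilon> * visits W + c1) + card L" by blast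
        have vis: "visits W = visits V" using visits_map[OF \<pi>_1, of V] V(1) by simp
        have "\<bar>occ_count R V v - ?p v * visits V\<bar> \<le> \<epsilon> * visits V + c" if "v \<in> L" for v
          using bspec[OF V(3) that] c unfolding vis by linarith
        then have "good_word R L ?p \<epsilon> c V" using V(2) unfolding good_word_def by blast
        then show "\<exists>V. map \<pi> V = factor (name b y) s e \<and> good_word R L ?p \<epsilon> c V"
          using V(1) by (auto simp: W_def)
      qed
    qed
  qed (use c1 in auto)
qed

text \<open>Since \<open>bad_blocks_small\<close> is one-sided, it is applied to the deviation of
  each word of \<open>L\<close> and to its negative; the exceptional set is the union of these
  finitely many cases. Again the constant does not depend on \<open>R'\<close>.\<close>

lemma bad_words_small:
  assumes a: "labelling a" and L: "finite L" and \<epsilon>: "0 < \<epsilon>" "\<epsilon> \<le> 1" and \<delta>: "\<delta> > 0"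
  shows "\<exists>c0\<ge>0. \<forall>c\<ge>c0. \<forall>R'\<ge>R. \<exists>B\<in>sets M. emeasure M B \<le> ennreal \<delta> \<and>
    (AE y in M. y \<in> K \<longrightarrow> y \<notin> B \<longrightarrow> (\<forall>s e. block R' (name b y) s e \<longrightarrow> s \<le> 0 \<longrightarrow> 0 \<le> e \<longrightarrow>
      (\<forall>v\<in>L. \<bar>occ_count R (factor (name a y) s e) v - freq (\<lambda>x. occurs R x v 0) a * visits (factor (name a y) s e)\<bar>
        \<le> \<epsilon> * visits (factor (name a y) s e) + c)))"
proof -
  let ?p = "\<lambda>v. freq (\<lambda>x. occurs R x v 0) a"
  define g where "g = (\<lambda>(v, \<sigma>) y. \<sigma> * deviation R a v y)"
  define I where "I = L \<times> {1, - 1 :: real}"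
  \<comment> \<open>Adding 1 keeps the bound positive when \<open>L\<close> is empty.\<close>
  define \<delta>' where "\<delta>' = \<delta> / (card I + 1)"
  have finI: "finite I" using L by (simp add: I_def)
  have \<delta>': "\<delta>' > 0" using \<delta> by (simp add: \<delta>'_def)
  define Bd where "Bd = (\<lambda>R' c t. {y\<in>space M. y \<in> K \<and> (\<exists>s e. (block R' (name b y) s e \<and>
    (\<Sum>i\<in>{s..<e + 1}. g t (orb i y)) > 2 * (\<epsilon> / 2) * sum (visit (name b y)) {s..<e + 1} + c) \<and> s \<le> 0 \<and> 0 \<le> e)})"
  have gm: "g t \<in> borel_measurable M" if "t \<in> I" for t
    using deviation(1)[OF a] by (cases t) (simp add: g_def)
  have "\<exists>c0::nat. \<forall>c\<ge>real c0. \<forall>R'. emeasure M (Bd R' c t) \<le> ennreal \<delta>'" if t: "t \<in> I" for t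
    unfolding Bd_def
  proof (rule bad_blocks_small)
    obtain v \<sigma> where vs: "t = (v, \<sigma>)" "\<bar>\<sigma>\<bar> = 1" using t by (auto simp: I_def)
    show "g t \<in> borel_measurable M" by (rule gm[OF t])
    show "\<bar>g t y\<bar> \<le> indicator K y" if "y \<in> space M" for y
      using deviation(2)[OF a that] vs by (simp add: g_def abs_mult)
    show "(\<integral>y. g t y \<partial>M) = 0" using deviation(3)[OF a] vs by (simp add: g_def)
  qed (use \<epsilon> \<delta>' in auto)
  then have "\<forall>t\<in>I. \<exists>c0::nat. \<forall>c\<ge>real c0. \<forall>R'. emeasure M (Bd R' c t) \<le> ennreal \<delta>'" by blast
  from bchoice[OF this] obtain C :: "nat list \<times> real \<Rightarrow> nat" where
    C: "\<And>t c R'. t \<in> I \<Longrightarrow> c \<ge> real (C t) \<Longrightarrow> emeasure M (Bd R' c t) \<le> ennreal \<delta>'" by blast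
  show ?thesis
  proof (intro exI[of _ "real (sum C I)"] conjI allI impI)
    fix c R' assume c: "real (sum C I) \<le> c" and R': "R \<le> R'"
    have Bm: "Bd R' c t \<in> sets M" if "t \<in> I" for t
    proof -
      note gm[OF that, measurable]
      note measurable_block_excess[OF gm[OF that], of R' "2 * (\<epsilon> / 2)" c, measurable]
      show ?thesis unfolding Bd_def by measurable
    qed
    define B where "B = (\<Union>t\<in>I. Bd R' c t)"
    have "emeasure M B \<le> (\<Sum>t\<in>I. emeasure M (Bd R' c t))"
      unfolding B_def using finI Bm by (intro emeasure_subadditive_finite) auto
    also have "\<dots> \<le> (\<Sum>t\<in>I. ennreal \<delta>')"
    proof (rule sum_mono)
      fix t assume t: "t \<in> I"
      have "C t \<le> sum C I" using t finI by (intro member_le_sum) auto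
      then have "real (C t) \<le> c" using c by linarith
      then show "emeasure M (Bd R' c t) \<le> ennreal \<delta>'" by (rule C[OF t])
    qed
    also have "\<dots> = ennreal (card I * \<delta>')" using \<delta>' by (simp add: ennreal_mult ennreal_of_nat_eq_real_of_nat)
    also have "\<dots> \<le> ennreal \<delta>" using \<delta> by (intro ennreal_leI) (simp add: \<delta>'_def field_simps)
    finally have eB: "emeasure M B \<le> ennreal \<delta>" .
    have "AE y in M. y \<in> K \<longrightarrow> y \<notin> B \<longrightarrow> (\<forall>s e. block R' (name b y) s e \<longrightarrow> s \<le> 0 \<longrightarrow> 0 \<le> e \<longrightarrow>
      (\<forall>v\<in>L. \<bar>occ_count R (factor (name a y) s e) v - ?p v * visits (factor (name a y) s e)\<bar>
        \<le> \<epsilon> * visits (factor (name a y) s e) + c))"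
      using sum_deviation[OF a, of R] AE_space
    proof eventually_elim
      case (elim y)
      show ?case
      proof (intro impI allI ballI)
        fix s e v assume y: "y \<in> K" "y \<notin> B" and bl: "block R' (name b y) s e" and se: "s \<le> 0" "0 \<le> e" and v: "v \<in> L"
        have bl': "block R' (name a y) s e" using bl block_name[OF a elim(2)] by simp
        have le: "(\<Sum>i\<in>{s..<e + 1}. g (v, \<sigma>) (orb i y)) \<le> \<epsilon> * sum (visit (name b y)) {s..<e + 1} + c" if "\<sigma> \<in> {1, -1}" for \<sigma>
        proof (rule ccontr)
          assume "\<not> ?thesis"
          then have "(block R' (name b y) s e \<and> (\<Sum>i\<in>{s..<e + 1}. g (v, \<sigma>) (orb i y)) >
              2 * (\<epsilon> / 2) * sum (visit (name b y)) {s..<e + 1} + c) \<and> s \<le> 0 \<and> 0 \<le> e"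
            using bl se by simp
          then have "y \<in> Bd R' c (v, \<sigma>)" unfolding Bd_def using y(1) elim(2) by blast
          then show False using y v that by (auto simp: B_def I_def)
        qed
        have "(\<Sum>i\<in>{s..<e + 1}. deviation R a v (orb i y)) = occ_count R (factor (name a y) s e) v - ?p v * visits (factor (name a y) s e)"
          using elim(1) by (simp add: occ_count_block[OF bl' R'] visits_block[OF bl'] visit_name[OF a elim(2)])
        moreover have "visits (factor (name a y) s e) = sum (visit (name b y)) {s..<e + 1}"
          by (simp add: visits_block[OF bl'] visit_name[OF a elim(2)])
        ultimately show "\<bar>occ_count R (factor (name a y) s e) v - ?p v * visits (factor (name a y) s e)\<bar>
            \<le> \<epsilon> * visits (factor (name a y) s e) + c"
          using le[of 1] le[of "-1"] by (simp add: g_def sum_negf abs_le_iff)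
      qed
    qed
    then show "\<exists>B\<in>sets M. emeasure M B \<le> ennreal \<delta> \<and>
    (AE y in M. y \<in> K \<longrightarrow> y \<notin> B \<longrightarrow> (\<forall>s e. block R' (name b y) s e \<longrightarrow> s \<le> 0 \<longrightarrow> 0 \<le> e \<longrightarrow>
      (\<forall>v\<in>L. \<bar>occ_count R (factor (name a y) s e) v - ?p v * visits (factor (name a y) s e)\<bar>
        \<le> \<epsilon> * visits (factor (name a y) s e) + c)))"
      using eB Bm finI by (intro bexI[of _ B]) (auto simp: B_def intro!: sets.finite_UN)
  qed (simp add: sum_nonneg)
qed

text \<open>The new label is described by countably many pairs of block ends, each entering through
  a function of the finite word between them; so \<Psi> may be arbitrary.\<close>

lemma measurable_recode:
  assumes [measurable]: "a \<in> measurable M (count_space UNIV)"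
  shows "(\<lambda>y. recode R (\<lambda>s e. \<Psi> (factor (name a y) s e)) (name a y) 0) \<in> measurable M (count_space UNIV)"
proof (subst measurable_count_space_eq2_countable, intro conjI ballI)
  fix l :: nat
  let ?r = "\<lambda>y. recode R (\<lambda>s e. \<Psi> (factor (name a y) s e)) (name a y) 0"
  have r: "?r y = l \<longleftrightarrow> (\<exists>s e. (block R (name a y) s e \<and> s \<le> 0 \<and> 0 \<le> e) \<and> \<Psi> (factor (name a y) s e) ! nat (- s) = l) \<or>
     (\<nexists>s e. block R (name a y) s e \<and> s \<le> 0 \<and> 0 \<le> e) \<and> name a y 0 = l" for y
  proof (cases "\<exists>s e. block R (name a y) s e \<and> s \<le> 0 \<and> 0 \<le> e")
    case True
    then obtain s e where se: "block R (name a y) s e" "s \<le> 0" "0 \<le> e" by blast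
    have "?r y = \<Psi> (factor (name a y) s e) ! nat (- s)" using recode_in_block[OF se] by simp
    moreover have "(\<exists>s' e'. (block R (name a y) s' e' \<and> s' \<le> 0 \<and> 0 \<le> e') \<and> \<Psi> (factor (name a y) s' e') ! nat (- s') = l) \<longleftrightarrow>
      \<Psi> (factor (name a y) s e) ! nat (- s) = l" (is "?L \<longleftrightarrow> ?R")
    proof
      assume ?L
      then obtain s' e' where *: "block R (name a y) s' e'" "s' \<le> 0" "0 \<le> e'" "\<Psi> (factor (name a y) s' e') ! nat (- s') = l"
        by (elim exE conjE)
      from block_unique[OF *(1) se(1) *(2,3) se(2,3)] *(4) show ?R by simp
    next
      assume ?R then show ?L using se by (intro exI[of _ s] exI[of _ e] conjI)
    qed
    ultimately show ?thesis using True by simp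
  next
    case False
    then have "?r y = name a y 0" unfolding recode_def by (rule if_not_P)
    then show ?thesis using False by auto
  qed
  have [measurable]: "Measurable.pred M (\<lambda>y. \<Psi> (factor (name a y) s e) ! nat (- s) = l)" for s e
    by (rule measurable_compose[OF measurable_factor, where g = "\<lambda>v. \<Psi> v ! nat (- s) = l"]) simp_all
  have "Measurable.pred M (\<lambda>y. ?r y = l)" unfolding r by measurable
  then have "{y\<in>space M. ?r y = l} \<in> sets M" by (simp add: pred_def)
  also have "{y\<in>space M. ?r y = l} = ?r -` {l} \<inter> space M" by auto
  finally show "?r -` {l} \<inter> space M \<in> sets M" .
qed auto

text \<open>The order of choices matters: one constant \<open>c\<close> serves both the good
  fillings and the bad set, for all larger gap lengths. Only then is \<open>R'\<close> taken so
  large that a cost of \<open>c\<close> per block is negligible.\<close>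

lemma refinement_stage:
  assumes a: "labelling a" and L: "finite L" "AE y in M. \<forall>v i. occurs R (name a y) v i \<longrightarrow> v \<in> L"
    and \<epsilon>: "0 < \<epsilon>" "\<epsilon> \<le> 1" and \<delta>: "\<delta> > 0"
  shows "\<exists>a' R' L'. R < R' \<and> labelling a' \<and> finite L' \<and>
    (AE y in M. \<forall>v i. occurs R' (name a' y) v i \<longrightarrow> v \<in> L') \<and>
    emeasure M {y\<in>space M. a y \<noteq> a' y} \<le> ennreal \<delta> \<and>
    (\<exists>p c c'. c \<ge> 0 \<and> (\<forall>V\<in>L'. good_word R L p \<epsilon> c V) \<and>
      (AE y in M. \<forall>s e. s \<le> e \<longrightarrow>
        c * (\<Sum>i\<in>{s..<e}. of_bool (gap_end R' (name b y) i)) \<le> \<epsilon> * sum (visit (name b y)) {s..<e} + c'))"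
proof -
  have am [measurable]: "a \<in> measurable M (count_space UNIV)" using a by (simp add: labelling_def)
  define p where "p = (\<lambda>v. freq (\<lambda>x. occurs R x v 0) a)"
  obtain c1 where c1: "c1 \<ge> 0" "\<And>c R'. c \<ge> c1 \<Longrightarrow> R' \<ge> R \<Longrightarrow> AE y in M. \<forall>s e. block R' (name b y) s e \<longrightarrow>
    (\<exists>V. map \<pi> V = factor (name b y) s e \<and> good_word R L p \<epsilon> c V)"
    using AE_good_fill_exists[OF a L \<epsilon>(1)] unfolding p_def by blast
  obtain c2 where c2: "c2 \<ge> 0" "\<And>c R'. c \<ge> c2 \<Longrightarrow> R' \<ge> R \<Longrightarrow> \<exists>B\<in>sets M. emeasure M B \<le> ennreal \<delta> \<and>
    (AE y in M. y \<in> K \<longrightarrow> y \<notin> B \<longrightarrow> (\<forall>s e. block R' (name b y) s e \<longrightarrow> s \<le> 0 \<longrightarrow> 0 \<le> e \<longrightarrow>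
      (\<forall>v\<in>L. \<bar>occ_count R (factor (name a y) s e) v - p v * visits (factor (name a y) s e)\<bar>
        \<le> \<epsilon> * visits (factor (name a y) s e) + c)))"
    using bad_words_small[OF a L(1) \<epsilon> \<delta>, of R] unfolding p_def by blast
  define c where "c = max c1 c2"
  have c: "c \<ge> 0" "c \<ge> c1" "c \<ge> c2" using c1 by (auto simp: c_def)
  obtain R' c' where R': "R < R'" and c': "AE y in M. \<forall>s e. s \<le> e \<longrightarrow>
        c * (\<Sum>i\<in>{s..<e}. of_bool (gap_end R' (name b y) i)) \<le> \<epsilon> * sum (visit (name b y)) {s..<e} + c'"
    using gap_end_sparse[OF \<epsilon>(1) c(1), of R] by blast
  obtain h where h: "AE y in M. (\<forall>s e. block R' (name b y) s e \<longrightarrow> e - s < int h)"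
    using AE_blocks[of R'] by auto
  have fill: "AE y in M. \<forall>s e. block R' (name b y) s e \<longrightarrow>
    (\<exists>V. map \<pi> V = factor (name b y) s e \<and> good_word R L p \<epsilon> c V)"
    using c1(2)[OF c(2)] R' by simp
  obtain B where B: "B \<in> sets M" "emeasure M B \<le> ennreal \<delta>" and
    small: "AE y in M. y \<in> K \<longrightarrow> y \<notin> B \<longrightarrow> (\<forall>s e. block R' (name b y) s e \<longrightarrow> s \<le> 0 \<longrightarrow> 0 \<le> e \<longrightarrow>
      (\<forall>v\<in>L. \<bar>occ_count R (factor (name a y) s e) v - p v * visits (factor (name a y) s e)\<bar>
        \<le> \<epsilon> * visits (factor (name a y) s e) + c))"
    using c2(2)[OF c(3)] R' by (meson less_imp_le)
  \<comment> \<open>Good words are kept, so labels change only in bad blocks. As \<Psi> depends on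
    the word alone, the recoding is measurable and commutes with the dynamics.\<close>
  define \<Psi> where "\<Psi> = (\<lambda>U. if good_word R L p \<epsilon> c U then U else (SOME V. map \<pi> V = map \<pi> U \<and> good_word R L p \<epsilon> c V))"
  have \<Psi>: "map \<pi> (\<Psi> U) = map \<pi> U \<and> good_word R L p \<epsilon> c (\<Psi> U)" if "\<exists>V. map \<pi> V = map \<pi> U \<and> good_word R L p \<epsilon> c V" for U
    using someI_ex[OF that] by (simp add: \<Psi>_def)
  define r where "r = (\<lambda>y. recode R' (\<lambda>s e. \<Psi> (factor (name a y) s e)) (name a y) 0)"
  have rm [measurable]: "r \<in> measurable M (count_space UNIV)" unfolding r_def by (rule measurable_recode[OF am])
  \<comment> \<open>Good fillings exist only almost everywhere. Where the recoded label does not lie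
    over \<open>b\<close>, the old label is kept, so that \<open>a'\<close> is a labelling at every
    point.\<close>
  define a' where "a' = (\<lambda>y. if \<pi> (r y) = b y then r y else a y)"
  have "Measurable.pred M (\<lambda>y. \<pi> (r y) = b y)"
  proof -
    have [measurable]: "(\<lambda>y. \<pi> (r y)) \<in> measurable M (count_space UNIV)" by (rule measurable_compose[OF rm]) simp
    have "Measurable.pred M (\<lambda>y. \<exists>l. b y = l \<and> \<pi> (r y) = l)" by measurable
    then show ?thesis by simp
  qed
  note this [measurable]
  have a'm [measurable]: "a' \<in> measurable M (count_space UNIV)" unfolding a'_def by measurable
  have a': "labelling a'" using a by (simp add: labelling_def a'_def a'm[unfolded a'_def])
  have main: "AE y in M. (\<forall>i. name a' y i = recode R' (\<lambda>s e. \<Psi> (factor (name a y) s e)) (name a y) i) \<and>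
    (\<forall>s e. block R' (name b y) s e \<longrightarrow> factor (name a' y) s e = \<Psi> (factor (name a y) s e) \<and> good_word R L p \<epsilon> c (\<Psi> (factor (name a y) s e)))"
    using fill AE_name_orb[of a] AE_space
  proof eventually_elim
    case (elim y)
    let ?x = "name a y"
    let ?\<phi> = "\<lambda>s e. \<Psi> (factor ?x s e)"
    have \<phi>: "map \<pi> (?\<phi> s e) = map \<pi> (factor ?x s e)" "good_word R L p \<epsilon> c (?\<phi> s e)" if "block R' ?x s e" for s e
    proof -
      have "\<exists>V. map \<pi> V = map \<pi> (factor ?x s e) \<and> good_word R L p \<epsilon> c V"
        using elim(1) that block_name[OF a elim(3)] map_factor_name[OF a elim(3)] by simp
      from \<Psi>[OF this] show "map \<pi> (?\<phi> s e) = map \<pi> (factor ?x s e)" "good_word R L p \<epsilon> c (?\<phi> s e)" by simp_all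
    qed
    have \<pi>r: "\<pi> (recode R' ?\<phi> ?x i) = name b y i" for i
      using recode_map[of R' ?x \<pi> ?\<phi> \<pi> i, OF \<phi>(1)] name_\<pi>(1)[OF a elim(3)] by simp
    have r: "r (orb i y) = recode R' ?\<phi> ?x i" for i
    proof -
      have "r (orb i y) = recode R' (\<lambda>s e. \<Psi> (factor (shift i ?x) s e)) (shift i ?x) 0"
        using elim(2) by (simp add: r_def)
      also have "\<dots> = recode R' ?\<phi> ?x (i + 0)" by (rule recode_shift) (simp add: factor_shift)
      finally show ?thesis by simp
    qed
    have n: "name a' y i = recode R' ?\<phi> ?x i" for i
    proof -
      have "\<pi> (r (orb i y)) = b (orb i y)" using \<pi>r[of i] r[of i] by (simp add: name_def[of b y])
      then have "a' (orb i y) = r (orb i y)" by (simp add: a'_def)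
      moreover have "name a' y i = a' (orb i y)" by (simp add: name_def)
      ultimately show ?thesis using r[of i] by simp
    qed
    then have na': "name a' y = recode R' ?\<phi> ?x" by (rule ext)
    have f: "factor (name a' y) s e = ?\<phi> s e" if "block R' ?x s e" for s e
      unfolding na' using arg_cong[OF \<phi>(1)[OF that], of length] by (intro factor_recode that) simp
    show ?case using n f \<phi>(2) block_name[OF a elim(3)] by blast
  qed
  \<comment> \<open>Labels at most \<open>k\<close> and lengths at most \<open>h\<close> leave
    finitely many words; goodness is part of the definition because later stages refer to
    it.\<close>
  define L' where "L' = {V. set V \<subseteq> {..k} \<and> length V \<le> h \<and> good_word R L p \<epsilon> c V}"
  have "finite L'"
    by (rule finite_subset[OF _ finite_lists_length_le[of "{..k}" h]]) (auto simp: L'_def)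
  moreover have "AE y in M. \<forall>v i. occurs R' (name a' y) v i \<longrightarrow> v \<in> L'"
    using main h AE_space
  proof eventually_elim
    case (elim y)
    show ?case
    proof (intro allI impI)
      fix v i assume o: "occurs R' (name a' y) v i"
      define e where "e = i + int (length v) - 1"
      have bl: "block R' (name b y) i e" and v: "factor (name a' y) i e = v"
        using o block_name[OF a' elim(3)] by (auto simp: occurs_def e_def)
      have "good_word R L p \<epsilon> c v" using elim(1) bl v by auto
      moreover have "length v \<le> h" using elim(2) bl by (force simp: e_def)
      moreover have "set v \<subseteq> {..k}" using name_\<pi>(3)[OF a' elim(3)] unfolding v[symmetric] by (auto simp: factor_def)
      ultimately show "v \<in> L'" by (simp add: L'_def)
    qed
  qed
  moreover have "emeasure M {y\<in>space M. a y \<noteq> a' y} \<le> ennreal \<delta>"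
  proof -
    \<comment> \<open>Where a label changes, the surrounding block was not good. Its shorter blocks
      all lie in \<open>L\<close>, so the failure is one of frequencies, and this puts the point
      into \<open>B\<close>.\<close>
    have "AE y in M. y \<in> {y\<in>space M. a y \<noteq> a' y} \<longrightarrow> y \<in> B"
      using main small L(2) AE_space
    proof eventually_elim
      case (elim y)
      show ?case
      proof (intro impI, rule ccontr)
        assume y: "y \<in> {y\<in>space M. a y \<noteq> a' y}" and nB: "y \<notin> B"
        let ?x = "name a y"
        have ne: "name a' y 0 \<noteq> ?x 0" using y by (simp add: name_def)
        have "\<exists>s e. block R' ?x s e \<and> s \<le> 0 \<and> 0 \<le> e"
        proof (rule ccontr)
          assume n: "\<not> ?thesis"
          have "recode R' (\<lambda>s e. \<Psi> (factor ?x s e)) ?x 0 = ?x 0" unfolding recode_def by (rule if_not_P) (rule n)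
          then show False using elim(1) ne by simp
        qed
        then obtain s e where se: "block R' ?x s e" "s \<le> 0" "0 \<le> e" by blast
        have seb: "block R' (name b y) s e" using se block_name[OF a elim(4)] by simp
        have yK: "y \<in> K"
        proof (rule ccontr)
          assume "y \<notin> K"
          then have "b y = 1" using elim(4) by (simp add: K_def)
          then have "a y = 1" "a' y = 1"
            using a a' elim(4) \<pi>_1[of "a y"] \<pi>_1[of "a' y"] by (auto simp: labelling_def simp del: One_nat_def)
          then show False using y by simp
        qed
        have "good_word R L p \<epsilon> c (factor ?x s e)"
          unfolding good_word_def
        proof (intro conjI allI impI)
          fix v i assume o: "occurs R (extend (factor ?x s e)) v i"
          then have "s \<le> s + i" "s + i \<le> e"
            using occurs_extend_range[of R "factor ?x s e" v] se by auto
          then have "occurs R ?x v (s + i)"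
            using o occurs_in_block[OF se(1)] R' by simp
          then show "v \<in> L" using elim(3) by blast
        next
          show "\<forall>v\<in>L. \<bar>occ_count R (factor ?x s e) v - p v * visits (factor ?x s e)\<bar> \<le> \<epsilon> * visits (factor ?x s e) + c"
            using elim(2) yK nB seb se by blast
        qed
        then have "factor (name a' y) s e = factor ?x s e" using elim(1) seb by (simp add: \<Psi>_def)
        then have "factor (name a' y) s e ! nat (- s) = factor ?x s e ! nat (- s)" by simp
        then show False using ne se by (simp add: nth_factor)
      qed
    qed
    then have "emeasure M {y\<in>space M. a y \<noteq> a' y} \<le> emeasure M B" using B by (intro emeasure_mono_AE) auto
    with B(2) show ?thesis by simp
  qed
  moreover have "\<forall>V\<in>L'. good_word R L p \<epsilon> c V" by (simp add: L'_def)
  ultimately show ?thesis using R' a' c(1) c' by blast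
qed

end

section \<open>The limit labelling\<close>

definition pattern_count :: "((int \<Rightarrow> nat) \<Rightarrow> bool) \<Rightarrow> nat list \<Rightarrow> real" where
  "pattern_count P v = (\<Sum>i\<in>{0..<int (length v)}. of_bool (P (shift i (extend v))))"

lemma pattern_count_nonneg: "pattern_count P v \<ge> 0"
  unfolding pattern_count_def by (intro sum_nonneg) simp

lemma pattern_count_le_length: "pattern_count P v \<le> length v"
proof -
  have "pattern_count P v \<le> (\<Sum>i\<in>{0..<int (length v)}. 1)"
    unfolding pattern_count_def by (intro sum_mono) simp
  then show ?thesis by simp
qed

lemma pattern_in_block:
  assumes b: "block R x s e" and P: "window_determined m P" "m \<le> R" and i: "0 \<le> i" "i \<le> e - s"
  shows "P (shift i (extend (factor x s e))) \<longleftrightarrow> P (shift (s + i) x)"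
proof -
  have "shift i (extend (factor x s e)) j = shift (s + i) x j" if "\<bar>j\<bar> \<le> int m" for j
    using extend_factor_block[OF b, of "i + j"] that i P(2) by (simp add: shift_def add.assoc)
  then show ?thesis using P(1)[unfolded window_determined_def] by blast
qed

lemma pattern_count_block:
  assumes b: "block R x s e" and P: "window_determined m P" "m \<le> R"
  shows "pattern_count P (factor x s e) = (\<Sum>i\<in>{s..<e + 1}. of_bool (P (shift i x)))"
proof -
  have se: "s \<le> e" using b by (simp add: block_def)
  have "pattern_count P (factor x s e) = (\<Sum>i\<in>{0..<e - s + 1}. of_bool (P (shift (s + i) x)))"
    unfolding pattern_count_def using se by (intro sum.cong) (auto simp: pattern_in_block[OF b P])
  also have "\<dots> = (\<Sum>i\<in>{s..<e + 1}. of_bool (P (shift i x)))"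
    using sum_int_shift[of "\<lambda>i. of_bool (P (shift i x))" s 0 "e - s + 1"] by simp
  finally show ?thesis .
qed

text \<open>A pattern that demands a visit at time 0 is seen in exactly one shorter block and
  depends there on the labelled word only. Counting pairs of a block occurrence and a place in it
  gives an expression linear in the block counts.\<close>

lemma pattern_count_decompose:
  assumes L: "finite L" "\<And>v i. occurs R (extend V) v i \<Longrightarrow> v \<in> L"
    and P: "window_determined m P" "m \<le> R" and P1: "\<And>x. P x \<Longrightarrow> x 0 \<noteq> 1"
  shows "pattern_count P V = (\<Sum>v\<in>L. pattern_count P v * occ_count R V v)"
proof -
  let ?x = "extend V"
  define J where "J = (\<lambda>v. {j. occurs R ?x v j})"
  define N where "N = (\<lambda>v. {t\<in>{0..<int (length v)}. P (shift t (extend v))})"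
  have finN: "finite (N v)" for v by (rule finite_subset[of _ "{0..<int (length v)}"]) (auto simp: N_def)
  have finJ: "finite (J v)" for v unfolding J_def by (rule finite_occurs_extend)
  have pc: "pattern_count P v = card (N v)" for v
    unfolding pattern_count_def N_def by (simp add: sum_of_bool_eq Int_def)
  have sub: "0 \<le> t \<Longrightarrow> t < int (length v) \<Longrightarrow> P (shift t (extend v)) \<longleftrightarrow> P (shift (j + t) ?x)" if "occurs R ?x v j" for v j t
    using pattern_in_block[of R ?x j "j + int (length v) - 1" m P t] that P by (auto simp: occurs_def)
  have "bij_betw (\<lambda>(v, j, t). j + t) (SIGMA v:L. J v \<times> N v) (N V)"
    unfolding bij_betw_def
  proof
    show "inj_on (\<lambda>(v, j, t). j + t) (SIGMA v:L. J v \<times> N v)"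
    proof (rule inj_onI)
      fix x x' assume x: "x \<in> (SIGMA v:L. J v \<times> N v)" "x' \<in> (SIGMA v:L. J v \<times> N v)"
        and eq: "(\<lambda>(v, j, t). j + t) x = (\<lambda>(v, j, t). j + t) x'"
      obtain v j t v' j' t' where xs: "x = (v, j, t)" "x' = (v', j', t')" by (metis prod_cases3)
      have *: "j \<in> J v" "t \<in> N v" "j' \<in> J v'" "t' \<in> N v'" "j + t = j' + t'" using x eq by (auto simp: xs)
      then have o: "occurs R ?x v j" "occurs R ?x v' j'" by (auto simp: J_def)
      then have "block R ?x j (j + int (length v) - 1)" "block R ?x j' (j' + int (length v') - 1)" by (auto simp: occurs_def)
      from block_unique(1)[OF this, of "j + t"] * have "j = j'" by (auto simp: N_def)
      moreover have "v = v'" using o occurs_unique[of R ?x v j v'] \<open>j = j'\<close> by simp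
      ultimately show "x = x'" using *(5) by (simp add: xs)
    qed
    show "(\<lambda>(v, j, t). j + t) ` (SIGMA v:L. J v \<times> N v) = N V"
    proof (intro equalityI subsetI)
      fix i assume "i \<in> (\<lambda>(v, j, t). j + t) ` (SIGMA v:L. J v \<times> N v)"
      then obtain v j t where i: "i = j + t" "j \<in> J v" "t \<in> N v" by auto
      then have "P (shift i ?x)" using sub[of v j t] by (auto simp: J_def N_def)
      moreover have "0 \<le> i" "i < int (length V)"
        using i occurs_extend_bounds[of R V v j] by (auto simp: J_def N_def)
      ultimately show "i \<in> N V" by (simp add: N_def)
    next
      fix i assume i: "i \<in> N V"
      then have "?x i \<noteq> 1" using P1[of "shift i ?x"] by (simp add: N_def shift_def)
      then obtain s e where se: "block R ?x s e" "s \<le> i" "i \<le> e" using block_in_extend by blast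
      let ?v = "factor ?x s e"
      have o: "occurs R ?x ?v s" by (rule occurs_block[OF se(1)])
      then have "?v \<in> L" by (rule L(2))
      moreover have "i - s \<in> N ?v" using sub[OF o, of "i - s"] se i by (simp add: N_def)
      ultimately have "(?v, s, i - s) \<in> (SIGMA v:L. J v \<times> N v)" using o by (simp add: J_def)
      then show "i \<in> (\<lambda>(v, j, t). j + t) ` (SIGMA v:L. J v \<times> N v)" by (rule rev_image_eqI) simp
    qed
  qed
  then have "card (N V) = card (SIGMA v:L. J v \<times> N v)" by (rule bij_betw_same_card[symmetric])
  also have "\<dots> = (\<Sum>v\<in>L. card (J v \<times> N v))" using L finN finJ by (intro card_SigmaI) auto
  finally have "pattern_count P V = (\<Sum>v\<in>L. real (card (J v)) * real (card (N v)))" unfolding pc by (simp add: card_cartesian_product)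
  then show ?thesis unfolding occ_count_eq_card pc J_def by (simp add: mult.commute)
qed

text \<open>By linearity the deviations of the block counts carry over, with coefficients at most
  the lengths of the words. The resulting factor, the total length of \<open>L\<close>, is what
  \<open>slope\<close> compensates.\<close>

lemma pattern_count_good_word:
  assumes L: "finite L" and good: "good_word R L p \<epsilon> c V"
    and P: "window_determined m P" "m \<le> R" and P1: "\<And>x. P x \<Longrightarrow> x 0 \<noteq> 1" and "0 \<le> \<epsilon>" "0 \<le> c"
  shows "\<bar>pattern_count P V - (\<Sum>v\<in>L. pattern_count P v * p v) * visits V\<bar>
    \<le> (\<Sum>v\<in>L. real (length v)) * (\<epsilon> * visits V + c)"
proof -
  have dec: "pattern_count P V = (\<Sum>v\<in>L. pattern_count P v * occ_count R V v)"
  proof (rule pattern_count_decompose)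
    show "v \<in> L" if "occurs R (extend V) v i" for v i using good that by (auto simp: good_word_def)
  qed (use L P P1 in auto)
  have "pattern_count P V - (\<Sum>v\<in>L. pattern_count P v * p v) * visits V =
    (\<Sum>v\<in>L. pattern_count P v * (occ_count R V v - p v * visits V))"
    unfolding dec by (simp add: sum_subtractf sum_distrib_right right_diff_distrib mult.assoc)
  also have "\<bar>\<dots>\<bar> \<le> (\<Sum>v\<in>L. \<bar>pattern_count P v * (occ_count R V v - p v * visits V)\<bar>)" by (rule sum_abs)
  also have "\<dots> \<le> (\<Sum>v\<in>L. real (length v) * (\<epsilon> * visits V + c))"
  proof (rule sum_mono)
    fix v assume "v \<in> L"
    then show "\<bar>pattern_count P v * (occ_count R V v - p v * visits V)\<bar> \<le> real (length v) * (\<epsilon> * visits V + c)"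
      unfolding abs_mult using good pattern_count_le_length[of P v] pattern_count_nonneg[of P v]
      by (intro mult_mono) (auto simp: good_word_def)
  qed
  finally show ?thesis by (simp add: sum_distrib_right)
qed

context refining_labels begin

text \<open>By \<open>AE_bounded_sums\<close>, a function with unbounded forward sums has nonnegative integral; this
  bounds the frequency on both sides.\<close>

lemma freq_eqI_approx:
  assumes a: "labelling a" and P: "window_determined m P" and P1: "\<And>x. P x \<Longrightarrow> x 0 \<noteq> 1" and \<epsilon>: "\<epsilon> > 0"
    and dev: "AE y in M. near_freq (\<lambda>i. P (shift i (name a y))) q \<epsilon> c (name b y)"
  shows "\<bar>freq P a - q\<bar> \<le> 2 * \<epsilon>"
proof -
  have am [measurable]: "a \<in> measurable M (count_space UNIV)" using a by (simp add: labelling_def)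
  have Pm [measurable]: "Measurable.pred M (\<lambda>y. P (name a y))" by (rule measurable_window_determined[OF am P])
  define C where "C = {y\<in>space M. P (name a y)}"
  have Cm [measurable]: "C \<in> sets M" unfolding C_def by measurable
  have CK: "C \<subseteq> K"
  proof
    fix y assume "y \<in> C"
    then have y: "y \<in> space M" "name a y 0 \<noteq> 1" using P1 by (simp_all add: C_def del: One_nat_def)
    then have "name b y 0 \<noteq> 1" using name_\<pi>(2)[OF a y(1)] by simp
    then show "y \<in> K" using y by (simp add: K_def name_def)
  qed
  then have "emeasure M C \<le> emeasure M K" by (intro emeasure_mono) auto
  then have fin: "emeasure M C < \<infinity>" using K_measure by (auto simp: less_top[symmetric] top_unique)
  have False if \<sigma>: "\<sigma> = 1 \<or> \<sigma> = -1" and gt: "\<sigma> * (freq P a - q) > 2 * \<epsilon>" for \<sigma> :: real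
  proof -
    \<comment> \<open>The sign \<sigma> treats both bounds at once. If the frequency were off by
      more than \<open>2 * \<epsilon>\<close>, the integral of \<open>f\<close> would be negative,
      although its forward sums grow by at least \<epsilon> per visit, up to a constant.\<close>
    define f where "f = (\<lambda>y. (\<sigma> * q + 2 * \<epsilon>) * indicator K y - \<sigma> * indicator C y :: real)"
    have int: "integrable M f" unfolding f_def using K_measure fin
      by (intro Bochner_Integration.integrable_diff integrable_mult_right integrable_real_indicator) auto
    have "(\<integral>y. f y \<partial>M) = (\<sigma> * q + 2 * \<epsilon>) * measure M K - \<sigma> * measure M C"
      unfolding f_def using K_measure fin
      by (subst Bochner_Integration.integral_diff) (auto intro!: integrable_mult_right integrable_real_indicator)
    also have "measure M C = freq P a * measure M K" using K_measure by (simp add: freq_def C_def)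
    also have "(\<sigma> * q + 2 * \<epsilon>) * measure M K - \<sigma> * (freq P a * measure M K) = - (\<sigma> * (freq P a - q) - 2 * \<epsilon>) * measure M K"
      by (simp add: algebra_simps)
    also have "\<dots> < 0" using gt K_measure by (intro mult_neg_pos) auto
    finally have "AE y in M. \<exists>c. \<forall>n. (\<Sum>i<n. f (orb (int i) y)) \<le> c" by (rule AE_bounded_sums[OF int])
    then have "AE y in M. False"
      using dev AE_recurrent_name AE_name_orb[of a] AE_space
    proof eventually_elim
      case (elim y)
      let ?x = "name b y"
      have sp: "orb i y \<in> space M" for i using measurable_space[OF measurable_orb elim(5)] .
      obtain B where B: "\<And>n. (\<Sum>i<n. f (orb (int i) y)) \<le> B" using elim(1) by blast
      define n0 where "n0 = nat \<lceil>(B + c) / \<epsilon>\<rceil> + 1"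
      have n0: "real n0 > (B + c) / \<epsilon>" unfolding n0_def by linarith
      obtain d where d: "0 \<le> d" "sum (visit ?x) {0..<d} \<ge> real n0" using recurrent_many_visits(1)[OF elim(3), of 0 n0] by auto
      let ?v = "sum (visit ?x) {0..<d}" and ?n = "\<Sum>i\<in>{0..<d}. of_bool (P (shift i (name a y))) :: real"
      have fi: "f (orb i y) = (\<sigma> * q + 2 * \<epsilon>) * visit ?x i - \<sigma> * of_bool (P (shift i (name a y)))" for i
        using sp[of i] elim(4) by (simp add: f_def K_def C_def visit_def name_def[of b] indicator_def of_bool_def)
      have "(\<Sum>i<nat d. f (orb (int i) y)) = (\<Sum>i\<in>{0..<d}. f (orb i y))"
        using sum_nat_int[of "\<lambda>i. f (orb i y)" "nat d"] d by simp
      also have "\<dots> = (\<sigma> * q + 2 * \<epsilon>) * ?v - \<sigma> * ?n"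
        unfolding fi by (simp add: sum_subtractf sum_distrib_left)
      finally have "(\<sigma> * q + 2 * \<epsilon>) * ?v - \<sigma> * ?n \<le> B" using B[of "nat d"] by simp
      moreover have "\<sigma> * (?n - q * ?v) \<le> \<epsilon> * ?v + c"
        using elim(2)[rule_format, OF d(1)] \<sigma> by (auto simp: abs_le_iff)
      ultimately have "\<epsilon> * ?v \<le> B + c" by (simp add: algebra_simps)
      then have "\<epsilon> * real n0 \<le> B + c" using d \<epsilon> by (meson mult_left_mono order_trans less_imp_le)
      then show False using n0 \<epsilon> by (simp add: field_simps)
    qed
    then show False using space_infinite by (simp add: eventually_False ae_filter_eq_bot_iff)
  qed
  from this[of 1] this[of "-1"] show ?thesis by (cases "freq P a - q \<ge> 0") (auto simp: not_less[symmetric])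
qed

section \<open>The sequence of stages\<close>

definition state_ok :: "('a \<Rightarrow> nat) \<times> nat \<times> nat list set \<Rightarrow> bool" where
  "state_ok = (\<lambda>(a, R, L). labelling a \<and> finite L \<and> (AE y in M. \<forall>v i. occurs R (name a y) v i \<longrightarrow> v \<in> L))"

text \<open>Multiplied by the total length of the words of \<open>L\<close>, as in
  \<open>pattern_count_good_word\<close>, the tolerance is still at most \<open>(1/2) ^ n\<close>.
  The summand 1 keeps the denominator positive and the tolerance itself below that bound.\<close>

definition slope :: "nat \<Rightarrow> nat list set \<Rightarrow> real" where
  "slope n L = (1/2) ^ n / (1 + (\<Sum>v\<in>L. real (length v)))"

lemma slope: "0 < slope n L" "slope n L \<le> 1" "(\<Sum>v\<in>L. real (length v)) * slope n L \<le> (1/2) ^ n" "slope n L \<le> (1/2) ^ n"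
proof -
  define S where "S = (\<Sum>v\<in>L. real (length v))"
  have S: "S \<ge> 0" unfolding S_def by (intro sum_nonneg) simp
  have sl: "slope n L = (1/2) ^ n / (1 + S)" by (simp add: slope_def S_def)
  show "0 < slope n L" using S by (simp add: sl)
  have "S * ((1/2) ^ n / (1 + S)) = (1/2) ^ n * (S / (1 + S))" by simp
  also have "\<dots> \<le> (1/2) ^ n * 1" using S by (intro mult_left_mono) auto
  finally show "(\<Sum>v\<in>L. real (length v)) * slope n L \<le> (1/2) ^ n" by (simp add: sl S_def)
  have "(1/2) ^ n / (1 + S) \<le> (1/2) ^ n / 1" using S by (intro divide_left_mono) auto
  then show *: "slope n L \<le> (1/2) ^ n" by (simp add: sl)
  also have "\<dots> \<le> (1::real)" by (rule power_le_one) auto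
  finally show "slope n L \<le> 1" .
qed

definition state_step :: "real \<Rightarrow> nat \<Rightarrow> ('a \<Rightarrow> nat) \<times> nat \<times> nat list set \<Rightarrow> ('a \<Rightarrow> nat) \<times> nat \<times> nat list set \<Rightarrow> bool" where
  "state_step \<delta> n = (\<lambda>(a, R, L) (a', R', L'). R < R' \<and>
    emeasure M {y\<in>space M. a y \<noteq> a' y} \<le> ennreal (\<delta> * (1/2) ^ Suc n) \<and>
    (\<exists>p c c'. c \<ge> 0 \<and> (\<forall>V\<in>L'. good_word R L p (slope n L) c V) \<and>
      (AE y in M. \<forall>s e. s \<le> e \<longrightarrow>
        c * (\<Sum>i\<in>{s..<e}. of_bool (gap_end R' (name b y) i)) \<le> slope n L * sum (visit (name b y)) {s..<e} + c')))"

lemma state_sequence: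
  assumes a: "labelling a" and \<delta>: "\<delta> > 0"
  shows "\<exists>\<alpha> R L. \<alpha> 0 = a \<and> (\<forall>n. state_ok (\<alpha> n, R n, L n) \<and> state_step \<delta> n (\<alpha> n, R n, L n) (\<alpha> (Suc n), R (Suc n), L (Suc n)))"
proof -
  have "\<exists>st. \<forall>n. (state_ok (st n) \<and> (n = 0 \<longrightarrow> fst (st n) = a)) \<and> state_step \<delta> n (st n) (st (Suc n))"
  proof (rule dependent_nat_choice)
    \<comment> \<open>The gap length starts at 0, where every visit is a block by itself; the
      initial list contains all words of bounded length over the alphabet.\<close>
    obtain h where h: "AE y in M. \<forall>s e. block 0 (name b y) s e \<longrightarrow> e - s < int h"
      using AE_blocks[of 0] by auto
    define L where "L = {V. set V \<subseteq> {..k} \<and> length V \<le> h}"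
    have "finite L" unfolding L_def by (rule finite_lists_length_le) simp
    moreover have "AE y in M. \<forall>v i. occurs 0 (name a y) v i \<longrightarrow> v \<in> L"
      using h AE_space
    proof eventually_elim
      case (elim y)
      show ?case
      proof (intro allI impI)
        fix v i assume o: "occurs 0 (name a y) v i"
        define e where "e = i + int (length v) - 1"
        have bl: "block 0 (name b y) i e" and v: "factor (name a y) i e = v"
          using o block_name[OF a elim(2)] by (auto simp: occurs_def e_def)
        have "length v \<le> h" using elim(1) bl by (force simp: e_def)
        moreover have "set v \<subseteq> {..k}" using name_\<pi>(3)[OF a elim(2)] unfolding v[symmetric] by (auto simp: factor_def)
        ultimately show "v \<in> L" by (simp add: L_def)
      qed
    qed
    ultimately show "\<exists>st. state_ok st \<and> (0 = (0::nat) \<longrightarrow> fst st = a)"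
      using a by (intro exI[of _ "(a, 0, L)"]) (simp add: state_ok_def)
  next
    fix st :: "('a \<Rightarrow> nat) \<times> nat \<times> nat list set" and n :: nat
    assume ok: "state_ok st \<and> (n = 0 \<longrightarrow> fst st = a)"
    obtain a1 R1 L1 where st: "st = (a1, R1, L1)" by (cases st)
    have 1: "labelling a1" "finite L1" "AE y in M. \<forall>v i. occurs R1 (name a1 y) v i \<longrightarrow> v \<in> L1"
      using ok by (auto simp: state_ok_def st)
    have d: "\<delta> * (1/2) ^ Suc n > 0" using \<delta> by simp
    obtain a2 R2 L2 where "R1 < R2 \<and> labelling a2 \<and> finite L2 \<and>
      (AE y in M. \<forall>v i. occurs R2 (name a2 y) v i \<longrightarrow> v \<in> L2) \<and>
      emeasure M {y\<in>space M. a1 y \<noteq> a2 y} \<le> ennreal (\<delta> * (1/2) ^ Suc n) \<and>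
      (\<exists>p c c'. c \<ge> 0 \<and> (\<forall>V\<in>L2. good_word R1 L1 p (slope n L1) c V) \<and>
        (AE y in M. \<forall>s e. s \<le> e \<longrightarrow>
        c * (\<Sum>i\<in>{s..<e}. of_bool (gap_end R2 (name b y) i)) \<le> slope n L1 * sum (visit (name b y)) {s..<e} + c'))"
      using refinement_stage[OF 1 slope(1)[of n L1] slope(2)[of n L1] d] by (elim exE) (rule that)
    then have "state_ok (a2, R2, L2) \<and> state_step \<delta> n st (a2, R2, L2)"
      unfolding st state_ok_def state_step_def by simp
    then show "\<exists>st'. (state_ok st' \<and> (Suc n = 0 \<longrightarrow> fst st' = a)) \<and> state_step \<delta> n st st'" by blast
  qed
  then obtain st where st: "\<And>n. state_ok (st n)" "fst (st 0) = a" "\<And>n. state_step \<delta> n (st n) (st (Suc n))" by blast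
  show ?thesis
    by (rule exI[of _ "\<lambda>n. fst (st n)"], rule exI[of _ "\<lambda>n. fst (snd (st n))"], rule exI[of _ "\<lambda>n. snd (snd (st n))"])
      (use st in simp)
qed

text \<open>The labels stabilise by the Borel-Cantelli lemma. A block of the limit labelling is
  finite, hence already a block of some late stage, and so its word belongs to the list of every
  earlier gap length; the frequencies recorded in the lists thus hold for the limit.\<close>

lemma uniform_refinement_exists:
  assumes a: "labelling a" and \<delta>: "\<delta> > 0"
  shows "\<exists>a'. labelling a' \<and> emeasure M {y\<in>space M. a y \<noteq> a' y} \<le> ennreal \<delta> \<and>
    (\<forall>P m \<epsilon>. window_determined m P \<longrightarrow> (\<forall>x. P x \<longrightarrow> x 0 \<noteq> 1) \<longrightarrow> \<epsilon> > 0 \<longrightarrow>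
      (\<exists>c. AE y in M. near_freq (\<lambda>i. P (shift i (name a' y))) (freq P a') \<epsilon> c (name b y)))"
proof -
  obtain \<alpha> R L where \<alpha>0: "\<alpha> 0 = a" and ok: "\<And>n. state_ok (\<alpha> n, R n, L n)"
    and step: "\<And>n. state_step \<delta> n (\<alpha> n, R n, L n) (\<alpha> (Suc n), R (Suc n), L (Suc n))"
    using state_sequence[OF a \<delta>] by blast
  have ok': "labelling (\<alpha> n) \<and> finite (L n) \<and> (AE y in M. \<forall>v i. occurs (R n) (name (\<alpha> n) y) v i \<longrightarrow> v \<in> L n)" for n
    using ok[of n] unfolding state_ok_def prod.case .
  have lab: "labelling (\<alpha> n)" for n using ok'[of n] by (rule conjunct1)
  have finL: "finite (L n)" for n using ok'[of n] by (elim conjE)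
  have occL: "AE y in M. \<forall>v i. occurs (R n) (name (\<alpha> n) y) v i \<longrightarrow> v \<in> L n" for n
    using ok'[of n] by (elim conjE)
  have \<alpha>m [measurable]: "\<alpha> n \<in> measurable M (count_space UNIV)" for n using lab[of n] by (simp add: labelling_def)
  note step' = step[unfolded state_step_def prod.case]
  have R_Suc: "R n < R (Suc n)" for n using step'[of n] by (rule conjunct1)
  have \<alpha>_Suc: "emeasure M {y\<in>space M. \<alpha> n y \<noteq> \<alpha> (Suc n) y} \<le> ennreal (\<delta> * (1/2) ^ Suc n)" for n
    using step'[of n] by (elim conjE)
  have L_Suc: "\<exists>p c c'. c \<ge> 0 \<and> (\<forall>V\<in>L (Suc n). good_word (R n) (L n) p (slope n (L n)) c V) \<and>
      (AE y in M. \<forall>s e. s \<le> e \<longrightarrow>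
        c * (\<Sum>i\<in>{s..<e}. of_bool (gap_end (R (Suc n)) (name b y) i)) \<le> slope n (L n) * sum (visit (name b y)) {s..<e} + c')" for n
    using step'[of n] by (elim conjE)
  have R_mono: "strict_mono R" using R_Suc by (simp add: strict_mono_Suc_iff)
  have R_ge: "n \<le> R n" for n using R_mono by (rule strict_mono_imp_increasing)
  have R_le: "R m \<le> R n" if "m \<le> n" for m n using R_mono that by (simp add: strict_mono_less_eq)
  \<comment> \<open>The lists are hierarchical: an \<open>R m\<close>-block inside a word of a later
    list lies in a block of the preceding gap length, which goodness puts into the preceding list.
    The induction descends to \<open>L m\<close>.\<close>
  have sub: "v \<in> L m" if "V \<in> L n" "m < n" "occurs (R m) (extend V) v i" for m n V v i
    using that
  proof (induction n arbitrary: V v i)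
    case (Suc n)
    have good: "\<And>u j. occurs (R n) (extend V) u j \<Longrightarrow> u \<in> L n"
      using L_Suc[of n] Suc.prems(1) unfolding good_word_def by blast
    show ?case
    proof (cases "m = n")
      case True then show ?thesis using good Suc.prems by blast
    next
      case False
      have "extend V i \<noteq> 1" using Suc.prems(3) by (auto simp: occurs_def block_def)
      then obtain s e where se: "block (R n) (extend V) s e" "s \<le> i" "i \<le> e" using block_in_extend by blast
      have "factor (extend V) s e \<in> L n" using good occurs_block[OF se(1)] by blast
      moreover have "occurs (R m) (extend (factor (extend V) s e)) v (i - s)"
        using occurs_in_block[OF se(1) R_le[of m n], of "i - s" v] Suc.prems False se by simp
      ultimately show ?thesis using Suc.IH Suc.prems False by simp
    qed
  qed simp
  have occL': "AE y in M. \<forall>v i. occurs (R m) (name (\<alpha> n) y) v i \<longrightarrow> v \<in> L m" if "m \<le> n" for m n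
  proof (cases "m = n")
    case True then show ?thesis using occL by simp
  next
    case False
    obtain h where h: "AE y in M. (\<forall>s e. block (R n) (name b y) s e \<longrightarrow> e - s < int h) \<and>
     (\<forall>i. name b y i \<noteq> 1 \<longrightarrow> (\<exists>s e. block (R n) (name b y) s e \<and> s \<le> i \<and> i \<le> e))" using AE_blocks by blast
    show ?thesis using occL[of n] h AE_space
    proof eventually_elim
      case (elim y)
      show ?case
      proof (intro allI impI)
        fix v i assume o: "occurs (R m) (name (\<alpha> n) y) v i"
        then have "name b y i \<noteq> 1" using name_\<pi>(2)[OF lab elim(3)] by (auto simp: occurs_def block_def)
        then obtain s e where se: "block (R n) (name (\<alpha> n) y) s e" "s \<le> i" "i \<le> e"
          using elim(2) block_name[OF lab elim(3)] by blast
        have "factor (name (\<alpha> n) y) s e \<in> L n" using elim(1) occurs_block[OF se(1)] by blast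
        moreover have "occurs (R m) (extend (factor (name (\<alpha> n) y) s e)) v (i - s)"
          using occurs_in_block[OF se(1) R_le[of m n], of "i - s" v] o that se by simp
        ultimately show "v \<in> L m" using sub that False by simp
      qed
    qed
  qed
  define stab where "stab = (\<lambda>y. \<exists>N. \<forall>n\<ge>N. \<alpha> n y = \<alpha> N y)"
  \<comment> \<open>Where the labels never settle, which is a null set by \<open>stable\<close>
    below, the initial label keeps \<open>a'\<close> over \<open>b\<close>.\<close>
  define a' where "a' = (\<lambda>y. if stab y then \<alpha> (LEAST N. \<forall>n\<ge>N. \<alpha> n y = \<alpha> N y) y else a y)"
  have a'_ev: "\<exists>N. \<forall>n\<ge>N. \<alpha> n y = a' y" if "stab y" for y
  proof -
    define N where "N = (LEAST N. \<forall>n\<ge>N. \<alpha> n y = \<alpha> N y)"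
    have N: "\<forall>n\<ge>N. \<alpha> n y = \<alpha> N y" unfolding N_def using that[unfolded stab_def] by (rule LeastI_ex)
    have a'N: "a' y = \<alpha> N y" unfolding a'_def N_def using that by (rule if_P)
    show ?thesis unfolding a'N using N by (rule exI)
  qed
  \<comment> \<open>A description by countable operations instead of \<open>LEAST\<close>, used for
    measurability.\<close>
  have a'_eq: "a' y = l \<longleftrightarrow> (\<exists>N. \<forall>n\<ge>N. \<alpha> n y = l) \<or> \<not> stab y \<and> a y = l" for y l
  proof (cases "stab y")
    case True
    then obtain N where N: "\<forall>n\<ge>N. \<alpha> n y = a' y" using a'_ev by blast
    show ?thesis
    proof
      assume "a' y = l" then show "(\<exists>N. \<forall>n\<ge>N. \<alpha> n y = l) \<or> \<not> stab y \<and> a y = l" using N by blast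
    next
      assume "(\<exists>N. \<forall>n\<ge>N. \<alpha> n y = l) \<or> \<not> stab y \<and> a y = l"
      then obtain N' where "\<forall>n\<ge>N'. \<alpha> n y = l" using True by blast
      then have "\<alpha> (max N N') y = l" by simp
      moreover have "\<alpha> (max N N') y = a' y" using N by simp
      ultimately show "a' y = l" by simp
    qed
  next
    case False
    have "\<not> (\<exists>N. \<forall>n\<ge>N. \<alpha> n y = l)"
    proof
      assume "\<exists>N. \<forall>n\<ge>N. \<alpha> n y = l"
      then obtain N where N: "\<And>n. n \<ge> N \<Longrightarrow> \<alpha> n y = l" by blast
      have "\<forall>n\<ge>N. \<alpha> n y = \<alpha> N y" by (simp add: N)
      then show False using False unfolding stab_def by blast
    qed
    then have E: "(\<exists>N. \<forall>n\<ge>N. \<alpha> n y = l) = False" by (rule eq_False[THEN iffD2])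
    have "a' y = a y" unfolding a'_def using False by (rule if_not_P)
    then show ?thesis unfolding E using False by simp
  qed
  have am [measurable]: "a \<in> measurable M (count_space UNIV)" using a by (simp add: labelling_def)
  have [measurable]: "Measurable.pred M (\<lambda>y. \<alpha> n y = \<alpha> N y)" for n N
  proof -
    have "Measurable.pred M (\<lambda>y. \<exists>l. \<alpha> N y = l \<and> \<alpha> n y = l)" by measurable
    then show ?thesis by simp
  qed
  have a'm [measurable]: "a' \<in> measurable M (count_space UNIV)"
  proof (subst measurable_count_space_eq2_countable, intro conjI ballI)
    fix l :: nat
    have [measurable]: "Measurable.pred M stab" unfolding stab_def by measurable
    have "Measurable.pred M (\<lambda>y. a' y = l)" unfolding a'_eq by measurable
    then have "{y\<in>space M. a' y = l} \<in> sets M" by (simp add: pred_def)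
    also have "{y\<in>space M. a' y = l} = a' -` {l} \<inter> space M" by auto
    finally show "a' -` {l} \<inter> space M \<in> sets M" .
  qed auto
  have a': "labelling a'" unfolding labelling_def
  proof (intro conjI ballI a'm)
    fix y assume y: "y \<in> space M"
    show "\<pi> (a' y) = b y"
    proof (cases "stab y")
      case True
      then obtain N where "\<alpha> N y = a' y" using a'_ev by blast
      then show ?thesis using lab[of N] y unfolding labelling_def by metis
    next
      case False
      then have "a' y = a y" unfolding a'_def by (rule if_not_P)
      then show ?thesis using a y by (simp add: labelling_def)
    qed
  qed
  define D where "D = (\<lambda>n. {y\<in>space M. \<alpha> n y \<noteq> \<alpha> (Suc n) y})"
  have Dm [measurable]: "D n \<in> sets M" for n unfolding D_def by measurable
  have De: "emeasure M (D n) \<le> ennreal (\<delta> * (1/2) ^ Suc n)" for n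
    unfolding D_def by (rule \<alpha>_Suc)
  have stable: "AE y in M. stab y"
  proof -
    have fin: "emeasure M (D n) < \<infinity>" for n using De[of n] by (auto simp: less_top[symmetric] top_unique)
    have sums: "summable (\<lambda>n. \<delta> * (1/2) ^ Suc n)" by (intro summable_mult) (simp add: summable_Suc_iff)
    have "summable (\<lambda>n. measure M (D n))"
    proof (rule summable_comparison_test'[OF sums, of 0])
      fix n :: nat
      have "emeasure M (D n) = ennreal (measure M (D n))" using fin[of n] by (intro emeasure_eq_ennreal_measure) auto
      then have "measure M (D n) \<le> \<delta> * (1/2) ^ Suc n" using De[of n] \<delta> by (simp del: power_Suc)
      then show "norm (measure M (D n)) \<le> \<delta> * (1/2) ^ Suc n" by simp
    qed
    then have "AE y in M. eventually (\<lambda>n. y \<in> space M - D n) sequentially"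
      using fin by (intro borel_cantelli_AE1) auto
    then show ?thesis
    proof eventually_elim
      case (elim y)
      then obtain N where N: "\<And>n. n \<ge> N \<Longrightarrow> \<alpha> n y = \<alpha> (Suc n) y" by (auto simp: eventually_sequentially D_def)
      have "\<alpha> n y = \<alpha> N y" if "n \<ge> N" for n
        using that
      proof (induction rule: dec_induct)
        case (step n)
        then show ?case using N[of n] by simp
      qed simp
      then show ?case unfolding stab_def by blast
    qed
  qed
  have close: "emeasure M {y\<in>space M. a y \<noteq> a' y} \<le> ennreal \<delta>"
  proof -
    have "AE y in M. y \<in> {y\<in>space M. a y \<noteq> a' y} \<longrightarrow> y \<in> (\<Union>n. D n)"
      using stable AE_space
    proof eventually_elim
      case (elim y)
      show ?case
      proof (rule impI, rule ccontr)
        assume y: "y \<in> {y\<in>space M. a y \<noteq> a' y}" and n: "y \<notin> (\<Union>n. D n)"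
        have eq: "\<alpha> n y = \<alpha> (Suc n) y" for n
        proof (rule ccontr)
          assume "\<not> ?thesis"
          then have "y \<in> D n" using elim(2) unfolding D_def by blast
          then show False using n by blast
        qed
        have 0: "\<alpha> n y = a y" for n
        proof (induction n)
          case (Suc n)
          then show ?case using eq[of n] by simp
        qed (simp add: \<alpha>0)
        obtain N where "\<forall>n\<ge>N. \<alpha> n y = a' y" using a'_ev[OF elim(1)] by blast
        then have "\<alpha> N y = a' y" by blast
        then show False using y 0[of N] by simp
      qed
    qed
    then have "emeasure M {y\<in>space M. a y \<noteq> a' y} \<le> emeasure M (\<Union>n. D n)" by (intro emeasure_mono_AE) auto
    also have "\<dots> \<le> (\<Sum>n. emeasure M (D n))" by (intro emeasure_subadditive_countably) auto
    also have "\<dots> \<le> (\<Sum>n. ennreal (\<delta> * (1/2) ^ Suc n))" by (intro suminf_le De) auto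
    also have "\<dots> = ennreal \<delta>"
    proof -
      have "(\<lambda>n. \<delta> * (1/2) ^ Suc n) sums (\<delta> * 1)" by (intro sums_mult power_half_series)
      then show ?thesis using \<delta> by (intro suminf_ennreal_eq) (auto simp del: power_Suc)
    qed
    finally show ?thesis .
  qed
  have occ': "AE y in M. \<forall>v i. occurs (R m) (name a' y) v i \<longrightarrow> v \<in> L m" for m
  proof -
    have "AE y in M. \<forall>n. n \<ge> m \<longrightarrow> (\<forall>v i. occurs (R m) (name (\<alpha> n) y) v i \<longrightarrow> v \<in> L m)"
      unfolding AE_all_countable using occL'[of m] by auto
    then show ?thesis using AE_orb[OF stable] AE_space
    proof eventually_elim
      case (elim y)
      show ?case
      proof (intro allI impI)
        fix v i assume o: "occurs (R m) (name a' y) v i"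
        define e where "e = i + int (length v) - 1"
        have bl: "block (R m) (name b y) i e" and v: "factor (name a' y) i e = v"
          using o block_name[OF a' elim(3)] by (auto simp: occurs_def e_def)
        have "\<forall>j\<in>{i..e}. eventually (\<lambda>n. name (\<alpha> n) y j = name a' y j) sequentially"
          using elim(2) a'_ev by (simp add: eventually_sequentially name_def)
        then have "eventually (\<lambda>n. \<forall>j\<in>{i..e}. name (\<alpha> n) y j = name a' y j) sequentially"
          by (intro eventually_ball_finite) auto
        then have "eventually (\<lambda>n. n \<ge> m \<and> (\<forall>j\<in>{i..e}. name (\<alpha> n) y j = name a' y j)) sequentially"
          by (intro eventually_conj eventually_ge_at_top)
        then obtain n where n: "n \<ge> m" "\<forall>j\<in>{i..e}. name (\<alpha> n) y j = name a' y j"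
          using eventually_happens'[OF sequentially_bot] by blast
        have "factor (name (\<alpha> n) y) i e = v" unfolding v[symmetric] factor_def using n(2) by simp
        moreover have "block (R m) (name (\<alpha> n) y) i e" using bl block_name[OF lab elim(3)] by simp
        ultimately have "occurs (R m) (name (\<alpha> n) y) v i" using occurs_block by blast
        then show "v \<in> L m" using elim(1) n(1) by blast
      qed
    qed
  qed
  \<comment> \<open>\<open>q\<close> is the frequency predicted by the recorded \<open>p\<close>,
    which belongs to an earlier labelling; \<open>freq_eqI_approx\<close> later replaces it by the
    frequency of \<open>a'\<close>.\<close>
  have approx: "\<exists>q c. AE y in M. near_freq (\<lambda>i. P (shift i (name a' y))) q \<epsilon> c (name b y)"
    if P: "window_determined m P" and P1: "\<And>x. P x \<Longrightarrow> x 0 \<noteq> 1" and \<epsilon>: "\<epsilon> > 0" for P m \<epsilon>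
  proof -
    obtain n0 :: nat where n0: "(1/2) ^ n0 < \<epsilon> / 2" using real_arch_pow_inv[of "\<epsilon> / 2" "1/2"] \<epsilon> by auto
    \<comment> \<open>\<open>n0\<close> makes the slope small; \<open>m\<close> ensures that the
      windows fit into the gaps, as \<open>R n\<close> is at least \<open>n\<close>.\<close>
    define n where "n = max n0 m"
    have "(1/2::real) ^ n \<le> (1/2) ^ n0" by (rule power_decreasing) (auto simp: n_def)
    \<comment> \<open>One share is the slope of the good words, the other the cost of the block
      ends.\<close>
    then have n\<epsilon>: "2 * (1/2) ^ n \<le> \<epsilon>" using n0 by linarith
    have mR: "m \<le> R n" "m \<le> R (Suc n)" using R_ge[of n] R_Suc[of n] by (auto simp: n_def)
    obtain p c c' where c: "c \<ge> 0" and good: "\<And>V. V \<in> L (Suc n) \<Longrightarrow> good_word (R n) (L n) p (slope n (L n)) c V"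
      and gap: "AE y in M. \<forall>s e. s \<le> e \<longrightarrow>
        c * (\<Sum>i\<in>{s..<e}. of_bool (gap_end (R (Suc n)) (name b y) i)) \<le> slope n (L n) * sum (visit (name b y)) {s..<e} + c'"
      using L_Suc[of n] by blast
    define S where "S = (\<Sum>v\<in>L n. real (length v))"
    have S: "S \<ge> 0" unfolding S_def by (intro sum_nonneg) simp
    have Sslope: "S * slope n (L n) \<le> (1/2) ^ n" unfolding S_def by (rule slope(3))
    define q where "q = (\<Sum>v\<in>L n. pattern_count P v * p v)"
    \<comment> \<open>\<open>sum_over_blocks\<close> needs a function bounded by the visits;
      division by \<open>Q\<close> achieves this however large \<open>q\<close> is.\<close>
    define Q where "Q = 1 + \<bar>q\<bar>"
    have Q: "Q \<ge> 1" by (simp add: Q_def)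
    obtain h where h: "AE y in M. (\<forall>s e. block (R (Suc n)) (name b y) s e \<longrightarrow> e - s < int h) \<and>
     (\<forall>i. name b y i \<noteq> 1 \<longrightarrow> (\<exists>s e. block (R (Suc n)) (name b y) s e \<and> s \<le> i \<and> i \<le> e))" using AE_blocks by blast
    have "AE y in M. near_freq (\<lambda>i. P (shift i (name a' y))) q \<epsilon> (S * c' + Q * (2 * h)) (name b y)"
      using gap h occ'[of "Suc n"] AE_space
    proof eventually_elim
      case (elim y)
      let ?x = "name a' y"
      have vis: "visit (name b y) = visit ?x" using visit_name[OF a' elim(4)] by simp
      define f where "f = (\<lambda>i. (of_bool (P (shift i ?x)) - q * visit ?x i) / Q)"
      have sumf: "sum f {s..<e} = ((\<Sum>i\<in>{s..<e}. of_bool (P (shift i ?x))) - q * sum (visit ?x) {s..<e}) / Q" for s e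
        unfolding f_def by (simp add: sum_divide_distrib[symmetric] sum_subtractf sum_distrib_left)
      show ?case
      proof (intro allI impI)
        fix s e :: int assume se: "s \<le> e"
        let ?v = "sum (visit ?x) {s..<e}" and ?g = "\<Sum>i\<in>{s..<e}. of_bool (gap_end (R (Suc n)) ?x i) :: real"
        have v0: "?v \<ge> 0" by (intro sum_nonneg) simp
        have "\<bar>sum f {s..<e}\<bar> \<le> ((1/2) ^ n / Q) * ?v + (S * c / Q) * ?g + real_of_int (2 * int h)"
        proof (rule sum_over_blocks[OF _ _ _ _ _ _ _ se])
          fix i
          show "\<bar>f i\<bar> \<le> visit ?x i"
          proof (cases "?x i = 1")
            case True
            then have "\<not> P (shift i ?x)" using P1[of "shift i ?x"] by (auto simp: shift_def)
            then show ?thesis using True by (simp add: f_def visit_def)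
          next
            case False
            have "\<bar>of_bool (P (shift i ?x)) - q\<bar> \<le> Q" unfolding Q_def by (auto simp: of_bool_def abs_if)
            then show ?thesis using False Q by (simp add: f_def visit_def)
          qed
        next
          fix i assume "?x i \<noteq> 1"
          then show "\<exists>s e. block (R (Suc n)) ?x s e \<and> s \<le> i \<and> i \<le> e"
            using elim(2) name_\<pi>(2)[OF a' elim(4)] block_name[OF a' elim(4)] by simp
        next
          fix s e assume bl: "block (R (Suc n)) ?x s e"
          then show "e - s < int h" using elim(2) block_name[OF a' elim(4)] by simp
          define V where "V = factor ?x s e"
          have V: "V \<in> L (Suc n)" unfolding V_def using elim(3) occurs_block[OF bl] by blast
          have vV: "visits V = sum (visit ?x) {s..<e + 1}" unfolding V_def by (rule visits_block[OF bl])
          have v0: "visits V \<ge> 0" by (rule visits_nonneg)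
          have "\<bar>pattern_count P V - q * visits V\<bar> \<le> S * (slope n (L n) * visits V + c)"
            unfolding q_def S_def
          proof (rule pattern_count_good_word[of "L n" "R n" p "slope n (L n)" c V m P])
            show "x 0 \<noteq> 1" if "P x" for x using that by (rule P1)
          qed (use finL good[OF V] P mR(1) slope(1)[of n "L n"] c in auto)
          also have "\<dots> = (S * slope n (L n)) * visits V + S * c" by (simp add: algebra_simps)
          also have "\<dots> \<le> (1/2) ^ n * visits V + S * c"
            using Sslope v0 by (intro add_right_mono mult_right_mono) auto
          finally have main: "\<bar>pattern_count P V - q * visits V\<bar> \<le> (1/2) ^ n * visits V + S * c" .
          have "sum f {s..<e + 1} = (pattern_count P V - q * visits V) / Q"
            unfolding sumf V_def pattern_count_block[OF bl P mR(2)] visits_block[OF bl] ..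
          then have "\<bar>sum f {s..<e + 1}\<bar> = \<bar>pattern_count P V - q * visits V\<bar> / Q" using Q by simp
          also have "\<dots> \<le> ((1/2) ^ n * visits V + S * c) / Q" using main Q by (intro divide_right_mono) auto
          finally show "\<bar>sum f {s..<e + 1}\<bar> \<le> ((1/2) ^ n / Q) * sum (visit ?x) {s..<e + 1} + S * c / Q"
            unfolding vV by (simp add: add_divide_distrib)
        qed (use S c Q in auto)
        then have "Q * \<bar>sum f {s..<e}\<bar> \<le> Q * (((1/2) ^ n / Q) * ?v + (S * c / Q) * ?g + real_of_int (2 * int h))"
          using Q by (intro mult_left_mono) auto
        also have "\<dots> = (1/2) ^ n * ?v + S * (c * ?g) + Q * (2 * h)"
          using Q by (simp add: algebra_simps)
        also have "S * (c * ?g) \<le> S * (slope n (L n) * ?v + c')"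
        proof -
          have "gap_end (R (Suc n)) (name b y) i \<longleftrightarrow> gap_end (R (Suc n)) ?x i" for i
            using name_\<pi>(2)[OF a' elim(4)] by (simp add: gap_end_def del: One_nat_def)
          then show ?thesis using elim(1) se S unfolding vis by (intro mult_left_mono) auto
        qed
        also have "S * (slope n (L n) * ?v + c') = (S * slope n (L n)) * ?v + S * c'" by (simp add: algebra_simps)
        also have "(S * slope n (L n)) * ?v \<le> (1/2) ^ n * ?v" using Sslope v0 by (rule mult_right_mono)
        finally have "Q * \<bar>sum f {s..<e}\<bar> \<le> 2 * (1/2) ^ n * ?v + (S * c' + Q * (2 * h))" by (simp add: algebra_simps)
        also have "2 * (1/2) ^ n * ?v \<le> \<epsilon> * ?v" using n\<epsilon> v0 by (rule mult_right_mono)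
        finally have "Q * \<bar>sum f {s..<e}\<bar> \<le> \<epsilon> * ?v + (S * c' + Q * (2 * h))" by simp
        moreover have "Q * \<bar>sum f {s..<e}\<bar> = \<bar>(\<Sum>i\<in>{s..<e}. of_bool (P (shift i ?x))) - q * ?v\<bar>"
          unfolding sumf using Q by simp
        ultimately show "\<bar>(\<Sum>i\<in>{s..<e}. of_bool (P (shift i ?x))) - q * sum (visit (name b y)) {s..<e}\<bar>
          \<le> \<epsilon> * sum (visit (name b y)) {s..<e} + (S * c' + Q * (2 * h))" unfolding vis by simp
      qed
    qed
    then show ?thesis by blast
  qed
  have "\<exists>c. AE y in M. near_freq (\<lambda>i. P (shift i (name a' y))) (freq P a') \<epsilon> c (name b y)"
    if P: "window_determined m P" and P1: "\<forall>x. P x \<longrightarrow> x 0 \<noteq> 1" and \<epsilon>: "\<epsilon> > 0" for P m \<epsilon>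
  proof -
    \<comment> \<open>One third is the deviation from \<open>q\<close>, two thirds the distance of
      \<open>q\<close> from the true frequency.\<close>
    have \<epsilon>3: "\<epsilon> / 3 > 0" using \<epsilon> by simp
    obtain q c where qc: "AE y in M. near_freq (\<lambda>i. P (shift i (name a' y))) q (\<epsilon> / 3) c (name b y)"
      using approx[OF P _ \<epsilon>3] P1 by blast
    have fq: "\<bar>freq P a' - q\<bar> \<le> 2 * (\<epsilon> / 3)"
      by (rule freq_eqI_approx[OF a' P _ \<epsilon>3 qc]) (use P1 in blast)
    from qc have "AE y in M. near_freq (\<lambda>i. P (shift i (name a' y))) (freq P a') \<epsilon> c (name b y)"
    proof eventually_elim
      case (elim y)
      show ?case
      proof (intro allI impI)
        fix s e :: int assume se: "s \<le> e"
        let ?v = "sum (visit (name b y)) {s..<e}" and ?n = "\<Sum>i\<in>{s..<e}. of_bool (P (shift i (name a' y))) :: real"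
        have v0: "?v \<ge> 0" by (intro sum_nonneg) simp
        have 1: "\<bar>?n - q * ?v\<bar> \<le> \<epsilon> / 3 * ?v + c" using elim se by blast
        have "\<bar>(q - freq P a') * ?v\<bar> \<le> 2 * (\<epsilon> / 3) * ?v"
          unfolding abs_mult using fq v0 \<epsilon> by (intro mult_mono) (auto simp: abs_minus_commute)
        then have 2: "\<bar>q * ?v - freq P a' * ?v\<bar> \<le> 2 * (\<epsilon> / 3) * ?v" by (simp add: left_diff_distrib)
        have "\<bar>?n - freq P a' * ?v\<bar> \<le> \<bar>?n - q * ?v\<bar> + \<bar>q * ?v - freq P a' * ?v\<bar>" by linarith
        also have "\<dots> \<le> (\<epsilon> / 3 * ?v + c) + 2 * (\<epsilon> / 3) * ?v" using 1 2 by (rule add_mono)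
        also have "\<dots> = \<epsilon> * ?v + c" by (simp add: field_simps)
        finally show "\<bar>?n - freq P a' * ?v\<bar> \<le> \<epsilon> * ?v + c" .
      qed
    qed
    then show ?thesis ..
  qed
  then show ?thesis using a' close by blast
qed

end

section \<open>Partitions and labellings\<close>

lemma eq_mod0_iff_AE:
  assumes "A \<in> sets M" "B \<in> sets M"
  shows "eq_mod0 M A B \<longleftrightarrow> (AE y in M. y \<in> A \<longleftrightarrow> y \<in> B)"
proof -
  have "sym_diff A B \<in> null_sets M \<longleftrightarrow> (AE y in M. y \<notin> sym_diff A B)"
    using assms by (intro AE_iff_null_sets) auto
  also have "\<dots> \<longleftrightarrow> (AE y in M. y \<in> A \<longleftrightarrow> y \<in> B)" by (intro arg_cong[of _ _ "almost_everywhere M"]) auto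
  finally show ?thesis by (simp add: eq_mod0_def)
qed

text \<open>If \<open>W\<close> could not be split, then for each length \<open>w\<close> the
  preimage of a single interval of that length would carry all of \<open>W\<close>, so the measure
  of \<open>W\<close> would be at most every positive \<open>w\<close>.\<close>

lemma infinite_lebesgue_space_nonatomic:
  assumes M: "infinite_lebesgue_space M" and W: "W \<in> sets M" "emeasure M W > 0"
  shows "\<exists>U V. U \<in> sets M \<and> V \<in> sets M \<and> U \<subseteq> W \<and> V \<subseteq> W \<and> U \<inter> V = {} \<and> emeasure M U > 0 \<and> emeasure M V > 0"
proof (rule ccontr)
  assume no: "\<not> ?thesis"
  obtain f g where fg: "iso_mod0 M (lebesgue :: real measure) f g" using M by (auto simp: infinite_lebesgue_space_def)
  then have f: "f \<in> measurable M lebesgue" and pres: "\<And>E. E \<in> sets lebesgue \<Longrightarrow> emeasure M (f -` E \<inter> space M) = emeasure lebesgue E"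
    by (auto simp: iso_mod0_def)
  have atom: "emeasure M (W \<inter> f -` E) = 0 \<or> emeasure M (W - f -` E) = 0" if E: "E \<in> sets lebesgue" for E
  proof -
    have eq: "W \<inter> f -` E = W \<inter> (f -` E \<inter> space M)" "W - f -` E = W - (f -` E \<inter> space M)"
      using sets.sets_into_space[OF W(1)] by auto
    have "f -` E \<inter> space M \<in> sets M" using f E by (rule measurable_sets)
    then have "W \<inter> f -` E \<in> sets M" "W - f -` E \<in> sets M" unfolding eq using W(1) by auto
    moreover have "(W \<inter> f -` E) \<inter> (W - f -` E) = {}" by blast
    ultimately show ?thesis using no by (metis Diff_subset Int_lower1 zero_less_iff_neq_zero)
  qed
  have le: "emeasure M W \<le> ennreal w" if w: "w > 0" for w :: real
  proof -
    define I where "I = (\<lambda>i::int. {of_int i * w..<(of_int i + 1) * w})"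
    have Im: "I i \<in> sets lebesgue" for i by (simp add: I_def)
    have "\<exists>i. emeasure M (W \<inter> f -` I i) \<noteq> 0"
    proof (rule ccontr)
      assume "\<not> ?thesis"
      moreover have "W \<inter> f -` I i \<in> sets M" for i
      proof -
        have "W \<inter> f -` I i = W \<inter> (f -` I i \<inter> space M)" using sets.sets_into_space[OF W(1)] by auto
        then show ?thesis using measurable_sets[OF f Im] W(1) by auto
      qed
      ultimately have "(\<Union>i. W \<inter> f -` I i) \<in> null_sets M" by (intro null_sets_UN) (auto simp: null_sets_def)
      moreover have "W \<subseteq> (\<Union>i. W \<inter> f -` I i)"
      proof
        fix y assume "y \<in> W"
        moreover have "f y \<in> I \<lfloor>f y / w\<rfloor>"
        proof -
          have "of_int \<lfloor>f y / w\<rfloor> \<le> f y / w" "f y / w < of_int \<lfloor>f y / w\<rfloor> + 1" using floor_correct[of "f y / w"] by simp_all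
          from pos_le_divide_eq[OF w, THEN iffD1, OF this(1)] pos_divide_less_eq[OF w, THEN iffD1, OF this(2)]
          show ?thesis by (simp add: I_def)
        qed
        ultimately show "y \<in> (\<Union>i. W \<inter> f -` I i)" by blast
      qed
      ultimately have "W \<in> null_sets M" using null_sets_subset W(1) by blast
      then show False using W(2) by auto
    qed
    then obtain i where "emeasure M (W \<inter> f -` I i) \<noteq> 0" by blast
    then have null: "emeasure M (W - f -` I i) = 0" using atom[OF Im] by blast
    have fI: "f -` I i \<inter> space M \<in> sets M" using f Im by (rule measurable_sets)
    have sub: "W - f -` I i = W - (f -` I i \<inter> space M)" using sets.sets_into_space[OF W(1)] by auto
    have "emeasure M W \<le> emeasure M ((f -` I i \<inter> space M) \<union> (W - (f -` I i \<inter> space M)))"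
      using W(1) fI by (intro emeasure_mono) auto
    also have "\<dots> \<le> emeasure M (f -` I i \<inter> space M) + emeasure M (W - (f -` I i \<inter> space M))"
      using W(1) fI by (intro emeasure_subadditive) auto
    also have "\<dots> = emeasure lebesgue (I i)" using null pres[OF Im] by (simp add: sub)
    also have "\<dots> = ennreal w" unfolding I_def using w by (simp add: algebra_simps)
    finally show ?thesis .
  qed
  have "emeasure M W \<le> 0"
  proof (rule ennreal_le_epsilon)
    show "emeasure M W \<le> 0 + ennreal e" if "0 < e" for e using le[OF that] by simp
  qed
  then show False using W(2) by simp
qed

text \<open>Atoms are disjoint and cover the space only up to null sets. The least index decides in
  overlaps, and 1 is the default elsewhere, so that the label is in range at every point.\<close>

lemma finite_partition_label:
  assumes "finite_partition M N A"
  shows "\<exists>a. a \<in> measurable M (count_space UNIV) \<and> (\<forall>y. a y \<in> {1..N}) \<and> (AE y in M. \<forall>i\<in>{1..N}. y \<in> A i \<longleftrightarrow> a y = i)"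
proof -
  have N: "2 \<le> N" and Am: "\<And>i. i \<in> {1..N} \<Longrightarrow> A i \<in> sets M"
    and disj: "\<And>i j. i \<in> {1..N} \<Longrightarrow> j \<in> {1..N} \<Longrightarrow> i \<noteq> j \<Longrightarrow> A i \<inter> A j \<in> null_sets M"
    and cover: "space M - (\<Union>i\<in>{1..N}. A i) \<in> null_sets M"
    using assms unfolding finite_partition_def by blast+
  define ex where "ex = (\<lambda>y. \<exists>i\<in>{1..N}. y \<in> A i)"
  define a where "a = (\<lambda>y. if ex y then (LEAST i. i \<in> {1..N} \<and> y \<in> A i) else 1)"
  have a_ex: "a y \<in> {1..N} \<and> y \<in> A (a y)" if "ex y" for y
  proof -
    have "\<exists>i. i \<in> {1..N} \<and> y \<in> A i" using that by (auto simp: ex_def)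
    from LeastI_ex[OF this] show ?thesis using that by (simp only: a_def if_True)
  qed
  have a_eq: "a y = l \<longleftrightarrow> (ex y \<and> l \<in> {1..N} \<and> y \<in> A l \<and> (\<forall>i\<in>{1..N}. i < l \<longrightarrow> y \<notin> A i)) \<or> (\<not> ex y \<and> l = 1)" for y l
  proof (cases "ex y")
    case True
    have "i \<ge> a y" if "i \<in> {1..N}" "y \<in> A i" for i
      using True that Least_le[of "\<lambda>i. i \<in> {1..N} \<and> y \<in> A i" i] by (simp add: a_def)
    then show ?thesis using a_ex[OF True] True by (metis linorder_neqE_nat not_less)
  qed (auto simp: a_def)
  have Apred: "Measurable.pred M (\<lambda>y. y \<in> A i)" if "i \<in> {1..N}" for i using Am[OF that] by measurable
  have exm [measurable]: "Measurable.pred M ex" unfolding ex_def by (intro pred_intros_finite Apred) auto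
  have "a \<in> measurable M (count_space UNIV)"
  proof (subst measurable_count_space_eq2_countable, intro conjI ballI)
    fix l :: nat
    have "Measurable.pred M (\<lambda>y. a y = l)"
    proof (cases "l \<in> {1..N}")
      case True
      have "Measurable.pred M (\<lambda>y. \<forall>i\<in>{1..N}. i < l \<longrightarrow> y \<notin> A i)"
        by (intro pred_intros_finite pred_intros_logic Apred) auto
      then have "Measurable.pred M (\<lambda>y. ex y \<and> y \<in> A l \<and> (\<forall>i\<in>{1..N}. i < l \<longrightarrow> y \<notin> A i))"
        by (rule pred_intros_logic(3)[OF exm pred_intros_logic(3)[OF Apred[OF True]]])
      then have "Measurable.pred M (\<lambda>y. (ex y \<and> y \<in> A l \<and> (\<forall>i\<in>{1..N}. i < l \<longrightarrow> y \<notin> A i)) \<or> (\<not> ex y \<and> l = 1))"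
        by (cases "l = 1") simp_all
      moreover have "a y = l \<longleftrightarrow> (ex y \<and> y \<in> A l \<and> (\<forall>i\<in>{1..N}. i < l \<longrightarrow> y \<notin> A i)) \<or> (\<not> ex y \<and> l = 1)" for y
        unfolding a_eq using True by blast
      ultimately show ?thesis by (simp only:)
    next
      case False
      then have "a y = l \<longleftrightarrow> \<not> ex y \<and> l = 1" for y unfolding a_eq by blast
      then show ?thesis by simp
    qed
    then have "{y\<in>space M. a y = l} \<in> sets M" by (simp add: pred_def)
    also have "{y\<in>space M. a y = l} = a -` {l} \<inter> space M" by auto
    finally show "a -` {l} \<inter> space M \<in> sets M" .
  qed auto
  moreover have "a y \<in> {1..N}" for y 
  proof (cases "ex y")
    case True then show ?thesis using a_ex by blast
  next
    case False
    then have "a y = 1" unfolding a_def by (rule if_not_P)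
    then show ?thesis using N by simp
  qed
  moreover have "AE y in M. \<forall>i\<in>{1..N}. y \<in> A i \<longleftrightarrow> a y = i"
  proof -
    have "AE y in M. \<forall>i\<in>{1..N}. \<forall>j\<in>{1..N}. i \<noteq> j \<longrightarrow> y \<notin> A i \<inter> A j"
    proof (intro AE_finite_allI)
      fix i j assume ij: "i \<in> {1..N}" "j \<in> {1..N}"
      show "AE y in M. i \<noteq> j \<longrightarrow> y \<notin> A i \<inter> A j"
      proof (cases "i = j")
        case False
        from AE_not_in[OF disj[OF ij False]] show ?thesis by eventually_elim blast
      qed simp
    qed simp_all
    moreover have "AE y in M. y \<notin> space M - (\<Union>i\<in>{1..N}. A i)" using cover by (rule AE_not_in)
    ultimately show ?thesis using AE_space
    proof eventually_elim
      case (elim y)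
      then have "ex y" by (auto simp: ex_def)
      then show ?case using a_ex[of y] elim(1) by blast
    qed
  qed
  ultimately show ?thesis by blast
qed

text \<open>Needed in \<open>atoms_uniform_partition\<close>, where a cylinder is recentred at a
  time at which it demands a visit and the windows shift accordingly.\<close>

lemma sum_visit_shift_diff:
  assumes "a \<le> b"
  shows "\<bar>sum (visit x) {a + t..<b + t} - sum (visit x) {a..<b}\<bar> \<le> \<bar>real_of_int t\<bar>"
proof -
  have bnd: "0 \<le> sum (visit x) {c..<d}" "sum (visit x) {c..<d} \<le> d - c" if "c \<le> d" for c d
    using sum_abs_le_length[of "visit x" x c d] that by (auto intro!: sum_nonneg)
  show ?thesis
  proof (cases "t \<ge> 0")
    case True
    have "sum (visit x) {a..<b + t} = sum (visit x) {a..<a + t} + sum (visit x) {a + t..<b + t}"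
      using assms True by (intro sum_int_split) auto
    moreover have "sum (visit x) {a..<b + t} = sum (visit x) {a..<b} + sum (visit x) {b..<b + t}"
      using assms True by (intro sum_int_split) auto
    ultimately show ?thesis using bnd[of a "a + t"] bnd[of b "b + t"] True by simp
  next
    case False
    have "sum (visit x) {a + t..<b} = sum (visit x) {a + t..<a} + sum (visit x) {a..<b}"
      using assms False by (intro sum_int_split) auto
    moreover have "sum (visit x) {a + t..<b} = sum (visit x) {a + t..<b + t} + sum (visit x) {b + t..<b}"
      using assms False by (intro sum_int_split) auto
    ultimately show ?thesis using bnd[of "a + t" a] bnd[of "b + t" b] False by simp
  qed
qed

lemma in_iterated_join_iff:
  "C \<in> iterated_join M T S N A m n \<longleftrightarrow>
    (\<exists>t. (\<forall>i\<in>{m..n}. t i \<in> {1..N}) \<and> C = (\<Inter>i\<in>{m..n}. iter T S i -` A (t i) \<inter> space M))"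
proof
  assume "C \<in> iterated_join M T S N A m n"
  then obtain s where s: "\<forall>i\<in>{m..n}. s i \<in> (\<lambda>j. iter T S i -` A j \<inter> space M) ` {1..N}" "C = (\<Inter>i\<in>{m..n}. s i)"
    by (auto simp: iterated_join_def joins_def)
  then have "\<forall>i\<in>{m..n}. \<exists>j. j \<in> {1..N} \<and> s i = iter T S i -` A j \<inter> space M" by blast
  from bchoice[OF this] obtain t where t: "\<forall>i\<in>{m..n}. t i \<in> {1..N} \<and> s i = iter T S i -` A (t i) \<inter> space M" by blast
  then have "C = (\<Inter>i\<in>{m..n}. iter T S i -` A (t i) \<inter> space M)" using s(2) by simp
  then show "\<exists>t. (\<forall>i\<in>{m..n}. t i \<in> {1..N}) \<and> C = (\<Inter>i\<in>{m..n}. iter T S i -` A (t i) \<inter> space M)" using t by blast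
next
  assume "\<exists>t. (\<forall>i\<in>{m..n}. t i \<in> {1..N}) \<and> C = (\<Inter>i\<in>{m..n}. iter T S i -` A (t i) \<inter> space M)"
  then show "C \<in> iterated_join M T S N A m n" unfolding iterated_join_def joins_def by blast
qed

section \<open>From a pair of partitions to labels\<close>

locale partition_pair =
  fixes M :: "'a measure" and T S :: "'a \<Rightarrow> 'a" and n k :: nat and B A0 :: "nat \<Rightarrow> 'a set"
  assumes mps: "infinite_mps M T S" and erg: "ergodic M T"
    and B: "finite_partition M n B" and B_uniform: "uniform_partition M T S n B (finite_part M B)"
    and A0: "finite_partition M k A0" and A0_finer: "strongly_finer M k A0 n B"
begin

sublocale ergodic_system M T S
proof
  have iso: "iso_mod0 M M T S" and leb: "infinite_lebesgue_space M" using mps by (auto simp: infinite_mps_def)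
  show "T \<in> measurable M M" "S \<in> measurable M M" "AE y in M. S (T y) = y" "AE y in M. T (S y) = y"
    using iso by (auto simp: iso_mod0_def)
  show "emeasure M (T -` E \<inter> space M) = emeasure M E" if "E \<in> sets M" for E
    using iso that by (auto simp: iso_mod0_def)
  show "ergodic M T" by (rule erg)
  show "\<exists>U V. U \<in> sets M \<and> V \<in> sets M \<and> U \<subseteq> W \<and> V \<subseteq> W \<and> U \<inter> V = {} \<and> emeasure M U > 0 \<and> emeasure M V > 0"
    if "W \<in> sets M" "emeasure M W > 0" for W
    using infinite_lebesgue_space_nonatomic[OF leb that] .
qed

lemma partition_sizes: "2 \<le> n" "2 \<le> k" using A0 B by (auto simp: finite_partition_def)

lemma sets_B: "j \<in> {1..n} \<Longrightarrow> B j \<in> sets M" and sets_A0: "i \<in> {1..k} \<Longrightarrow> A0 i \<in> sets M"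
  using A0 B by (auto simp: finite_partition_def)

lemma A0_pos: "i \<in> {1..k} \<Longrightarrow> 0 < emeasure M (A0 i)"
  using A0 unfolding finite_partition_def by blast

text \<open>Refinement gives, for each atom of \<open>B\<close>, a set of indices of atoms of
  \<open>A0\<close>. It becomes a map of indices because atoms have positive measure: for every
  index there is a point with that label at which all almost sure relations hold, and \<pi> is read
  off there. Equality of the finite parts matches index 1 with index 1.\<close>

lemma labels_exist:
  "\<exists>a \<pi>. a \<in> measurable M (count_space UNIV) \<and> (\<forall>y. a y \<in> {1..k}) \<and>
    (AE y in M. \<forall>i\<in>{1..k}. y \<in> A0 i \<longleftrightarrow> a y = i) \<and>
    (\<forall>l. \<pi> l = 1 \<longleftrightarrow> l = 1) \<and> (\<forall>l\<in>{1..k}. \<pi> l \<in> {1..n}) \<and> (\<forall>l. l \<notin> {1..k} \<longrightarrow> \<pi> l \<notin> {1..n}) \<and>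
    (AE y in M. \<forall>j\<in>{1..n}. y \<in> B j \<longleftrightarrow> \<pi> (a y) = j)"
proof -
  obtain a where a: "a \<in> measurable M (count_space UNIV)" "\<And>y. a y \<in> {1..k}" and aA: "AE y in M. \<forall>i\<in>{1..k}. y \<in> A0 i \<longleftrightarrow> a y = i"
    using finite_partition_label[OF A0] by blast
  obtain b0 where b0: "\<And>y. b0 y \<in> {1..n}" and bB: "AE y in M. \<forall>j\<in>{1..n}. y \<in> B j \<longleftrightarrow> b0 y = j"
    using finite_partition_label[OF B] by blast
  have "\<forall>j\<in>{1..n}. \<exists>J. J \<subseteq> {1..k} \<and> eq_mod0 M (B j) (\<Union>i\<in>J. A0 i)"
    using A0_finer unfolding strongly_finer_def finer_def by blast
  from bchoice[OF this] obtain J where J: "\<And>j. j \<in> {1..n} \<Longrightarrow> J j \<subseteq> {1..k} \<and> eq_mod0 M (B j) (\<Union>i\<in>J j. A0 i)" by blast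
  have "AE y in M. \<forall>j\<in>{1..n}. y \<in> B j \<longleftrightarrow> y \<in> (\<Union>i\<in>J j. A0 i)"
  proof (rule AE_finite_allI)
    fix j assume j: "j \<in> {1..n}"
    have "(\<Union>i\<in>J j. A0 i) \<in> sets M"
      using J[OF j] by (intro sets.finite_UN sets_A0) (auto intro: finite_subset)
    then show "AE y in M. y \<in> B j \<longleftrightarrow> y \<in> (\<Union>i\<in>J j. A0 i)"
      using eq_mod0_iff_AE[OF sets_B[OF j]] J[OF j] by blast
  qed simp
  then have AJ: "AE y in M. \<forall>j\<in>{1..n}. b0 y = j \<longleftrightarrow> a y \<in> J j"
    using aA bB
  proof eventually_elim
    case (elim y)
    show ?case
    proof
      fix j assume j: "j \<in> {1..n}"
      have "y \<in> A0 i \<longleftrightarrow> a y = i" if "i \<in> J j" for i using elim(2) J[OF j] that by blast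
      then have "y \<in> (\<Union>i\<in>J j. A0 i) \<longleftrightarrow> a y \<in> J j" by auto
      then show "b0 y = j \<longleftrightarrow> a y \<in> J j" using elim(1,3) j by blast
    qed
  qed
  have "eq_mod0 M (finite_part M A0) (finite_part M B)" using A0_finer by (simp add: strongly_finer_def)
  moreover have "A0 1 \<in> sets M" "B 1 \<in> sets M" using sets_A0[of 1] sets_B[of 1] partition_sizes by auto
  ultimately have "AE y in M. y \<in> finite_part M A0 \<longleftrightarrow> y \<in> finite_part M B"
    by (subst (asm) eq_mod0_iff_AE) (auto simp: finite_part_def)
  then have A1: "AE y in M. a y = 1 \<longleftrightarrow> b0 y = 1"
    using aA bB AE_space
  proof eventually_elim
    case (elim y)
    have "y \<in> A0 1 \<longleftrightarrow> a y = 1" using elim(2) partition_sizes by (auto dest: bspec[of _ _ 1])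
    moreover have "y \<in> B 1 \<longleftrightarrow> b0 y = 1" using elim(3) partition_sizes by (auto dest: bspec[of _ _ 1])
    ultimately show ?case using elim(1,4) by (auto simp: finite_part_def)
  qed
  have ex_j: "\<exists>j. j \<in> {1..n} \<and> (j = 1 \<longleftrightarrow> i = 1) \<and> (AE y in M. a y = i \<longrightarrow> b0 y = j)" if i: "i \<in> {1..k}" for i
  proof -
    have "\<not> (AE y in M. a y \<noteq> i)"
    proof
      assume "AE y in M. a y \<noteq> i"
      then have "AE y in M. y \<notin> A0 i" using aA by eventually_elim (use i in blast)
      then have "emeasure M (A0 i) = 0" using AE_iff_null_sets[OF sets_A0[OF i]] by (auto simp: null_sets_def)
      then show False using A0_pos[OF i] by simp
    qed
    moreover have "AE y in M. a y \<noteq> i" if "\<forall>y. \<not> (a y = i \<and> (\<forall>j\<in>{1..n}. b0 y = j \<longleftrightarrow> a y \<in> J j) \<and> (a y = 1 \<longleftrightarrow> b0 y = 1))"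
      using AJ A1 by eventually_elim (use that in blast)
    ultimately obtain y0 where y0: "a y0 = i" "\<forall>j\<in>{1..n}. b0 y0 = j \<longleftrightarrow> a y0 \<in> J j" "a y0 = 1 \<longleftrightarrow> b0 y0 = 1" by blast
    have iJ: "i \<in> J (b0 y0)" using y0 b0 by blast
    have "AE y in M. a y = i \<longrightarrow> b0 y = b0 y0"
      using AJ by eventually_elim (use iJ b0 in blast)
    then show ?thesis using y0 b0 by (intro exI[of _ "b0 y0"]) auto
  qed
  then have "\<forall>i\<in>{1..k}. \<exists>j. j \<in> {1..n} \<and> (j = 1 \<longleftrightarrow> i = 1) \<and> (AE y in M. a y = i \<longrightarrow> b0 y = j)" by blast
  from bchoice[OF this] obtain p where p: "\<And>i. i \<in> {1..k} \<Longrightarrow> p i \<in> {1..n} \<and> (p i = 1 \<longleftrightarrow> i = 1) \<and> (AE y in M. a y = i \<longrightarrow> b0 y = p i)"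
    by blast
  (* n + 2 keeps the indices outside 1..k from lying over an atom of B *)
  define \<pi> where "\<pi> = (\<lambda>l. if l \<in> {1..k} then p l else n + 2)"
  have "AE y in M. \<forall>i\<in>{1..k}. a y = i \<longrightarrow> b0 y = p i" using p by (intro AE_finite_allI) auto
  then have "AE y in M. \<forall>j\<in>{1..n}. y \<in> B j \<longleftrightarrow> \<pi> (a y) = j"
    using bB
  proof eventually_elim
    case (elim y)
    have "b0 y = p (a y)" using elim(1) a(2)[of y] by blast
    moreover have "\<pi> (a y) = p (a y)" unfolding \<pi>_def using a(2)[of y] by (rule if_P)
    ultimately show ?case using elim(2) by simp
  qed
  moreover have "\<pi> l = 1 \<longleftrightarrow> l = 1" for l
  proof (cases "l \<in> {1..k}")
    case True
    then have "\<pi> l = p l" by (simp add: \<pi>_def)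
    then show ?thesis using p[OF True] by simp
  next
    case False
    then have "\<pi> l = n + 2" unfolding \<pi>_def by (rule if_not_P)
    moreover have "l \<noteq> 1" using False partition_sizes by auto
    ultimately show ?thesis by simp
  qed
  moreover have "\<forall>l\<in>{1..k}. \<pi> l \<in> {1..n}" "\<forall>l. l \<notin> {1..k} \<longrightarrow> \<pi> l \<notin> {1..n}"
    using p by (auto simp: \<pi>_def)
  ultimately show ?thesis using a aA by (intro exI[of _ a] exI[of _ \<pi>]) blast
qed

end

locale labelled_partition_pair = partition_pair +
  fixes a :: "'a \<Rightarrow> nat" and \<pi> :: "nat \<Rightarrow> nat"
  assumes a [measurable]: "a \<in> measurable M (count_space UNIV)" and a_range: "\<And>y. a y \<in> {1..k}"
    and a_A0: "AE y in M. \<forall>i\<in>{1..k}. y \<in> A0 i \<longleftrightarrow> a y = i"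
    and \<pi>1: "\<And>l. \<pi> l = 1 \<longleftrightarrow> l = 1" and \<pi>_in: "\<And>l. l \<in> {1..k} \<Longrightarrow> \<pi> l \<in> {1..n}"
    and \<pi>_out: "\<And>l. l \<notin> {1..k} \<Longrightarrow> \<pi> l \<notin> {1..n}"
    and a_B: "AE y in M. \<forall>j\<in>{1..n}. y \<in> B j \<longleftrightarrow> \<pi> (a y) = j"
begin

text \<open>Defined through \<open>a\<close> and not through \<open>B\<close>, so that the relation
  demanded by \<open>labelling\<close> holds at every point; \<open>B\<close> is described by it
  almost everywhere.\<close>

definition b :: "'a \<Rightarrow> nat" where "b y = \<pi> (a y)"

lemma measurable_b [measurable]: "b \<in> measurable M (count_space UNIV)"
  unfolding b_def[abs_def] by (rule measurable_compose[OF a]) simp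

lemma b_range: "b y \<in> {1..n}"
  unfolding b_def by (rule \<pi>_in[OF a_range])

definition Kb :: "'a set" where "Kb = {y\<in>space M. b y \<noteq> 1}"

lemma Kb_sets [measurable]: "Kb \<in> sets M"
  unfolding Kb_def by measurable

lemma b_1: "b y = 1 \<longleftrightarrow> a y = 1"
  unfolding b_def by (rule \<pi>1)

lemma Kb_pos: "emeasure M Kb > 0"
proof -
  \<comment> \<open>A partition has at least two atoms; atom 2 lies in the finite part and has
    positive measure.\<close>
  have 2: "2 \<in> {1..k}" using partition_sizes by simp
  have "emeasure M (A0 2) \<le> emeasure M Kb"
  proof (rule emeasure_mono_AE)
    show "AE y in M. y \<in> A0 2 \<longrightarrow> y \<in> Kb"
      using a_A0 AE_space
    proof eventually_elim
      case (elim y)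
      show ?case
      proof
        assume "y \<in> A0 2"
        then have "a y = 2" using elim(1) 2 by blast
        then show "y \<in> Kb" using elim(2) b_1[of y] by (simp add: Kb_def)
      qed
    qed
  qed measurable
  then show ?thesis using A0_pos[OF 2] by (meson less_le_trans)
qed

lemma Kb_fin: "emeasure M Kb < \<infinity>"
proof -
  have "emeasure M Kb \<le> emeasure M (\<Union>i\<in>{2..k}. A0 i)"
  proof (rule emeasure_mono_AE)
    show "AE y in M. y \<in> Kb \<longrightarrow> y \<in> (\<Union>i\<in>{2..k}. A0 i)"
      using a_A0
    proof eventually_elim
      case (elim y)
      show ?case
      proof
        assume "y \<in> Kb"
        then have "a y \<noteq> 1" using b_1[of y] by (simp add: Kb_def)
        moreover have "y \<in> A0 (a y)" using elim a_range by blast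
        moreover have "a y \<in> {2..k}" using a_range[of y] \<open>a y \<noteq> 1\<close> by auto
        ultimately show "y \<in> (\<Union>i\<in>{2..k}. A0 i)" by blast
      qed
    qed
    show "(\<Union>i\<in>{2..k}. A0 i) \<in> sets M" by (intro sets.finite_UN sets_A0) auto
  qed
  also have "\<dots> \<le> (\<Sum>i\<in>{2..k}. emeasure M (A0 i))"
  proof (rule emeasure_subadditive_finite)
    show "A0 ` {2..k} \<subseteq> sets M" by (intro image_subsetI sets_A0) auto
  qed simp
  also have "\<dots> < \<infinity>" using A0 by (auto simp: finite_partition_def less_top[symmetric])
  finally show ?thesis .
qed

lemma space_inf: "emeasure M (space M) = \<infinity>"
proof -
  have 1: "1 \<in> {1..k}" using partition_sizes by simp
  have "emeasure M (A0 1) = \<infinity>" using A0 by (simp add: finite_partition_def)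
  moreover have "emeasure M (A0 1) \<le> emeasure M (space M)"
    using sets_A0[OF 1] sets.sets_into_space by (intro emeasure_mono) auto
  ultimately show ?thesis by (simp add: top_unique)
qed

lemma finite_part_B: "AE y in M. y \<in> finite_part M B \<longleftrightarrow> y \<in> Kb"
  using a_B AE_space
proof eventually_elim
  case (elim y)
  have "1 \<in> {1..n}" using partition_sizes by simp
  then have "y \<in> B 1 \<longleftrightarrow> b y = 1" using elim(1) by (simp add: b_def del: One_nat_def)
  then show ?case using elim(2) by (simp add: finite_part_def Kb_def)
qed

lemma sets_finite_part_B [measurable]: "finite_part M B \<in> sets M"
  using sets_B[of 1] partition_sizes by (simp add: finite_part_def)

lemma measure_finite_part_B: "measure M (finite_part M B) = measure M Kb"
  by (rule measure_eq_AE[OF finite_part_B]) measurable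

text \<open>The window is that of the two-sided joins and of \<open>two_sided_sum\<close>, one step
  shorter on the right.\<close>

definition cyl :: "nat \<Rightarrow> (int \<Rightarrow> nat) \<Rightarrow> (int \<Rightarrow> nat) \<Rightarrow> bool" where
  "cyl N t x \<longleftrightarrow> (\<forall>i\<in>{- int N..int N - 1}. x i = t i)"

lemma AE_visit_two_sided:
  "AE y in M. \<forall>i N. two_sided_sum T S N (indicator (finite_part M B)) (orb i y) = sum (visit (name b y)) {i - int N..<i + int N}"
  using AE_orb[OF finite_part_B] AE_orb_add AE_space
proof eventually_elim
  case (elim y)
  show ?case
  proof (intro allI)
    fix i N
    have "two_sided_sum T S N (indicator (finite_part M B)) (orb i y) = (\<Sum>j\<in>{- int N..<int N}. visit (name b y) (i + j))"
      unfolding two_sided_sum_def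
    proof (rule sum.cong)
      fix j
      have "orb j (orb i y) = orb (i + j) y" using elim(2) by (simp add: add.commute)
      then show "indicator (finite_part M B) (orb j (orb i y)) = visit (name b y) (i + j)"
        using elim(1) measurable_space[OF measurable_orb elim(3)]
        by (simp add: indicator_def visit_def name_def Kb_def of_bool_def)
    qed auto
    also have "\<dots> = sum (visit (name b y)) {i - int N..<i + int N}" by (simp add: sum_int_shift)
    finally show "two_sided_sum T S N (indicator (finite_part M B)) (orb i y) = sum (visit (name b y)) {i - int N..<i + int N}" .
  qed
qed

text \<open>Uniformity speaks of windows centred at a point of the finite part. Applied to all
  iterates of a point, it covers all windows along its orbit that are centred at a visit, which is
  what \<open>interval_deviation_of_windows\<close> takes as input.\<close>

lemma cylinder_interval_deviation:
  assumes N: "N \<ge> 1" and t: "\<And>i. i \<in> {- int N..int N - 1} \<Longrightarrow> t i \<in> {1..n}" and t0: "t 0 \<noteq> 1" and \<epsilon>: "\<epsilon> > 0"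
  shows "\<exists>c\<ge>0. AE y in M. near_freq (\<lambda>i. cyl N t (shift i (name b y))) (measure M {y\<in>space M. cyl N t (name b y)} / measure M Kb) \<epsilon> c (name b y)"
proof -
  define C where "C = (\<Inter>i\<in>{- int N..int N - 1}. orb i -` B (t i) \<inter> space M)"
  define D where "D = {y\<in>space M. cyl N t (name b y)}"
  define p where "p = measure M D / measure M Kb"
  have [measurable]: "Measurable.pred M (\<lambda>y. cyl N t (name b y))" unfolding cyl_def by measurable
  have Dm [measurable]: "D \<in> sets M" unfolding D_def by measurable
  have "orb i -` B (t i) \<inter> space M \<in> sets M" if "i \<in> {- int N..int N - 1}" for i
    using measurable_sets[OF measurable_orb sets_B[OF t[OF that]]] .
  then have Cm [measurable]: "C \<in> sets M" unfolding C_def using N by (intro sets.finite_INT) auto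
  have CD: "AE y in M. y \<in> C \<longleftrightarrow> y \<in> D"
    using AE_orb[OF a_B] AE_space
  proof eventually_elim
    case (elim y)
    have "orb i y \<in> B (t i) \<longleftrightarrow> name b y i = t i" if "i \<in> {- int N..int N - 1}" for i
      using elim(1) t[OF that] by (simp add: name_def b_def)
    then show ?case using elim(2) N unfolding C_def D_def cyl_def by auto
  qed
  have zero: "0 \<in> {- int N..int N - 1}" using N by simp
  have DK: "D \<subseteq> Kb"
  proof
    fix y assume "y \<in> D"
    then have "y \<in> space M" "name b y 0 = t 0" using zero by (auto simp: D_def cyl_def)
    then show "y \<in> Kb" using t0 by (simp add: Kb_def name_def)
  qed
  have eD: "emeasure M D \<le> emeasure M Kb" using DK by (intro emeasure_mono) auto
  then have Dfin: "emeasure M D < \<infinity>" using Kb_fin by (rule le_less_trans)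
  have mK: "measure M Kb > 0" using Kb_pos Kb_fin by (simp add: measure_def enn2real_positive_iff less_top)
  have p: "0 \<le> p" "p \<le> 1"
  proof -
    have "measure M D \<le> measure M Kb" unfolding measure_def using eD Kb_fin by (intro enn2real_mono) (auto simp: less_top)
    then show "p \<le> 1" using mK by (simp add: p_def)
  qed (simp add: p_def)
  have orb_D: "AE y in M. \<forall>i. orb i y \<in> D \<longleftrightarrow> cyl N t (shift i (name b y))"
    using AE_name_orb[of b] AE_space
  proof eventually_elim
    case (elim y)
    show ?case using elim(1) measurable_space[OF measurable_orb elim(2)] by (simp add: D_def)
  qed
  show ?thesis
  proof (cases "emeasure M D = 0")
    \<comment> \<open>Uniformity says nothing about null cylinders, but almost every orbit avoids
      them.\<close>
    case True
    then have "AE y in M. y \<notin> D" using AE_iff_null_sets[OF Dm] by (auto simp: null_sets_def)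
    then have "AE y in M. \<forall>i. orb i y \<notin> D" by (rule AE_orb)
    then have "AE y in M. \<forall>i. \<not> cyl N t (shift i (name b y))" using orb_D by eventually_elim blast
    then have "AE y in M. near_freq (\<lambda>i. cyl N t (shift i (name b y))) p \<epsilon> 0 (name b y)"
    proof eventually_elim
      case (elim y)
      have "p = 0" using True by (simp add: p_def measure_def)
      then show ?case using elim \<epsilon> by (auto intro!: mult_nonneg_nonneg sum_nonneg)
    qed
    then show ?thesis unfolding p_def D_def by blast
  next
    case False
    have eCD: "emeasure M C = emeasure M D" by (rule emeasure_eq_AE[OF CD Cm Dm])
    have "C \<in> iterated_join M T S n B (- int N) (int N - 1)"
      unfolding in_iterated_join_iff C_def using t by blast
    moreover have "C \<in> pos_finite_sets M" using False Dfin by (simp add: pos_finite_sets_def Cm eCD zero_less_iff_neq_zero)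
    ultimately have "uniform_set M T S C (finite_part M B)" using B_uniform N unfolding uniform_partition_def by blast
    then have un: "\<forall>\<epsilon>>0. \<exists>m::nat. AE y in M. y \<in> finite_part M B \<longrightarrow>
        (\<forall>N. two_sided_sum T S N (indicator (finite_part M B)) y \<ge> real m \<longrightarrow>
           \<bar>two_sided_sum T S N (indicator C) y / two_sided_sum T S N (indicator (finite_part M B)) y
              - measure M C / measure M (finite_part M B)\<bar> < \<epsilon>)"
      by (simp add: uniform_set_def)
    have pC: "measure M C / measure M (finite_part M B) = p"
      unfolding p_def measure_finite_part_B using measure_eq_AE[OF CD Cm Dm] by simp
    \<comment> \<open>The tolerances form a countable family, so one null set serves for all of
      them.\<close>
    have "\<forall>j::nat. \<exists>m::nat. AE y in M. y \<in> finite_part M B \<longrightarrow>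
        (\<forall>N. two_sided_sum T S N (indicator (finite_part M B)) y \<ge> real m \<longrightarrow>
           \<bar>two_sided_sum T S N (indicator C) y / two_sided_sum T S N (indicator (finite_part M B)) y - p\<bar> < 1 / Suc j)"
      using un unfolding pC by simp
    from choice[OF this] obtain m :: "nat \<Rightarrow> nat" where "\<And>j. AE y in M. y \<in> finite_part M B \<longrightarrow>
        (\<forall>N. two_sided_sum T S N (indicator (finite_part M B)) y \<ge> real (m j) \<longrightarrow>
           \<bar>two_sided_sum T S N (indicator C) y / two_sided_sum T S N (indicator (finite_part M B)) y - p\<bar> < 1 / Suc j)"
      by blast
    then have "AE y in M. \<forall>j. y \<in> finite_part M B \<longrightarrow>
        (\<forall>N. two_sided_sum T S N (indicator (finite_part M B)) y \<ge> real (m j) \<longrightarrow>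
           \<bar>two_sided_sum T S N (indicator C) y / two_sided_sum T S N (indicator (finite_part M B)) y - p\<bar> < 1 / Suc j)"
      by (intro AE_all_countable[THEN iffD2] allI)
    note all = AE_orb[OF this]
    define d where "d = (\<lambda>y i. of_bool (cyl N t (shift i (name b y))) - p * visit (name b y) i)"
    define G where "G = (\<lambda>y. \<forall>j i N. visit (name b y) i = 1 \<longrightarrow> sum (visit (name b y)) {i - int N..<i + int N} \<ge> real (m j) \<longrightarrow>
      \<bar>sum (d y) {i - int N..<i + int N}\<bar> \<le> 1 / Suc j * sum (visit (name b y)) {i - int N..<i + int N})"
    have cyl_visit: "x i \<noteq> 1" if "cyl N t (shift i x)" for x i
    proof -
      have "shift i x 0 = t 0" using that zero unfolding cyl_def by blast
      then show ?thesis using t0 by (simp add: shift_def)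
    qed
    have dk: "\<bar>d y i\<bar> \<le> visit (name b y) i" for y i
      using p cyl_visit[of i "name b y"] by (auto simp: d_def visit_def of_bool_def)
    have "AE y in M. G y"
      using all AE_visit_two_sided orb_D AE_orb[OF CD] AE_orb[OF finite_part_B] AE_orb_add AE_space
    proof eventually_elim
      case (elim y)
      show ?case unfolding G_def
      proof (intro allI impI)
        fix j i N' assume vi: "visit (name b y) i = 1" and ge: "sum (visit (name b y)) {i - int N'..<i + int N'} \<ge> real (m j)"
        let ?v = "sum (visit (name b y)) {i - int N'..<i + int N'}"
        have v0: "?v \<ge> 0" by (intro sum_nonneg) simp
        have "orb i y \<in> Kb" using vi measurable_space[OF measurable_orb elim(7)]
          by (auto simp: visit_def Kb_def name_def)
        then have iK: "orb i y \<in> finite_part M B" using elim(5) by blast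
        have v: "two_sided_sum T S N' (indicator (finite_part M B)) (orb i y) = ?v" using elim(2) by blast
        have "two_sided_sum T S N' (indicator C) (orb i y) = (\<Sum>j\<in>{- int N'..<int N'}. of_bool (cyl N t (shift (i + j) (name b y))))"
          unfolding two_sided_sum_def
        proof (rule sum.cong)
          fix j
          have "orb j (orb i y) = orb (i + j) y" using elim(6) by (simp add: add.commute)
          then show "indicator C (orb j (orb i y)) = of_bool (cyl N t (shift (i + j) (name b y)))"
            using elim(3,4) by (simp add: indicator_def of_bool_def)
        qed auto
        also have "\<dots> = (\<Sum>j\<in>{i - int N'..<i + int N'}. of_bool (cyl N t (shift j (name b y))))"
          using sum_int_shift[of "\<lambda>j. of_bool (cyl N t (shift j (name b y)))" i "- int N'" "int N'"] by simp
        finally have c: "two_sided_sum T S N' (indicator C) (orb i y) = (\<Sum>j\<in>{i - int N'..<i + int N'}. of_bool (cyl N t (shift j (name b y))))" .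
        have sd: "sum (d y) {i - int N'..<i + int N'} = two_sided_sum T S N' (indicator C) (orb i y) - p * ?v"
          unfolding c d_def by (simp add: sum_subtractf sum_distrib_left)
        show "\<bar>sum (d y) {i - int N'..<i + int N'}\<bar> \<le> 1 / Suc j * ?v"
        \<comment> \<open>The threshold \<open>m j\<close> may be 0, so a window without visits has
          to be treated apart from the quotient.\<close>
        proof (cases "?v = 0")
          case True
          have "\<bar>sum (d y) {i - int N'..<i + int N'}\<bar> \<le> ?v"
            by (rule order_trans[OF sum_abs sum_mono]) (rule dk)
          then show ?thesis using True by simp
        next
          case False
          then have vp: "?v > 0" using v0 by simp
          have "\<bar>two_sided_sum T S N' (indicator C) (orb i y) / ?v - p\<bar> < 1 / Suc j"
            using elim(1) iK ge unfolding v[symmetric] by blast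
          then have "\<bar>two_sided_sum T S N' (indicator C) (orb i y) / ?v - p\<bar> * ?v \<le> 1 / Suc j * ?v"
            using vp by (intro mult_right_mono) auto
          also have "\<bar>two_sided_sum T S N' (indicator C) (orb i y) / ?v - p\<bar> * ?v = \<bar>(two_sided_sum T S N' (indicator C) (orb i y) / ?v - p) * ?v\<bar>"
            using v0 by (simp only: abs_mult abs_of_nonneg)
          also have "(two_sided_sum T S N' (indicator C) (orb i y) / ?v - p) * ?v = two_sided_sum T S N' (indicator C) (orb i y) - p * ?v"
            using vp by (simp add: left_diff_distrib)
          finally show ?thesis unfolding sd .
        qed
      qed
    qed
    \<comment> \<open>Collecting the pairs of all points of \<open>G\<close> makes the constant the
      same for all of them.\<close>
    define X where "X = {(visit (name b y), d y) |y. G y}"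
    have "\<exists>c\<ge>0. \<forall>(\<kappa>, d)\<in>X. \<forall>a b. a \<le> b \<longrightarrow> \<bar>sum d {a..<b}\<bar> \<le> \<epsilon> * sum \<kappa> {a..<b} + c"
    proof (rule interval_deviation_of_windows)
      show "\<kappa> i = 0 \<or> \<kappa> i = 1" if "(\<kappa>, d') \<in> X" for \<kappa> d' i using that by (auto simp: X_def visit_def)
      show "\<bar>d' i\<bar> \<le> \<kappa> i" if "(\<kappa>, d') \<in> X" for \<kappa> d' i using that dk by (auto simp: X_def)
      show "\<exists>m::nat. \<forall>(\<kappa>, d')\<in>X. \<forall>y N. \<kappa> y = 1 \<longrightarrow> sum \<kappa> {y - int N..<y + int N} \<ge> real m \<longrightarrow>
        \<bar>sum d' {y - int N..<y + int N}\<bar> \<le> \<epsilon>' * sum \<kappa> {y - int N..<y + int N}" if \<epsilon>': "\<epsilon>' > 0" for \<epsilon>'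
      proof -
        obtain j where j: "1 / Suc j < \<epsilon>'" using reals_Archimedean[OF \<epsilon>'] by (auto simp: inverse_eq_divide)
        show ?thesis
        proof (rule exI[of _ "m j"], clarify)
          fix \<kappa> d' i N' assume "(\<kappa>, d') \<in> X" and k1: "\<kappa> i = 1" "sum \<kappa> {i - int N'..<i + int N'} \<ge> real (m j)"
          then obtain y where y: "\<kappa> = visit (name b y)" "d' = d y" "G y" by (auto simp: X_def)
          then have "\<bar>sum d' {i - int N'..<i + int N'}\<bar> \<le> 1 / Suc j * sum \<kappa> {i - int N'..<i + int N'}"
            using k1 unfolding G_def by blast
          also have "\<dots> \<le> \<epsilon>' * sum \<kappa> {i - int N'..<i + int N'}"
            unfolding y using j by (intro mult_right_mono sum_nonneg) auto
          finally show "\<bar>sum d' {i - int N'..<i + int N'}\<bar> \<le> \<epsilon>' * sum \<kappa> {i - int N'..<i + int N'}" .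
        qed
      qed
    qed (rule \<epsilon>)
    then obtain c where c: "c \<ge> 0" "\<And>y a b'. G y \<Longrightarrow> a \<le> b' \<Longrightarrow> \<bar>sum (d y) {a..<b'}\<bar> \<le> \<epsilon> * sum (visit (name b y)) {a..<b'} + c"
      unfolding X_def by blast
    have "AE y in M. near_freq (\<lambda>i. cyl N t (shift i (name b y))) p \<epsilon> c (name b y)"
      using \<open>AE y in M. G y\<close>
    proof eventually_elim
      case (elim y)
      show ?case using c(2)[OF elim] by (simp add: d_def sum_subtractf sum_distrib_left)
    qed
    then show ?thesis using c(1) unfolding p_def D_def by blast
  qed
qed

end

section \<open>Uniformity of the base for finite-window events\<close>

context labelled_partition_pair begin

lemma A0_fin: "i \<in> {2..k} \<Longrightarrow> emeasure M (A0 i) < \<infinity>"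
  using A0 unfolding finite_partition_def by blast

text \<open>As \<beta> has finitely many labels, a finite-window event is a finite disjoint union of
  cylinders, whose deviations and constants add up.\<close>

lemma base_uniform:
  assumes P: "window_determined m P" and P1: "\<And>x. P x \<Longrightarrow> x 0 \<noteq> 1" and \<epsilon>: "\<epsilon> > 0"
  shows "\<exists>c\<ge>0. AE y in M. near_freq (\<lambda>i. P (shift i (name b y))) (measure M {y\<in>space M. P (name b y)} / measure M {y\<in>space M. b y \<noteq> 1}) \<epsilon> c (name b y)"
proof -
  \<comment> \<open>The window of \<open>cyl N\<close> ends at \<open>N - 1\<close>, so
    \<open>m + 1\<close> is needed to reach time \<open>m\<close>.\<close>
  define N where "N = m + 1"
  define W where "W = {- int N..int N - 1}"
  \<comment> \<open>Indexing by extensional functions makes the cylinder of a name unique; values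
    outside \<open>W\<close> do not influence \<open>P\<close>.\<close>
  define Ps where "Ps = {s \<in> PiE W (\<lambda>_. {1..n}). P s}"
  have "finite (PiE W (\<lambda>_. {1..n}))" by (intro finite_PiE) (auto simp: W_def)
  then have finPs: "finite Ps" unfolding Ps_def by (rule finite_subset[rotated]) blast
  have cyl_unique: "s = restrict x W" if "s \<in> Ps" "cyl N s x" for s x
  proof
    fix i show "s i = restrict x W i"
      using that by (cases "i \<in> W") (auto simp: Ps_def W_def cyl_def PiE_def extensional_def)
  qed
  have P_restrict: "P (restrict x W) \<longleftrightarrow> P x" for x
  proof -
    have "\<forall>i. \<bar>i\<bar> \<le> int m \<longrightarrow> restrict x W i = x i" by (auto simp: W_def N_def)
    then show ?thesis using P[unfolded window_determined_def, rule_format] by blast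
  qed
  have cyl_iff: "s \<in> Ps \<and> cyl N s x \<longleftrightarrow> P x \<and> s = restrict x W" if x: "\<And>i. x i \<in> {1..n}" for s x
  proof
    assume *: "s \<in> Ps \<and> cyl N s x"
    then have "s = restrict x W" using cyl_unique by blast
    moreover have "P s" using * by (simp add: Ps_def)
    ultimately show "P x \<and> s = restrict x W" using P_restrict by simp
  next
    assume *: "P x \<and> s = restrict x W"
    then have "s \<in> Ps" using P_restrict x by (auto simp: Ps_def)
    moreover have "cyl N s x" using * by (auto simp: cyl_def W_def)
    ultimately show "s \<in> Ps \<and> cyl N s x" ..
  qed
  have cyl_sum: "(\<Sum>s\<in>Ps. of_bool (cyl N s x)) = (of_bool (P x) :: real)" if x: "\<And>i. x i \<in> {1..n}" for x
  proof -
    have "Ps \<inter> {s. cyl N s x} = (if P x then {restrict x W} else {})" using cyl_iff[of x, OF x] by auto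
    then show ?thesis using finPs by (simp add: sum_of_bool_eq)
  qed
  have name_range: "name b y i \<in> {1..n}" "shift j (name b y) i \<in> {1..n}" for y i j
    using b_range by (simp_all add: name_def shift_def)
  define Cs where "Cs = (\<lambda>s. {y\<in>space M. cyl N s (name b y)})"
  have [measurable]: "Measurable.pred M (\<lambda>y. cyl N s (name b y))" for s unfolding cyl_def by measurable
  have Csm [measurable]: "Cs s \<in> sets M" for s unfolding Cs_def by measurable
  have s0: "s 0 \<noteq> 1" if "s \<in> Ps" for s using P1 that by (simp add: Ps_def)
  have "measure M {y\<in>space M. P (name b y)} = measure M (\<Union>s\<in>Ps. Cs s)"
  proof (rule arg_cong[of _ _ "measure M"])
    show "{y\<in>space M. P (name b y)} = (\<Union>s\<in>Ps. Cs s)"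
    proof (rule set_eqI)
      fix y show "y \<in> {y\<in>space M. P (name b y)} \<longleftrightarrow> y \<in> (\<Union>s\<in>Ps. Cs s)"
        using cyl_iff[of "name b y", OF name_range(1)] by (auto simp: Cs_def)
    qed
  qed
  also have "\<dots> = (\<Sum>s\<in>Ps. measure M (Cs s))"
  proof (rule measure_finite_Union[OF finPs])
    show "disjoint_family_on Cs Ps"
      unfolding disjoint_family_on_def
    proof (intro ballI impI)
      fix s s' assume ss': "s \<in> Ps" "s' \<in> Ps" "s \<noteq> s'"
      have "s = s'" if "y \<in> Cs s" "y \<in> Cs s'" for y
        using that cyl_unique[OF ss'(1), of "name b y"] cyl_unique[OF ss'(2), of "name b y"] by (simp add: Cs_def)
      then show "Cs s \<inter> Cs s' = {}" using ss'(3) by blast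
    qed
    show "emeasure M (Cs s) \<noteq> \<infinity>" if "s \<in> Ps" for s
    proof -
      have "Cs s \<subseteq> Kb"
      proof
        fix y assume "y \<in> Cs s"
        then have "y \<in> space M" "name b y 0 = s 0" by (auto simp: Cs_def cyl_def N_def)
        then show "y \<in> Kb" using s0[OF that] by (simp add: Kb_def name_def)
      qed
      then have "emeasure M (Cs s) \<le> emeasure M Kb" by (intro emeasure_mono) auto
      then show ?thesis using Kb_fin by (auto simp: less_top[symmetric] top_unique)
    qed
  qed auto
  finally have meas: "measure M {y\<in>space M. P (name b y)} = (\<Sum>s\<in>Ps. measure M (Cs s))" .
  define \<epsilon>' where "\<epsilon>' = \<epsilon> / (card Ps + 1)"
  have \<epsilon>': "\<epsilon>' > 0" "card Ps * \<epsilon>' \<le> \<epsilon>" using \<epsilon> by (auto simp: \<epsilon>'_def field_simps)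
  have "\<forall>s\<in>Ps. \<exists>c\<ge>0. AE y in M. near_freq (\<lambda>i. cyl N s (shift i (name b y))) (measure M (Cs s) / measure M Kb) \<epsilon>' c (name b y)"
  proof
    fix s assume s: "s \<in> Ps"
    have range: "s i \<in> {1..n}" if "i \<in> {- int N..int N - 1}" for i using s that by (auto simp: Ps_def W_def)
    have "N \<ge> 1" by (simp add: N_def)
    show "\<exists>c\<ge>0. AE y in M. near_freq (\<lambda>i. cyl N s (shift i (name b y))) (measure M (Cs s) / measure M Kb) \<epsilon>' c (name b y)"
      unfolding Cs_def using \<open>N \<ge> 1\<close> range s0[OF s] \<epsilon>'(1) by (rule cylinder_interval_deviation)
  qed
  from bchoice[OF this] obtain c where c: "\<And>s. s \<in> Ps \<Longrightarrow> c s \<ge> 0"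
    "\<And>s. s \<in> Ps \<Longrightarrow> AE y in M. near_freq (\<lambda>i. cyl N s (shift i (name b y))) (measure M (Cs s) / measure M Kb) \<epsilon>' (c s) (name b y)" by blast
  have "AE y in M. \<forall>s\<in>Ps. near_freq (\<lambda>i. cyl N s (shift i (name b y))) (measure M (Cs s) / measure M Kb) \<epsilon>' (c s) (name b y)"
    by (rule AE_finite_allI[OF finPs]) (rule c(2))
  then have "AE y in M. near_freq (\<lambda>i. P (shift i (name b y))) (measure M {y\<in>space M. P (name b y)} / measure M {y\<in>space M. b y \<noteq> 1}) \<epsilon> (sum c Ps) (name b y)"
  proof eventually_elim
    case (elim y)
    show ?case
    proof (intro allI impI)
      fix a e :: int assume ae: "a \<le> e"
      let ?v = "sum (visit (name b y)) {a..<e}"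
      have v0: "?v \<ge> 0" by (intro sum_nonneg) simp
      have "(\<Sum>i\<in>{a..<e}. of_bool (P (shift i (name b y))) :: real) = (\<Sum>i\<in>{a..<e}. \<Sum>s\<in>Ps. of_bool (cyl N s (shift i (name b y))))"
      proof (rule sum.cong[OF refl])
        fix i show "of_bool (P (shift i (name b y))) = (\<Sum>s\<in>Ps. of_bool (cyl N s (shift i (name b y))) :: real)"
          by (rule cyl_sum[of "shift i (name b y)", OF name_range(2), symmetric])
      qed
      also have "\<dots> = (\<Sum>s\<in>Ps. \<Sum>i\<in>{a..<e}. of_bool (cyl N s (shift i (name b y))))" by (rule sum.swap)
      finally have "(\<Sum>i\<in>{a..<e}. of_bool (P (shift i (name b y)))) - measure M {y\<in>space M. P (name b y)} / measure M Kb * ?v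
        = (\<Sum>s\<in>Ps. (\<Sum>i\<in>{a..<e}. of_bool (cyl N s (shift i (name b y)))) - measure M (Cs s) / measure M Kb * ?v)"
        unfolding meas by (simp add: sum_subtractf sum_divide_distrib sum_distrib_right)
      also have "\<bar>\<dots>\<bar> \<le> (\<Sum>s\<in>Ps. \<epsilon>' * ?v + c s)"
        by (rule order_trans[OF sum_abs sum_mono]) (use elim ae in blast)
      also have "\<dots> = (card Ps * \<epsilon>') * ?v + sum c Ps" by (simp add: sum.distrib)
      also have "\<dots> \<le> \<epsilon> * ?v + sum c Ps" using \<epsilon>'(2) v0 by (intro add_right_mono mult_right_mono)
      finally show "\<bar>(\<Sum>i\<in>{a..<e}. of_bool (P (shift i (name b y))))
        - measure M {y\<in>space M. P (name b y)} / measure M {y\<in>space M. b y \<noteq> 1} * ?v\<bar> \<le> \<epsilon> * ?v + sum c Ps"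
        by (simp only: Kb_def)
    qed
  qed
  moreover have "sum c Ps \<ge> 0" using c(1) by (intro sum_nonneg)
  ultimately show ?thesis by blast
qed

sublocale refining_labels M T S b \<pi> k
proof
  show "b \<in> measurable M (count_space UNIV)" by (rule measurable_b)
  show "0 < emeasure M {y\<in>space M. b y \<noteq> 1}" using Kb_pos by (simp only: Kb_def)
  show "emeasure M {y\<in>space M. b y \<noteq> 1} < \<infinity>" using Kb_fin by (simp only: Kb_def)
  show "emeasure M (space M) = \<infinity>" by (rule space_inf)
  show "\<pi> l = 1 \<longleftrightarrow> l = 1" for l by (rule \<pi>1)
  show "l \<le> k" if "\<pi> l = b y" for y l
    using \<pi>_out[of l] b_range[of y] that by (cases "l \<in> {1..k}") auto
qed (rule base_uniform)

lemma a_labelling: "labelling a"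
  by (simp add: labelling_def b_def)

lemma labelling_range: "labelling a' \<Longrightarrow> y \<in> space M \<Longrightarrow> a' y \<in> {1..k}"
  using \<pi>_out[of "a' y"] b_range[of y] by (cases "a' y \<in> {1..k}") (auto simp: labelling_def)

section \<open>From a labelling back to a partition\<close>

definition atoms :: "('a \<Rightarrow> nat) \<Rightarrow> nat \<Rightarrow> 'a set" where
  "atoms a' i = {y\<in>space M. a' y = i}"

lemma sets_atoms: "labelling a' \<Longrightarrow> atoms a' i \<in> sets M"
proof -
  assume "labelling a'"
  then have [measurable]: "a' \<in> measurable M (count_space UNIV)" by (simp add: labelling_def)
  show ?thesis unfolding atoms_def by measurable
qed

lemma sets_disagreement: "labelling a' \<Longrightarrow> {y\<in>space M. a y \<noteq> a' y} \<in> sets M"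
proof -
  assume "labelling a'"
  then have [measurable]: "a' \<in> measurable M (count_space UNIV)" by (simp add: labelling_def)
  have "{y\<in>space M. \<not> (\<exists>l. a y = l \<and> a' y = l)} \<in> sets M" by measurable
  then show ?thesis by (simp add: eq_commute)
qed

lemma labelling_1: "labelling a' \<Longrightarrow> y \<in> space M \<Longrightarrow> a' y = 1 \<longleftrightarrow> b y = 1"
  using \<pi>1[of "a' y"] by (simp add: labelling_def del: One_nat_def)

lemma finite_part_atoms: "labelling a' \<Longrightarrow> finite_part M (atoms a') = Kb"
  using labelling_1[of a'] by (auto simp: finite_part_def atoms_def Kb_def)

lemma atoms_strongly_finer:
  assumes a': "labelling a'"
  shows "strongly_finer M k (atoms a') n B"
  unfolding strongly_finer_def finer_def
proof (intro conjI ballI)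
  show "eq_mod0 M (finite_part M (atoms a')) (finite_part M B)"
    unfolding finite_part_atoms[OF a']
    using finite_part_B by (subst eq_mod0_iff_AE) (auto elim: eventually_mono)
  fix j assume j: "j \<in> {1..n}"
  define J where "J = {i\<in>{1..k}. \<pi> i = j}"
  have "AE y in M. y \<in> B j \<longleftrightarrow> y \<in> (\<Union>i\<in>J. atoms a' i)"
    using a_B AE_space
  proof eventually_elim
    case (elim y)
    have "y \<in> B j \<longleftrightarrow> \<pi> (a' y) = j" using elim j a' by (simp add: labelling_def b_def)
    then show ?case using labelling_range[OF a' elim(2)] elim(2) by (auto simp: J_def atoms_def)
  qed
  moreover have "(\<Union>i\<in>J. atoms a' i) \<in> sets M" using sets_atoms[OF a'] by (intro sets.finite_UN) (auto simp: J_def)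
  ultimately show "\<exists>J\<subseteq>{1..k}. eq_mod0 M (B j) (\<Union>i\<in>J. atoms a' i)"
    using eq_mod0_iff_AE[OF sets_B[OF j]] by (intro exI[of _ J]) (auto simp: J_def)
qed

lemma AE_A0_1: "AE y in M. y \<in> A0 1 \<longleftrightarrow> b y = 1"
  using a_A0
proof eventually_elim
  case (elim y)
  have "1 \<in> {1..k}" using partition_sizes by simp
  then have "y \<in> A0 1 \<longleftrightarrow> a y = 1" using elim by blast
  then show ?case using b_1[of y] by simp
qed

text \<open>The point at risk is positivity: an atom of \<open>A0\<close> cannot disappear when
  labels change on a set of smaller measure. Atom 1 stays the same up to null sets.\<close>

lemma atoms_finite_partition:
  assumes a': "labelling a'" and d: "\<And>i. i \<in> {2..k} \<Longrightarrow> emeasure M {y\<in>space M. a y \<noteq> a' y} < emeasure M (A0 i)"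
  shows "finite_partition M k (atoms a')"
  unfolding finite_partition_def
proof (intro conjI ballI impI)
  have [measurable]: "a' \<in> measurable M (count_space UNIV)" using a' by (simp add: labelling_def)
  show "2 \<le> k" by (rule partition_sizes)
  show "atoms a' i \<in> sets M" for i by (rule sets_atoms[OF a'])
  show "atoms a' i \<inter> atoms a' j \<in> null_sets M" if "i \<noteq> j" for i j
  proof -
    have "atoms a' i \<inter> atoms a' j = {}" using that by (auto simp: atoms_def)
    then show ?thesis by simp
  qed
  have "space M - (\<Union>i\<in>{1..k}. atoms a' i) = {}" using labelling_range[OF a'] by (auto simp: atoms_def)
  then show "space M - (\<Union>i\<in>{1..k}. atoms a' i) \<in> null_sets M" by (simp only: null_sets.empty_sets)
  have 1: "1 \<in> {1..k}" using partition_sizes by simp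
  have "emeasure M (atoms a' 1) = emeasure M (A0 1)"
  proof (rule emeasure_eq_AE)
    show "AE y in M. y \<in> atoms a' 1 \<longleftrightarrow> y \<in> A0 1"
      using AE_A0_1 AE_space by eventually_elim (use labelling_1[OF a'] in \<open>auto simp: atoms_def\<close>)
  qed (use sets_atoms[OF a'] sets_A0[OF 1] in auto)
  then show inf: "emeasure M (atoms a' 1) = \<infinity>" using A0 by (simp add: finite_partition_def)
  show "emeasure M (atoms a' i) < \<infinity>" if i: "i \<in> {2..k}" for i
  proof -
    have "atoms a' i \<subseteq> Kb"
    proof
      fix y assume "y \<in> atoms a' i"
      then have y: "y \<in> space M" "a' y \<noteq> 1" using i by (auto simp: atoms_def)
      then show "y \<in> Kb" using labelling_1[OF a' y(1)] by (simp add: Kb_def)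
    qed
    then have "emeasure M (atoms a' i) \<le> emeasure M Kb" by (intro emeasure_mono) auto
    then show ?thesis using Kb_fin by (rule le_less_trans)
  qed
  show "0 < emeasure M (atoms a' i)" if i: "i \<in> {1..k}" for i
  proof (cases "i = 1")
    case True
    then show ?thesis using inf by simp
  next
    case False
    then have i2: "i \<in> {2..k}" using i by auto
    have "emeasure M (A0 i) \<le> emeasure M (atoms a' i \<union> {y\<in>space M. a y \<noteq> a' y})"
    proof (rule emeasure_mono_AE)
      show "AE y in M. y \<in> A0 i \<longrightarrow> y \<in> atoms a' i \<union> {y\<in>space M. a y \<noteq> a' y}"
        using a_A0 AE_space by eventually_elim (use i in \<open>auto simp: atoms_def\<close>)
    qed (intro sets.Un sets_atoms[OF a'] sets_disagreement[OF a'])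
    also have "\<dots> \<le> emeasure M (atoms a' i) + emeasure M {y\<in>space M. a y \<noteq> a' y}"
      by (intro emeasure_subadditive sets_atoms[OF a'] sets_disagreement[OF a'])
    finally have "emeasure M (A0 i) \<le> emeasure M (atoms a' i) + emeasure M {y\<in>space M. a y \<noteq> a' y}" .
    then show ?thesis using d[OF i2] by (cases "emeasure M (atoms a' i) = 0") (auto simp: zero_less_iff_neq_zero)
  qed
qed

lemma atoms_dist:
  assumes a': "labelling a'"
  shows "partition_dist M k A0 (atoms a') \<le> of_nat k * emeasure M {y\<in>space M. a y \<noteq> a' y}"
proof -
  have [measurable]: "a' \<in> measurable M (count_space UNIV)" using a' by (simp add: labelling_def)
  have "emeasure M (sym_diff (A0 i) (atoms a' i)) \<le> emeasure M {y\<in>space M. a y \<noteq> a' y}" if i: "i \<in> {1..k}" for i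
  proof (rule emeasure_mono_AE)
    show "AE y in M. y \<in> sym_diff (A0 i) (atoms a' i) \<longrightarrow> y \<in> {y\<in>space M. a y \<noteq> a' y}"
      using a_A0 AE_space by eventually_elim (use i in \<open>auto simp: atoms_def\<close>)
  qed (rule sets_disagreement[OF a'])
  then have "partition_dist M k A0 (atoms a') \<le> (\<Sum>i\<in>{2..k}. emeasure M {y\<in>space M. a y \<noteq> a' y})"
    unfolding partition_dist_def by (intro sum_mono) auto
  also have "\<dots> \<le> of_nat k * emeasure M {y\<in>space M. a y \<noteq> a' y}" by (auto intro!: mult_right_mono)
  finally show ?thesis .
qed

text \<open>A cylinder of finite measure prescribes a visit at some time \<open>i0\<close> of its
  window; otherwise its complement would lie in finitely many translates of \<open>Kb\<close> and
  the space would have finite measure. Recentred at \<open>i0\<close> it is an event inside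
  \<open>K\<close>, and the shift changes the number of visits in a window by at most
  \<open>N\<close>.\<close>

lemma atoms_uniform_partition:
  assumes a': "labelling a'"
    and U: "\<forall>P m \<epsilon>. window_determined m P \<longrightarrow> (\<forall>x. P x \<longrightarrow> x 0 \<noteq> 1) \<longrightarrow> \<epsilon> > 0 \<longrightarrow>
      (\<exists>c. AE y in M. near_freq (\<lambda>i. P (shift i (name a' y))) (freq P a') \<epsilon> c (name b y))"
  shows "uniform_partition M T S k (atoms a') (finite_part M (atoms a'))"
  unfolding uniform_partition_def finite_part_atoms[OF a']
proof (intro allI impI ballI)
  fix N :: nat and C
  assume N: "1 \<le> N" and C: "C \<in> iterated_join M T S k (atoms a') (- int N) (int N - 1)" and Cpf: "C \<in> pos_finite_sets M"
  define W where "W = {- int N..int N - 1}"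
  obtain t where Ct: "C = (\<Inter>i\<in>W. orb i -` atoms a' (t i) \<inter> space M)"
    using C unfolding in_iterated_join_iff W_def by blast
  have W0: "W \<noteq> {}" "finite W" using N by (auto simp: W_def)
  have inC: "y \<in> C \<longleftrightarrow> y \<in> space M \<and> (\<forall>i\<in>W. name a' y i = t i)" for y
    unfolding Ct using W0 measurable_space[OF measurable_orb, of y] by (auto simp: atoms_def name_def)
  have Cm [measurable]: "C \<in> sets M" and Cfin: "emeasure M C < \<infinity>" using Cpf by (auto simp: pos_finite_sets_def)
  have "\<exists>i0\<in>W. t i0 \<noteq> 1"
  proof (rule ccontr)
    assume no: "\<not> ?thesis"
    have sub: "space M \<subseteq> C \<union> (\<Union>i\<in>W. orb i -` Kb \<inter> space M)"
    proof
      fix y assume y: "y \<in> space M"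
      show "y \<in> C \<union> (\<Union>i\<in>W. orb i -` Kb \<inter> space M)"
      proof (cases "\<exists>i\<in>W. name a' y i \<noteq> 1")
        case True
        then obtain i where i: "i \<in> W" "name a' y i \<noteq> 1" by blast
        then have "name b y i \<noteq> 1" using name_\<pi>(2)[OF a' y] by simp
        then have "orb i y \<in> Kb" using measurable_space[OF measurable_orb y] by (simp add: Kb_def name_def)
        then show ?thesis using i y by blast
      next
        case False
        then have "y \<in> C" using inC no y by simp
        then show ?thesis ..
      qed
    qed
    have Um: "(\<Union>i\<in>W. orb i -` Kb \<inter> space M) \<in> sets M"
      using W0 by (intro sets.finite_UN) (auto intro: measurable_sets[OF measurable_orb])
    have "emeasure M (\<Union>i\<in>W. orb i -` Kb \<inter> space M) \<le> (\<Sum>i\<in>W. emeasure M (orb i -` Kb \<inter> space M))"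
      using W0 by (intro emeasure_subadditive_finite) (auto intro: measurable_sets[OF measurable_orb])
    also have "\<dots> = (\<Sum>i\<in>W. emeasure M Kb)" by (simp add: emeasure_orb)
    also have "\<dots> < \<infinity>" using Kb_fin W0 by (simp add: ennreal_mult_less_top less_top[symmetric] ennreal_mult_eq_top_iff)
    finally have "emeasure M C + emeasure M (\<Union>i\<in>W. orb i -` Kb \<inter> space M) < \<infinity>" using Cfin by simp
    moreover have "emeasure M (space M) \<le> emeasure M C + emeasure M (\<Union>i\<in>W. orb i -` Kb \<inter> space M)"
    proof -
      have "emeasure M (space M) \<le> emeasure M (C \<union> (\<Union>i\<in>W. orb i -` Kb \<inter> space M))"
        using sub Um by (intro emeasure_mono) auto
      also have "\<dots> \<le> emeasure M C + emeasure M (\<Union>i\<in>W. orb i -` Kb \<inter> space M)"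
        using Cm Um by (rule emeasure_subadditive)
      finally show ?thesis .
    qed
    ultimately have "emeasure M (space M) < \<infinity>" by (rule le_less_trans[rotated])
    then show False using space_inf by simp
  qed
  then obtain i0 where i0: "i0 \<in> W" "t i0 \<noteq> 1" by blast
  define P where "P = (\<lambda>x :: int \<Rightarrow> nat. \<forall>i\<in>W. x (i - i0) = t i)"
  \<comment> \<open>Two times of the window differ by less than \<open>2 * N\<close>.\<close>
  have Pw: "window_determined (2 * N) P"
    unfolding window_determined_def
  proof (intro allI impI)
    fix x y :: "int \<Rightarrow> nat" assume "\<forall>i. \<bar>i\<bar> \<le> int (2 * N) \<longrightarrow> x i = y i"
    then have "x (i - i0) = y (i - i0)" if "i \<in> W" for i using that i0 by (auto simp: W_def)
    then show "P x = P y" by (simp add: P_def)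
  qed
  have P1: "x 0 \<noteq> 1" if "P x" for x
  proof -
    have "x (i0 - i0) = t i0" using that i0(1) unfolding P_def by blast
    then show ?thesis using i0(2) by simp
  qed
  have P_shift: "P (shift (j + i0) x) \<longleftrightarrow> (\<forall>i\<in>W. shift j x i = t i)" for j x
    by (simp add: P_def shift_def algebra_simps)
  have orbC: "AE y in M. \<forall>j. orb j y \<in> C \<longleftrightarrow> P (shift (j + i0) (name a' y))"
    using AE_name_orb[of a'] AE_space
  proof eventually_elim
    case (elim y)
    show ?case unfolding P_shift using inC elim(1) measurable_space[OF measurable_orb elim(2)] by simp
  qed
  have am [measurable]: "a' \<in> measurable M (count_space UNIV)" using a' by (simp add: labelling_def)
  have Pm [measurable]: "Measurable.pred M (\<lambda>y. P (name a' y))" by (rule measurable_window_determined[OF am Pw])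
  have "emeasure M C = emeasure M (orb i0 -` {y\<in>space M. P (name a' y)} \<inter> space M)"
  proof (rule emeasure_eq_AE)
    show "AE y in M. y \<in> C \<longleftrightarrow> y \<in> orb i0 -` {y\<in>space M. P (name a' y)} \<inter> space M"
      using orbC AE_name_orb[of a'] AE_space
    proof eventually_elim
      case (elim y)
      have "y \<in> C \<longleftrightarrow> P (shift i0 (name a' y))" using elim(1)[rule_format, of 0] by simp
      then show ?case using elim(2) measurable_space[OF measurable_orb elim(3)] elim(3) by simp
    qed
  qed measurable
  also have "\<dots> = emeasure M {y\<in>space M. P (name a' y)}" by (rule emeasure_orb) measurable
  finally have "measure M C = measure M {y\<in>space M. P (name a' y)}" by (simp add: measure_def)
  then have fr: "freq P a' = measure M C / measure M Kb" unfolding freq_def K_def Kb_def by simp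
  define p where "p = measure M C / measure M Kb"
  have p0: "p \<ge> 0" by (simp add: p_def)
  show "uniform_set M T S C Kb"
    unfolding uniform_set_def
  proof (intro conjI allI impI)
    show "C \<in> pos_finite_sets M" by (rule Cpf)
    show "Kb \<in> pos_finite_sets M" using Kb_pos Kb_fin by (simp add: pos_finite_sets_def)
    fix \<epsilon> :: real assume \<epsilon>: "0 < \<epsilon>"
    obtain c where c: "AE y in M. near_freq (\<lambda>i. P (shift i (name a' y))) p (\<epsilon> / 2) c (name b y)"
    proof -
      have "\<forall>x. P x \<longrightarrow> x 0 \<noteq> 1" using P1 by blast
      then show ?thesis using U[THEN spec, of P, THEN spec, of "2 * N", THEN spec, of "\<epsilon> / 2"] Pw \<epsilon> that unfolding fr p_def by auto
    qed
    \<comment> \<open>The summands besides \<open>c\<close> pay for replacing the shifted window by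
      the centred one on both sides of the estimate.\<close>
    define c' where "c' = \<bar>c\<bar> + (\<epsilon> / 2 + p) * N"
    \<comment> \<open>From \<open>m\<close> visits on, the constant is less than
      \<open>\<epsilon> / 2\<close> per visit; this turns an additive constant back into a threshold
      on the visits.\<close>
    obtain m :: nat where m: "real m > c' / (\<epsilon> / 2)" using reals_Archimedean2 by blast
    have c'0: "c' \<ge> 0" using \<epsilon> p0 by (simp add: c'_def)
    then have m0: "real m > 0" using m \<epsilon> by (meson divide_nonneg_pos half_gt_zero le_less_trans)
    have mc: "c' < \<epsilon> / 2 * real m" using m \<epsilon> by (simp add: field_simps)
    show "\<exists>m::nat. AE y in M. y \<in> Kb \<longrightarrow> (\<forall>N. real m \<le> two_sided_sum T S N (indicator Kb) y \<longrightarrow>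
      \<bar>two_sided_sum T S N (indicator C) y / two_sided_sum T S N (indicator Kb) y - measure M C / measure M Kb\<bar> < \<epsilon>)"
    proof (rule exI[of _ m])
      show "AE y in M. y \<in> Kb \<longrightarrow> (\<forall>N. real m \<le> two_sided_sum T S N (indicator Kb) y \<longrightarrow>
        \<bar>two_sided_sum T S N (indicator C) y / two_sided_sum T S N (indicator Kb) y - measure M C / measure M Kb\<bar> < \<epsilon>)"
        using c orbC AE_space
      proof eventually_elim
        case (elim y)
        let ?x = "name b y"
        show ?case
        proof (intro impI allI)
          fix N' assume "y \<in> Kb" and ge: "real m \<le> two_sided_sum T S N' (indicator Kb) y"
          have win: "{- int N'..int N' - 1} = {- int N'..<int N'}" by auto
          define v where "v = sum (visit ?x) {- int N'..<int N'}"
          define v' where "v' = sum (visit ?x) {- int N' + i0..<int N' + i0}"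
          have K: "two_sided_sum T S N' (indicator Kb) y = v"
            unfolding two_sided_sum_def win v_def
            using measurable_space[OF measurable_orb elim(3)]
            by (intro sum.cong) (auto simp: visit_def name_def Kb_def indicator_def)
          have "two_sided_sum T S N' (indicator C) y = (\<Sum>j\<in>{- int N'..<int N'}. of_bool (P (shift (j + i0) (name a' y))))"
            unfolding two_sided_sum_def win using elim(2) by (intro sum.cong) (auto simp: indicator_def)
          also have "\<dots> = (\<Sum>j\<in>{- int N' + i0..<int N' + i0}. of_bool (P (shift j (name a' y))))"
            using sum_int_shift[of "\<lambda>j. of_bool (P (shift j (name a' y)))" i0 "- int N'" "int N'"] by (simp add: add.commute)
          finally have Cs: "two_sided_sum T S N' (indicator C) y = (\<Sum>j\<in>{- int N' + i0..<int N' + i0}. of_bool (P (shift j (name a' y))))" .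
          have 1: "\<bar>two_sided_sum T S N' (indicator C) y - p * v'\<bar> \<le> \<epsilon> / 2 * v' + c"
            unfolding Cs v'_def using elim(1) by simp
          have "\<bar>v' - v\<bar> \<le> \<bar>real_of_int i0\<bar>" unfolding v_def v'_def by (rule sum_visit_shift_diff) simp
          also have "\<dots> \<le> N" using i0(1) by (auto simp: W_def)
          finally have 2: "\<bar>v' - v\<bar> \<le> N" .
          have "\<bar>p * v' - p * v\<bar> = p * \<bar>v' - v\<bar>" using p0 by (simp add: abs_mult flip: right_diff_distrib)
          also have "\<dots> \<le> p * N" using 2 p0 by (rule mult_left_mono)
          finally have 3: "\<bar>p * v' - p * v\<bar> \<le> p * N" .
          have "\<epsilon> / 2 * v' \<le> \<epsilon> / 2 * (v + N)" using 2 \<epsilon> by (intro mult_left_mono) auto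
          then have "\<bar>two_sided_sum T S N' (indicator C) y - p * v\<bar> \<le> \<epsilon> / 2 * v + c'"
            using 1 3 unfolding c'_def by (simp add: algebra_simps)
          also have "\<dots> < \<epsilon> / 2 * v + \<epsilon> / 2 * v"
          proof -
            have "\<epsilon> / 2 * real m \<le> \<epsilon> / 2 * v" using ge K \<epsilon> by (intro mult_left_mono) auto
            then show ?thesis using mc by simp
          qed
          also have "\<dots> = \<epsilon> * v" by simp
          finally have 4: "\<bar>two_sided_sum T S N' (indicator C) y - p * v\<bar> < \<epsilon> * v" .
          have v: "v > 0" using ge m0 K by simp
          have "two_sided_sum T S N' (indicator C) y / v - p = (two_sided_sum T S N' (indicator C) y - p * v) / v"
            using v by (simp add: diff_divide_distrib)
          also have "\<bar>\<dots>\<bar> = \<bar>two_sided_sum T S N' (indicator C) y - p * v\<bar> / v" using v by simp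
          also have "\<dots> < \<epsilon>" using 4 v by (simp add: pos_divide_less_eq)
          finally show "\<bar>two_sided_sum T S N' (indicator C) y / two_sided_sum T S N' (indicator Kb) y - measure M C / measure M Kb\<bar> < \<epsilon>"
            unfolding K p_def .
        qed
      qed
    qed
  qed
qed

lemma uniform_partition_near:
  assumes \<epsilon>: "0 < \<epsilon>"
  shows "\<exists>A. finite_partition M k A \<and> strongly_finer M k A n B \<and>
    uniform_partition M T S k A (finite_part M A) \<and> partition_dist M k A0 A < ennreal \<epsilon>"
proof -
  have "\<exists>\<delta>>0::real. \<delta> * k < \<epsilon> \<and> (\<forall>i\<in>{2..k}. \<delta> < measure M (A0 i))"
  proof -
    \<comment> \<open>\<delta> must be below \<open>\<epsilon> / k\<close> for the distance and
      below the measure of each finite atom for its survival; half the least of these positive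
      numbers will do.\<close>
    define D where "D = insert (\<epsilon> / k) ((\<lambda>i. measure M (A0 i)) ` {2..k})"
    have k0: "real k > 0" using partition_sizes by simp
    have pos: "x > 0" if "x \<in> D" for x
    proof -
      have "measure M (A0 i) > 0" if "i \<in> {2..k}" for i
      proof -
        have "0 < emeasure M (A0 i)" "emeasure M (A0 i) < \<infinity>"
          using A0_pos[of i] A0_fin[of i] that by auto
        then show ?thesis by (simp add: measure_def enn2real_positive_iff less_top)
      qed
      then show ?thesis using that \<epsilon> k0 by (auto simp: D_def)
    qed
    have D: "finite D" "D \<noteq> {}" by (auto simp: D_def)
    define \<delta> where "\<delta> = Min D / 2"
    have "Min D > 0" using D pos by simp
    then have \<delta>0: "\<delta> > 0" by (simp add: \<delta>_def)
    have lt: "\<delta> < x" if "x \<in> D" for x using Min_le[OF D(1) that] \<open>Min D > 0\<close> by (simp add: \<delta>_def)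
    have "\<epsilon> / k \<in> D" by (simp add: D_def)
    then have "\<delta> < \<epsilon> / k" by (rule lt)
    then have "\<delta> * k < \<epsilon>" using k0 by (simp add: field_simps)
    moreover have "\<delta> < measure M (A0 i)" if "i \<in> {2..k}" for i using that by (intro lt) (auto simp: D_def)
    ultimately show ?thesis using \<delta>0 by (intro exI[of _ \<delta>] conjI ballI)
  qed
  then obtain \<delta> :: real where "\<delta> > 0 \<and> \<delta> * k < \<epsilon> \<and> (\<forall>i\<in>{2..k}. \<delta> < measure M (A0 i))" by (elim exE)
  then have \<delta>: "\<delta> > 0" "\<delta> * k < \<epsilon>" "\<And>i. i \<in> {2..k} \<Longrightarrow> \<delta> < measure M (A0 i)" by simp_all
  obtain a' where a': "labelling a'" and close: "emeasure M {y\<in>space M. a y \<noteq> a' y} \<le> ennreal \<delta>"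
    and U: "\<forall>P m \<epsilon>. window_determined m P \<longrightarrow> (\<forall>x. P x \<longrightarrow> x 0 \<noteq> 1) \<longrightarrow> \<epsilon> > 0 \<longrightarrow>
      (\<exists>c. AE y in M. near_freq (\<lambda>i. P (shift i (name a' y))) (freq P a') \<epsilon> c (name b y))"
    using uniform_refinement_exists[OF a_labelling \<delta>(1)] by (elim exE conjE) (rule that; assumption)
  have "emeasure M {y\<in>space M. a y \<noteq> a' y} < emeasure M (A0 i)" if i: "i \<in> {2..k}" for i
  proof -
    have "emeasure M (A0 i) = ennreal (measure M (A0 i))"
      using A0_fin[OF i] by (intro emeasure_eq_ennreal_measure) auto
    moreover have "ennreal \<delta> < ennreal (measure M (A0 i))" using \<delta>(1) \<delta>(3)[OF i] by (intro ennreal_lessI) auto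
    ultimately show ?thesis using le_less_trans[OF close] by simp
  qed
  then have fp: "finite_partition M k (atoms a')" by (rule atoms_finite_partition[OF a'])
  have "partition_dist M k A0 (atoms a') \<le> of_nat k * emeasure M {y\<in>space M. a y \<noteq> a' y}" by (rule atoms_dist[OF a'])
  also have "\<dots> \<le> of_nat k * ennreal \<delta>" using close by (intro mult_left_mono) auto
  also have "\<dots> = ennreal (\<delta> * k)" using \<delta>(1) by (simp add: ennreal_of_nat_eq_real_of_nat ennreal_mult mult.commute)
  also have "\<dots> < ennreal \<epsilon>" using \<delta> \<epsilon> by (intro ennreal_lessI) auto
  finally have "partition_dist M k A0 (atoms a') < ennreal \<epsilon>" .
  then show ?thesis
    using fp atoms_strongly_finer[OF a'] atoms_uniform_partition[OF a' U] by (intro exI[of _ "atoms a'"] conjI)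
qed

end

theorem lemma4p4:
  fixes M :: "'a measure" and T S :: "'a \<Rightarrow> 'a"
    and n k :: nat and B A0 :: "nat \<Rightarrow> 'a set" and \<epsilon> :: real
  assumes "infinite_mps M T S"
    and "ergodic M T"
    and "finite_partition M n B"
    and "uniform_partition M T S n B (finite_part M B)"
    and "finite_partition M k A0"
    and "strongly_finer M k A0 n B"
    and "0 < \<epsilon>" and "\<epsilon> < 1"
  shows "\<exists>A. finite_partition M k A
           \<and> strongly_finer M k A n B
           \<and> uniform_partition M T S k A (finite_part M A)
           \<and> partition_dist M k A0 A < ennreal \<epsilon>"
proof -
  interpret partition_pair M T S n k B A0
    using assms by unfold_locales
  obtain a \<pi> where "a \<in> measurable M (count_space UNIV)" "\<forall>y. a y \<in> {1..k}"
    "AE y in M. \<forall>i\<in>{1..k}. y \<in> A0 i \<longleftrightarrow> a y = i"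
    "\<forall>l. \<pi> l = 1 \<longleftrightarrow> l = 1" "\<forall>l\<in>{1..k}. \<pi> l \<in> {1..n}" "\<forall>l. l \<notin> {1..k} \<longrightarrow> \<pi> l \<notin> {1..n}"
    "AE y in M. \<forall>j\<in>{1..n}. y \<in> B j \<longleftrightarrow> \<pi> (a y) = j"
    using labels_exist by blast
  then interpret labelled_partition_pair M T S n k B A0 a \<pi>
    by unfold_locales blast+
  show ?thesis by (rule uniform_partition_near[OF \<open>0 < \<epsilon>\<close>])
qed

end
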